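(* Let $M$ be a nonelementary hyperbolic $3$-manifold (orientable or not) that has a virtually rank-$2$ cusp. Then $M$ contains infinitely many simple closed geodesics. In particular, every cusped finite-volume hyperbolic $3$-manifold contains infinitely many simple closed geodesics.
   Context: A hyperbolic $3$-manifold is a complete Riemannian $3$-manifold of constant curvature $-1$, i.e. $M=\mathbb{H}^3/\Gamma$ with $\Gamma\cong\pi_1(M)$ a discrete torsion-free subgroup of $\mathrm{Isom}(\mathbb{H}^3)$ (orientation-reversing isometries are allowed). $M$ is nonelementary if $\Gamma$ is a nonelementary group. A cusp of $M$ is an end with a neighbourhood (a horocusp) of the form $\mathcal{H}/\Gamma_{\mathcal H}$, embedded in $M$, where $\mathcal{H}\subset\mathbb{H}^3$ is a horoball and $\Gamma_{\mathcal H}\subset\Gamma$ is the nontrivial subgroup of elements stabilizing $\mathcal{H}$. The horosphere $\partial\mathcal{H}$ with its induced metric is a Euclidean plane $\mathbb{R}^2$, on which $\Gamma_{\mathcal H}$ acts as a discrete group $\Gamma_c$ of Euclidean isometries acting freely. The cusp is virtually rank-$2$ if $\Gamma_c$ contains a finite-index subgroup isomorphic to $\mathbb{Z}^2$. $M$ is cusped if it has at least one cusp. A closed geodesic is simple if it has no self-intersections. *)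

theory Defs
  imports "HOL-Analysis.Analysis" "HOL-Algebra.Algebra"
begin

section \<open>Hyperbolic 3-space\<close>

text \<open>
  The upper half-space model: points are pairs \<open>(z, t)\<close> with \<open>z\<close> complex and \<open>t > 0\<close>, with the
  Riemannian metric \<open>(|dz|^2 + dt^2) / t^2\<close>, whose distance function is given by
  \<open>cosh d((z,s),(w,t)) = 1 + (|z - w|^2 + (s - t)^2) / (2 s t)\<close>.
\<close>

typedef hyp3 = "{p :: complex \<times> real. snd p > 0}"
  by (intro exI[of _ "(0, 1)"]) simp

definition height :: "hyp3 \<Rightarrow> real" where
  "height x = snd (Rep_hyp3 x)"

lemma height_pos [simp]: "height x > 0"
  using Rep_hyp3[of x] by (simp add: height_def)

definition hyp_cosh :: "hyp3 \<Rightarrow> hyp3 \<Rightarrow> real" where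
  "hyp_cosh x y = 1 + (dist (Rep_hyp3 x) (Rep_hyp3 y))\<^sup>2 / (2 * height x * height y)"

lemma hyp_cosh_ge_1 [simp]: "hyp_cosh x y \<ge> 1"
  using less_imp_le[OF height_pos[of x]] less_imp_le[OF height_pos[of y]]
  by (simp add: hyp_cosh_def)

lemma hyp_cosh_commute: "hyp_cosh x y = hyp_cosh y x"
  by (simp add: hyp_cosh_def dist_commute mult.commute mult.left_commute)

text \<open>
  \<open>hyp_vec y x\<close> is the component of \<open>x\<close> orthogonal to \<open>y\<close> in the hyperboloid model, in suitable
  orthonormal coordinates; the triangle inequality is the Cauchy-Schwarz inequality for it.
\<close>

definition hyp_vec :: "hyp3 \<Rightarrow> hyp3 \<Rightarrow> real \<times> complex" where
  "hyp_vec y x =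
     (((norm (fst (Rep_hyp3 x) - fst (Rep_hyp3 y)))\<^sup>2 + (height x)\<^sup>2 - (height y)\<^sup>2)
        / (2 * height x * height y),
      (fst (Rep_hyp3 x) - fst (Rep_hyp3 y)) /\<^sub>R height x)"

lemma hyp_cosh_alt:
  "hyp_cosh x y = ((norm (fst (Rep_hyp3 x) - fst (Rep_hyp3 y)))\<^sup>2 + (height x)\<^sup>2 + (height y)\<^sup>2)
     / (2 * height x * height y)"
proof -
  have "height x \<noteq> 0" "height y \<noteq> 0"
    using height_pos[of x] height_pos[of y] by linarith+
  moreover have "(dist (Rep_hyp3 x) (Rep_hyp3 y))\<^sup>2 =
      (norm (fst (Rep_hyp3 x) - fst (Rep_hyp3 y)))\<^sup>2 + (height x - height y)\<^sup>2"
    by (simp add: dist_prod_def dist_norm height_def)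
  ultimately show ?thesis
    by (simp add: hyp_cosh_def field_simps power2_eq_square)
qed

lemma inner_pair_scaleR:
  fixes a b :: complex
  shows "inner (p::real, a /\<^sub>R s) (q, b /\<^sub>R r) = p * q + inner a b / (s * r)"
  unfolding inner_Pair inner_scaleR_left inner_scaleR_right inner_real_def
  by (simp add: divide_inverse)

lemma hyp_cosh_identity:
  fixes P Q D s t r :: real
  assumes nz: "s \<noteq> 0" "t \<noteq> 0" "r \<noteq> 0"
  shows "(P + Q - 2 * D) / (2 * s * r) =
      (P + t\<^sup>2) / (2 * s * t) * ((Q + t\<^sup>2) / (2 * r * t)) -
      ((P - t\<^sup>2) / (2 * s * t) * ((Q - t\<^sup>2) / (2 * r * t)) + D / (s * r))"
proof -
  have "(P + t\<^sup>2) * (Q + t\<^sup>2) - (P - t\<^sup>2) * (Q - t\<^sup>2) = 2 * (P + Q) * t\<^sup>2"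
    by (simp add: algebra_simps power2_eq_square)
  then have "(P + t\<^sup>2) / (2 * s * t) * ((Q + t\<^sup>2) / (2 * r * t)) -
      (P - t\<^sup>2) / (2 * s * t) * ((Q - t\<^sup>2) / (2 * r * t)) = 2 * (P + Q) * t\<^sup>2 / (2 * s * t * (2 * r * t))"
    by (simp add: diff_divide_distrib[symmetric])
  also have "\<dots> = (P + Q) / (2 * s * r)"
    using nz by (simp add: divide_simps power2_eq_square)
  finally show ?thesis by (simp add: diff_divide_distrib)
qed

lemma norm_hyp_vec_identity:
  fixes N s t :: real
  assumes nz: "s \<noteq> 0" "t \<noteq> 0"
  shows "((N + s\<^sup>2 - t\<^sup>2) / (2 * s * t))\<^sup>2 + N / s\<^sup>2 = ((N + s\<^sup>2 + t\<^sup>2) / (2 * s * t))\<^sup>2 - 1"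
proof -
  have "(N + s\<^sup>2 + t\<^sup>2)\<^sup>2 - (N + s\<^sup>2 - t\<^sup>2)\<^sup>2 = (2 * s * t)\<^sup>2 + 4 * N * t\<^sup>2"
    by (simp add: algebra_simps power2_eq_square)
  then have "((N + s\<^sup>2 + t\<^sup>2) / (2 * s * t))\<^sup>2 - ((N + s\<^sup>2 - t\<^sup>2) / (2 * s * t))\<^sup>2 = 
     ((2 * s * t)\<^sup>2 + 4 * N * t\<^sup>2) / (2 * s * t)\<^sup>2"
    by (simp add: power_divide diff_divide_distrib[symmetric])
  also have "\<dots> = 1 + N / s\<^sup>2"
    using nz by (simp add: add_divide_distrib power_mult_distrib)
  finally show ?thesis by simp
qed

lemma norm_hyp_vec: "(norm (hyp_vec y x))\<^sup>2 = (hyp_cosh x y)\<^sup>2 - 1"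
proof -
  define N where "N = (norm (fst (Rep_hyp3 x) - fst (Rep_hyp3 y)))\<^sup>2"
  have nz: "height x \<noteq> 0" "height y \<noteq> 0"
    using height_pos[of x] height_pos[of y] by linarith+
  have "(norm (hyp_vec y x))\<^sup>2 =
      ((N + (height x)\<^sup>2 - (height y)\<^sup>2) / (2 * height x * height y))\<^sup>2 + N / (height x)\<^sup>2"
    unfolding hyp_vec_def N_def[symmetric] power2_norm_eq_inner[of "(_, _)"] inner_pair_scaleR
    by (simp add: N_def power2_norm_eq_inner[symmetric]) (simp add: power2_eq_square)
  also have "\<dots> = ((N + (height x)\<^sup>2 + (height y)\<^sup>2) / (2 * height x * height y))\<^sup>2 - 1"
    by (rule norm_hyp_vec_identity[OF nz])
  finally show ?thesis
    by (simp add: hyp_cosh_alt N_def)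
qed

lemma hyp_cosh_vec:
  "hyp_cosh x z = hyp_cosh x y * hyp_cosh y z - inner (hyp_vec y x) (hyp_vec y z)"
proof -
  define a b s t r where "a = fst (Rep_hyp3 x) - fst (Rep_hyp3 y)"
    and "b = fst (Rep_hyp3 z) - fst (Rep_hyp3 y)"
    and "s = height x" and "t = height y" and "r = height z"
  have nz: "s \<noteq> 0" "t \<noteq> 0" "r \<noteq> 0"
    using height_pos[of x] height_pos[of y] height_pos[of z]
    unfolding s_def t_def r_def by linarith+
  define A B D where "A = inner a a" and "B = inner b b" and "D = inner a b"
  have diff: "fst (Rep_hyp3 x) - fst (Rep_hyp3 z) = a - b"
    by (simp add: a_def b_def)
  have "hyp_cosh x z = (A + B - 2 * D + s\<^sup>2 + r\<^sup>2) / (2 * s * r)"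
    unfolding hyp_cosh_alt diff power2_norm_eq_inner A_def B_def D_def s_def r_def
    by (simp add: inner_diff_left inner_diff_right inner_commute)
  moreover have "hyp_cosh x y = (A + s\<^sup>2 + t\<^sup>2) / (2 * s * t)"
    by (simp add: hyp_cosh_alt A_def a_def s_def t_def power2_norm_eq_inner)
  moreover have "hyp_cosh y z = (B + r\<^sup>2 + t\<^sup>2) / (2 * r * t)"
    by (subst hyp_cosh_commute) (simp add: hyp_cosh_alt B_def b_def r_def t_def power2_norm_eq_inner)
  moreover have "inner (hyp_vec y x) (hyp_vec y z) =
      ((A + s\<^sup>2 - t\<^sup>2) / (2 * s * t)) * ((B + r\<^sup>2 - t\<^sup>2) / (2 * r * t)) + D / (s * r)"
  proof -
    have "hyp_vec y x = ((A + s\<^sup>2 - t\<^sup>2) / (2 * s * t), a /\<^sub>R s)"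
      unfolding hyp_vec_def a_def[symmetric] s_def[symmetric] t_def[symmetric] A_def
        power2_norm_eq_inner ..
    moreover have "hyp_vec y z = ((B + r\<^sup>2 - t\<^sup>2) / (2 * r * t), b /\<^sub>R r)"
      unfolding hyp_vec_def b_def[symmetric] r_def[symmetric] t_def[symmetric] B_def
        power2_norm_eq_inner ..
    ultimately show ?thesis
      unfolding D_def by (simp only: inner_pair_scaleR)
  qed
  moreover have "(A + B - 2 * D + s\<^sup>2 + r\<^sup>2) / (2 * s * r) =
      (A + s\<^sup>2 + t\<^sup>2) / (2 * s * t) * ((B + r\<^sup>2 + t\<^sup>2) / (2 * r * t)) -
      (((A + s\<^sup>2 - t\<^sup>2) / (2 * s * t)) * ((B + r\<^sup>2 - t\<^sup>2) / (2 * r * t)) + D / (s * r))"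
    using hyp_cosh_identity[OF nz, of "A + s\<^sup>2" "B + r\<^sup>2" D] by (simp add: algebra_simps)
  ultimately show ?thesis by simp
qed

instantiation hyp3 :: metric_space
begin

definition dist_hyp3 :: "hyp3 \<Rightarrow> hyp3 \<Rightarrow> real" where
  "dist_hyp3 x y = arcosh (hyp_cosh x y)"

definition uniformity_hyp3 :: "(hyp3 \<times> hyp3) filter" where
  "uniformity_hyp3 = (INF e\<in>{0<..}. principal {(x, y). dist x y < e})"

definition open_hyp3 :: "hyp3 set \<Rightarrow> bool" where
  "open_hyp3 U = (\<forall>x\<in>U. eventually (\<lambda>(x', y). x' = x \<longrightarrow> y \<in> U) uniformity)"

instance
proof
  fix x y z :: hyp3
  have d: "dist u v = arcosh (hyp_cosh u v)" for u v :: hyp3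
    by (simp add: dist_hyp3_def)
  have "hyp_cosh x y = 1 \<longleftrightarrow> x = y"
    using less_imp_neq[OF height_pos[of x]] less_imp_neq[OF height_pos[of y]]
    by (auto simp: hyp_cosh_def Rep_hyp3_inject)
  then show "dist x y = 0 \<longleftrightarrow> x = y"
    by (simp add: d)
  have n: "norm (hyp_vec z u) = sinh (dist u z)" for u
    unfolding d sinh_arcosh_real[OF hyp_cosh_ge_1] norm_hyp_vec[symmetric] by simp
  have "hyp_cosh x y \<le> hyp_cosh x z * hyp_cosh z y + norm (hyp_vec z x) * norm (hyp_vec z y)"
    unfolding hyp_cosh_vec[of x y z] using Cauchy_Schwarz_ineq2[of "hyp_vec z x" "hyp_vec z y"]
    by linarith
  also have "\<dots> = cosh (dist x z + dist y z)"
    unfolding n cosh_add by (simp add: d hyp_cosh_commute)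
  finally have "cosh (dist x y) \<le> cosh (dist x z + dist y z)"
    by (simp add: d)
  moreover have "dist x y \<ge> 0" "dist x z + dist y z \<ge> 0"
    by (simp_all add: d)
  ultimately show "dist x y \<le> dist x z + dist y z"
    by (simp add: cosh_real_nonneg_le_iff)
qed (simp_all add: uniformity_hyp3_def open_hyp3_def)

end

text \<open>
  The Riemannian volume on the upper half-space has density \<open>1 / t^3\<close> with respect to
  Lebesgue measure.
\<close>

definition hyp_volume :: "hyp3 set \<Rightarrow> ennreal" where
  "hyp_volume A = (\<integral>\<^sup>+ p \<in> Rep_hyp3 ` A. ennreal (1 / snd p ^ 3) \<partial>lborel)"


section \<open>Isometries and hyperbolic 3-manifolds\<close>

definition hyp_isom :: "(hyp3 \<Rightarrow> hyp3) monoid" where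
  "hyp_isom = \<lparr>carrier = {f. bij f \<and> (\<forall>x y. dist (f x) (f y) = dist x y)},
               monoid.mult = (\<circ>), one = id\<rparr>"

lemma group_hyp_isom: "group hyp_isom"
proof (rule groupI)
  fix f assume "f \<in> carrier hyp_isom"
  then have f: "bij f" "\<And>x y. dist (f x) (f y) = dist x y"
    by (auto simp: hyp_isom_def)
  have "dist (inv_into UNIV f x) (inv_into UNIV f y) = dist x y" for x y
    using f(2)[of "inv_into UNIV f x" "inv_into UNIV f y"] bij_is_surj[OF f(1)] by (simp add: surj_f_inv_f)
  then show "\<exists>g\<in>carrier hyp_isom. g \<otimes>\<^bsub>hyp_isom\<^esub> f = \<one>\<^bsub>hyp_isom\<^esub>"
    using f(1) by (intro bexI[of _ "inv_into UNIV f"]) (auto simp: hyp_isom_def bij_imp_bij_inv bij_is_inj)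
qed (auto simp: hyp_isom_def bij_comp o_assoc)

text \<open>
  A hyperbolic 3-manifold \<open>M\<close> is given by the group \<open>\<Gamma>\<close> with \<open>M = H^3 / \<Gamma>\<close>. Discreteness refers to
  the product topology on functions, i.e. the topology of pointwise convergence, which on
  isometries coincides with the compact-open topology.
\<close>

definition hyperbolic_3_manifold :: "(hyp3 \<Rightarrow> hyp3) set \<Rightarrow> bool" where
  "hyperbolic_3_manifold \<Gamma> \<longleftrightarrow>
     subgroup \<Gamma> hyp_isom \<and>
     discrete \<Gamma> \<and>
     (\<forall>g\<in>\<Gamma>. \<forall>n>0. g [^]\<^bsub>hyp_isom\<^esub> (n :: nat) = \<one>\<^bsub>hyp_isom\<^esub> \<longrightarrow> g = \<one>\<^bsub>hyp_isom\<^esub>)"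

text \<open>The covering projection onto \<open>M\<close>; a point of \<open>M\<close> is an orbit of \<open>\<Gamma>\<close>.\<close>

definition orbit_proj :: "(hyp3 \<Rightarrow> hyp3) set \<Rightarrow> hyp3 \<Rightarrow> hyp3 set" where
  "orbit_proj \<Gamma> x = (\<lambda>g. g x) ` \<Gamma>"

text \<open>
  The sphere at infinity is the one-point compactification of the plane \<open>t = 0\<close>, where \<open>None\<close> is
  the point at infinity. The limit set is the set of its points at which an orbit accumulates.
\<close>

definition limit_set :: "(hyp3 \<Rightarrow> hyp3) set \<Rightarrow> complex option set" where
  "limit_set \<Gamma> =
     {Some z | z. \<exists>x. (z, 0) islimpt Rep_hyp3 ` orbit_proj \<Gamma> x} \<union>
     {\<xi>. \<xi> = None \<and> (\<exists>x. \<not> bounded (Rep_hyp3 ` orbit_proj \<Gamma> x))}"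

definition elementary :: "(hyp3 \<Rightarrow> hyp3) set \<Rightarrow> bool" where
  "elementary \<Gamma> \<longleftrightarrow> finite (limit_set \<Gamma>) \<and> card (limit_set \<Gamma>) \<le> 2"


section \<open>Cusps\<close>

text \<open>
  Open horoballs: those centred at infinity, and those centred at a point \<open>(z, 0)\<close>, which are the
  Euclidean balls tangent to the plane \<open>t = 0\<close> there.
\<close>

definition horoball :: "hyp3 set \<Rightarrow> bool" where
  "horoball H \<longleftrightarrow>
     (\<exists>h>0. H = {x. height x > h}) \<or>
     (\<exists>z. \<exists>r>0. H = {x. dist (Rep_hyp3 x) (z, r) < r})"

definition set_stabilizer :: "(hyp3 \<Rightarrow> hyp3) set \<Rightarrow> hyp3 set \<Rightarrow> (hyp3 \<Rightarrow> hyp3) set" where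
  "set_stabilizer \<Gamma> H = {g \<in> \<Gamma>. g ` H = H}"

text \<open>
  The second condition says that the quotient of \<open>H\<close> by its stabilizer embeds in \<open>M\<close>.
\<close>

definition horocusp :: "(hyp3 \<Rightarrow> hyp3) set \<Rightarrow> hyp3 set \<Rightarrow> bool" where
  "horocusp \<Gamma> H \<longleftrightarrow>
     horoball H \<and>
     (\<forall>x\<in>H. \<forall>g\<in>\<Gamma>. g x \<in> H \<longrightarrow> g \<in> set_stabilizer \<Gamma> H) \<and>
     set_stabilizer \<Gamma> H \<noteq> {\<one>\<^bsub>hyp_isom\<^esub>}"

definition cusped :: "(hyp3 \<Rightarrow> hyp3) set \<Rightarrow> bool" where
  "cusped \<Gamma> \<longleftrightarrow> (\<exists>H. horocusp \<Gamma> H)"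

text \<open>
  The group of transformations of the horosphere (the frontier of \<open>H\<close>) induced by the stabilizer
  of \<open>H\<close>.
\<close>

definition cusp_group :: "(hyp3 \<Rightarrow> hyp3) set \<Rightarrow> hyp3 set \<Rightarrow> (hyp3 \<Rightarrow> hyp3) monoid" where
  "cusp_group \<Gamma> H =
     (BijGroup (frontier H))\<lparr>carrier := (\<lambda>g. restrict g (frontier H)) ` set_stabilizer \<Gamma> H\<rparr>"

definition virtually_rank_2 :: "('a, 'b) monoid_scheme \<Rightarrow> bool" where
  "virtually_rank_2 G \<longleftrightarrow>
     (\<exists>A. subgroup A G \<and> finite (rcosets\<^bsub>G\<^esub> A) \<and>
          G\<lparr>carrier := A\<rparr> \<cong> integer_group \<times>\<times> integer_group)"

definition has_virtually_rank_2_cusp :: "(hyp3 \<Rightarrow> hyp3) set \<Rightarrow> bool" where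
  "has_virtually_rank_2_cusp \<Gamma> \<longleftrightarrow>
     (\<exists>H. horocusp \<Gamma> H \<and> virtually_rank_2 (cusp_group \<Gamma> H))"


section \<open>Volume\<close>

text \<open>
  The volume of \<open>M\<close> is the volume of a Borel set of representatives of the orbits. For a discrete
  torsion-free \<open>\<Gamma>\<close> such sets exist and all have the same volume.
\<close>

definition fundamental_set :: "(hyp3 \<Rightarrow> hyp3) set \<Rightarrow> hyp3 set \<Rightarrow> bool" where
  "fundamental_set \<Gamma> F \<longleftrightarrow>
     F \<in> sets borel \<and> bij_betw (orbit_proj \<Gamma>) F (range (orbit_proj \<Gamma>))"

definition manifold_volume :: "(hyp3 \<Rightarrow> hyp3) set \<Rightarrow> ennreal" where
  "manifold_volume \<Gamma> = (INF F \<in> {F. fundamental_set \<Gamma> F}. hyp_volume F)"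


section \<open>Closed geodesics\<close>

definition geodesic_line :: "(real \<Rightarrow> hyp3) \<Rightarrow> bool" where
  "geodesic_line \<gamma> \<longleftrightarrow> (\<forall>s t. dist (\<gamma> s) (\<gamma> t) = \<bar>s - t\<bar>)"

text \<open>
  As the projection is a local isometry, the complete unit-speed geodesics of \<open>M\<close> are
  the projections of the geodesic lines of hyperbolic space. Periodicity over the whole line
  makes the geodesic close up smoothly.
\<close>

definition closed_geodesic ::
    "(hyp3 \<Rightarrow> hyp3) set \<Rightarrow> (real \<Rightarrow> hyp3 set) \<Rightarrow> real \<Rightarrow> bool" where
  "closed_geodesic \<Gamma> c l \<longleftrightarrow>
     (\<exists>\<gamma>. geodesic_line \<gamma> \<and> c = orbit_proj \<Gamma> \<circ> \<gamma>) \<and>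
     l > 0 \<and> (\<forall>t. c (t + l) = c t)"

text \<open>
  Simple closed geodesics are regarded as subsets of \<open>M\<close>, so that reparametrizations of the same
  geodesic are not counted separately.
\<close>

definition simple_closed_geodesics :: "(hyp3 \<Rightarrow> hyp3) set \<Rightarrow> hyp3 set set set" where
  "simple_closed_geodesics \<Gamma> = {range c | c. \<exists>l. closed_geodesic \<Gamma> c l \<and> inj_on c {0..<l}}"

end

theory Submission
  imports Defs
begin

text \<open>
  Put the cusp at infinity of the upper half-space, and let \<open>H\<close> be the horoball above height 1. After
  rescaling, \<open>H\<close> is disjoint from its translates but almost touches one of them, which rests on a point
  \<open>b\<close> and is mapped to \<open>H\<close> by an element \<open>g\<close> (\<open>maximal_cusp\<close>). Let \<open>a\<close> be the image of infinity
  under \<open>g\<close>. For an element \<open>q\<close> of the cusp group let \<open>h = q \<circ> g\<close>. If \<open>q a\<close> is far away from \<open>b\<close>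
  then \<open>h\<close> is hyperbolic, and its axis is a large half-circle joining a point close to \<open>b\<close> to a point
  close to \<open>q a\<close> (\<open>axis_exists\<close>). In the quotient this is a closed geodesic that makes one
  long excursion into the cusp. The claim is that it is simple for suitable \<open>q\<close>. As the excursions can
  be made arbitrarily high, there are infinitely many such geodesics.

  Suppose that an element \<open>k\<close> of the group maps a point of a fundamental arc of the axis to another point
  of it (\<open>arc_embedded\<close>). The arc stays above a height slightly less than 1. If \<open>k\<close> is not
  in the cusp group, it maps a point at height \<open>t\<close> to height at most \<open>1 / t\<close>, so both points have
  height close to 1 and lie near the ends of the arc. Since different translates of \<open>H\<close> are disjoint,
  \<open>k\<close> then agrees with \<open>h\<close> or its inverse up to elements of the cusp groups involved
  (\<open>near_pole_imp_coset\<close>). These are trivial, as in a torsion-free discrete group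
  no nontrivial element fixes two parabolic points, and none exchanges them. Thus \<open>k\<close> is \<open>h\<close> or its
  inverse, which match the two ends of the arc only.

  If \<open>k\<close> is in the cusp group then it preserves heights, so it exchanges two points of the half-circle
  that are symmetric about its top. Projecting to the boundary plane leaves a problem about groups of
  Euclidean motions acting freely on the plane: find \<open>q\<close> such that \<open>q a\<close> is far from \<open>b\<close> and no nontrivial
  motion folds the segment from \<open>b\<close> to \<open>q a\<close>, even after a small perturbation of its ends
  (\<open>rank2_stably_unfoldable\<close>). One makes the segment long in the direction of a translation \<open>v\<close> while
  keeping its width across \<open>v\<close> smaller than all shifts of motions across \<open>v\<close>. Such a choice
  of \<open>v\<close> exists because \<open>a\<close> is not in the orbit of \<open>b\<close>, except that with glide reflections the width may
  have to equal the smallest shift, and then the position of the glide axes excludes a fold.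

  A virtually rank-2 cusp supplies two independent translations. A cusp of a manifold of finite volume
  does so as well, and the group is larger than the cusp group, since otherwise the quotient would contain
  infinitely many disjoint balls of the same size. This uses the invariance of hyperbolic volume under
  isometries, which follows from the Vitali covering theorem (\<open>vol_isometry_image\<close>).

  An isometry of hyperbolic space enters these arguments through its effect on heights
  (\<open>hyp_isometry_height_cases\<close>): up to a Euclidean similarity it is the identity or an inversion.
\<close>

section \<open>Isometries of the upper half-space\<close>

definition mk :: "complex \<Rightarrow> real \<Rightarrow> hyp3" where "mk z t = Abs_hyp3 (z, t)"

abbreviation base :: "hyp3 \<Rightarrow> complex" where "base x \<equiv> fst (Rep_hyp3 x)"

lemma Rep_mk [simp]: "t > 0 \<Longrightarrow> Rep_hyp3 (mk z t) = (z, t)"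
  by (simp add: mk_def Abs_hyp3_inverse)

lemma height_mk [simp]: "t > 0 \<Longrightarrow> height (mk z t) = t"
  by (simp add: height_def)

lemma mk_base_height [simp]: "mk (base x) (height x) = x"
  by (simp add: mk_def height_def Rep_hyp3_inverse)

lemma Rep_eq: "Rep_hyp3 x = (base x, height x)"
  by (simp add: height_def)

lemma height_nz [simp]: "height x \<noteq> 0"
  using height_pos[of x] by linarith

lemma hyp3_eqI: "base x = base y \<Longrightarrow> height x = height y \<Longrightarrow> x = y"
  by (metis mk_base_height)

lemma cosh_dist: "cosh (dist x y) = hyp_cosh x y" for x y :: hyp3
  by (simp add: dist_hyp3_def)

lemma dist_eq_iff: "dist x y = dist u v \<longleftrightarrow> hyp_cosh x y = hyp_cosh u v" for x y u v :: hyp3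
  by (metis cosh_dist dist_hyp3_def)

lemma dist_Pair_sq: "(dist (z, s) (w, t))\<^sup>2 = (norm (z - w))\<^sup>2 + (s - t)\<^sup>2" for z w :: complex and s t :: real
  by (simp add: dist_prod_def dist_norm)

lemma dist_Rep_sq: "(dist (Rep_hyp3 x) (w, t))\<^sup>2 = (norm (base x - w))\<^sup>2 + (height x - t)\<^sup>2"
  by (metis Rep_eq dist_Pair_sq)

definition hyp_isometry :: "(hyp3 \<Rightarrow> hyp3) \<Rightarrow> bool" where
  "hyp_isometry f \<longleftrightarrow> bij f \<and> (\<forall>x y. dist (f x) (f y) = dist x y)"

lemma hyp_isometry_cosh: "hyp_isometry f \<Longrightarrow> hyp_cosh (f x) (f y) = hyp_cosh x y"
  by (metis dist_eq_iff hyp_isometry_def)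

lemma hyp_isometry_comp: "hyp_isometry f \<Longrightarrow> hyp_isometry g \<Longrightarrow> hyp_isometry (f \<circ> g)"
  by (auto simp: hyp_isometry_def bij_comp)

lemma hyp_isometry_inv:
  assumes "hyp_isometry f" shows "hyp_isometry (inv_into UNIV f)"
proof -
  have s: "f (inv_into UNIV f x) = x" for x
    using assms by (simp add: bij_is_surj surj_f_inv_f hyp_isometry_def)
  have "dist (inv_into UNIV f x) (inv_into UNIV f y) = dist x y" for x y
    using assms s unfolding hyp_isometry_def by metis
  then show ?thesis using assms by (auto simp: hyp_isometry_def bij_imp_bij_inv)
qed

text \<open>
  The function \<open>1 / height\<close> is the limit of the functions \<open>2 / s * cosh d(_, (0, s))\<close>. Transporting
  this by an isometry shows that \<open>height x / height (f x)\<close> is a limit of polynomials of the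
  form \<open>\<alpha> |x|^2 - 2 z \<cdot> \<zeta> + \<gamma>\<close> whose discriminants tend to 0: in the limit it is a
  constant or a multiple of the square of the distance to a point of the boundary plane.
\<close>

lemma hyp_isometry_height_cases:
  assumes f: "hyp_isometry f"
  obtains (affine) l where "l > 0" "\<And>x. height (f x) = l * height x"
    | (inversive) b r where "r > 0" "\<And>x. height (f x) = r * height x / (dist (Rep_hyp3 x) (b, 0))\<^sup>2"
proof -
  define g where "g = inv_into UNIV f"
  have g: "hyp_isometry g" using hyp_isometry_inv f g_def by simp
  have gf: "g (f x) = x" for x
    using f by (simp add: g_def hyp_isometry_def bij_is_inj)
  define s where "s n = real (Suc n)" for n
  have s: "s n > 0" for n by (simp add: s_def)
  define y where "y n = g (mk 0 (s n))" for n
  define Z where "Z n = base (y n)" for n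
  define T where "T n = height (y n)" for n
  have T: "T n > 0" for n by (simp add: T_def)
  define \<alpha> where "\<alpha> n = 1 / (s n * T n)" for n
  define \<gamma> where "\<gamma> n = ((norm (Z n))\<^sup>2 + (T n)\<^sup>2) / (s n * T n)" for n
  define \<zeta> where "\<zeta> n = Re (Z n) / (s n * T n)" for n
  define \<eta> where "\<eta> n = Im (Z n) / (s n * T n)" for n
  define L where "L x n = \<alpha> n * ((norm (base x))\<^sup>2 + (height x)\<^sup>2) + \<gamma> n
     - 2 * (Re (base x) * \<zeta> n + Im (base x) * \<eta> n)" for x n
  have eq: "L x n = height x * ((norm (base (f x)))\<^sup>2 + (height (f x))\<^sup>2 + (s n)\<^sup>2) / (height (f x) * (s n)\<^sup>2)" for x n
  proof -
    have "hyp_cosh (f x) (mk 0 (s n)) = hyp_cosh x (y n)"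
      using hyp_isometry_cosh[OF g, of "f x" "mk 0 (s n)"] by (simp add: gf y_def)
    then have h: "((norm (base (f x)))\<^sup>2 + (height (f x))\<^sup>2 + (s n)\<^sup>2) / (2 * height (f x) * s n)
      = ((norm (base x - Z n))\<^sup>2 + (height x)\<^sup>2 + (T n)\<^sup>2) / (2 * height x * T n)"
      using s[of n] by (simp add: hyp_cosh_alt Z_def T_def)
    have nn: "(norm (base x - Z n))\<^sup>2 = (norm (base x))\<^sup>2 + (norm (Z n))\<^sup>2 - 2 * (Re (base x) * Re (Z n) + Im (base x) * Im (Z n))"
      unfolding cmod_power2 by (simp add: power2_eq_square algebra_simps)
    have "L x n = ((norm (base x - Z n))\<^sup>2 + (height x)\<^sup>2 + (T n)\<^sup>2) / (s n * T n)"
      unfolding nn L_def \<alpha>_def \<gamma>_def \<zeta>_def \<eta>_def by (simp add: add_divide_distrib diff_divide_distrib algebra_simps)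
    also have "\<dots> = (2 * height x / s n) * (((norm (base x - Z n))\<^sup>2 + (height x)\<^sup>2 + (T n)\<^sup>2) / (2 * height x * T n))"
      by simp
    also have "\<dots> = height x * ((norm (base (f x)))\<^sup>2 + (height (f x))\<^sup>2 + (s n)\<^sup>2) / (height (f x) * (s n)\<^sup>2)"
      unfolding h[symmetric] by (simp add: power2_eq_square)
    finally show ?thesis .
  qed
  define K where "K x = height x / height (f x)" for x
  have s_lim: "(\<lambda>n. 1 / (s n)\<^sup>2) \<longlonglongrightarrow> 0"
  proof -
    have "(\<lambda>n. (1 / s n)\<^sup>2) \<longlonglongrightarrow> 0\<^sup>2"
      using LIMSEQ_inverse_real_of_nat unfolding s_def by (intro tendsto_power) (simp add: inverse_eq_divide)
    then show ?thesis by (simp add: power_one_over)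
  qed
  have LK: "L x \<longlonglongrightarrow> K x" for x
  proof -
    have e: "L x = (\<lambda>n. height x / height (f x) * (((norm (base (f x)))\<^sup>2 + (height (f x))\<^sup>2) * (1 / (s n)\<^sup>2) + 1))"
    proof
      fix n
      have "((norm (base (f x)))\<^sup>2 + (height (f x))\<^sup>2 + (s n)\<^sup>2) / (s n)\<^sup>2
          = ((norm (base (f x)))\<^sup>2 + (height (f x))\<^sup>2) * (1 / (s n)\<^sup>2) + 1"
        using s[of n] by (simp add: add_divide_distrib)
      then show "L x n = height x / height (f x) * (((norm (base (f x)))\<^sup>2 + (height (f x))\<^sup>2) * (1 / (s n)\<^sup>2) + 1)"
        unfolding eq by (metis times_divide_times_eq)
    qed
    have "(\<lambda>n. height x / height (f x) * (((norm (base (f x)))\<^sup>2 + (height (f x))\<^sup>2) * (1 / (s n)\<^sup>2) + 1)) \<longlonglongrightarrow>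
       height x / height (f x) * (((norm (base (f x)))\<^sup>2 + (height (f x))\<^sup>2) * 0 + 1)"
      by (intro tendsto_intros s_lim)
    then show ?thesis unfolding e K_def by simp
  qed
  have A: "(\<lambda>n. (L (mk 0 2) n - L (mk 0 1) n) / 3) \<longlonglongrightarrow> (K (mk 0 2) - K (mk 0 1)) / 3"
    by (rule tendsto_divide[OF tendsto_diff[OF LK LK] tendsto_const]) simp
  define a where "a = (K (mk 0 2) - K (mk 0 1)) / 3"
  have \<alpha>: "\<alpha> \<longlonglongrightarrow> a" using A by (simp add: L_def a_def)
  have "(\<lambda>n. L (mk 0 1) n - \<alpha> n) \<longlonglongrightarrow> K (mk 0 1) - a" by (rule tendsto_diff[OF LK \<alpha>])
  then obtain c where \<gamma>: "\<gamma> \<longlonglongrightarrow> c" by (simp add: L_def)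
  have "(\<lambda>n. (2 * \<alpha> n + \<gamma> n - L (mk 1 1) n) / 2) \<longlonglongrightarrow> (2 * a + c - K (mk 1 1)) / 2"
    by (rule tendsto_divide[OF tendsto_diff[OF tendsto_add[OF tendsto_mult[OF tendsto_const \<alpha>] \<gamma>] LK] tendsto_const]) simp
  then obtain p where \<zeta>: "\<zeta> \<longlonglongrightarrow> p" by (simp add: L_def)
  have "(\<lambda>n. (2 * \<alpha> n + \<gamma> n - L (mk \<i> 1) n) / 2) \<longlonglongrightarrow> (2 * a + c - K (mk \<i> 1)) / 2"
    by (rule tendsto_divide[OF tendsto_diff[OF tendsto_add[OF tendsto_mult[OF tendsto_const \<alpha>] \<gamma>] LK] tendsto_const]) simp
  then obtain q where \<eta>: "\<eta> \<longlonglongrightarrow> q" by (simp add: L_def)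
  have K: "K x = a * ((norm (base x))\<^sup>2 + (height x)\<^sup>2) + c - 2 * (Re (base x) * p + Im (base x) * q)" for x
  proof (rule LIMSEQ_unique[OF LK])
    show "L x \<longlonglongrightarrow> a * ((norm (base x))\<^sup>2 + (height x)\<^sup>2) + c - 2 * (Re (base x) * p + Im (base x) * q)"
      unfolding L_def by (intro tendsto_intros \<alpha> \<gamma> \<zeta> \<eta>)
  qed
  have disc: "a * c = p\<^sup>2 + q\<^sup>2"
  proof -
    have "\<alpha> n * \<gamma> n - ((\<zeta> n)\<^sup>2 + (\<eta> n)\<^sup>2) = 1 / (s n)\<^sup>2" for n
    proof -
      define D where "D = s n * T n"
      have "\<alpha> n * \<gamma> n - ((\<zeta> n)\<^sup>2 + (\<eta> n)\<^sup>2) =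
          ((Re (Z n))\<^sup>2 + (Im (Z n))\<^sup>2 + (T n)\<^sup>2) / D\<^sup>2 - ((Re (Z n))\<^sup>2 / D\<^sup>2 + (Im (Z n))\<^sup>2 / D\<^sup>2)"
        unfolding \<alpha>_def \<gamma>_def \<zeta>_def \<eta>_def cmod_power2 D_def[symmetric] power_divide
        by (simp add: power2_eq_square)
      also have "\<dots> = (T n)\<^sup>2 / D\<^sup>2" by (simp add: add_divide_distrib)
      also have "\<dots> = 1 / (s n)\<^sup>2" using T[of n] by (simp add: D_def power_mult_distrib)
      finally show ?thesis .
    qed
    then have l0: "(\<lambda>n. \<alpha> n * \<gamma> n - ((\<zeta> n)\<^sup>2 + (\<eta> n)\<^sup>2)) \<longlonglongrightarrow> 0" using s_lim by simp
    have "(\<lambda>n. \<alpha> n * \<gamma> n - ((\<zeta> n)\<^sup>2 + (\<eta> n)\<^sup>2)) \<longlonglongrightarrow> a * c - (p\<^sup>2 + q\<^sup>2)"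
      by (intro tendsto_intros \<alpha> \<gamma> \<zeta> \<eta>)
    from LIMSEQ_unique[OF this l0] show ?thesis by simp
  qed
  have Kpos: "K x > 0" for x by (simp add: K_def)
  have hf: "height (f x) = height x / K x" for x by (simp add: K_def)
  have "a \<ge> 0"
    by (rule LIMSEQ_le_const[OF \<alpha>]) (auto simp: \<alpha>_def less_imp_le s T)
  show thesis
  proof (cases "a = 0")
    case True
    then have "p = 0" "q = 0" using disc by (auto simp: sum_power2_eq_zero_iff)
    then have "K x = c" for x using K True by simp
    moreover from this have "c > 0" using Kpos by metis
    ultimately show thesis using hf by (intro affine[of "1 / c"]) auto
  next
    case False
    with \<open>a \<ge> 0\<close> have a: "a > 0" by simp
    define p' q' where "p' = p / a" and "q' = q / a"
    have p: "p = a * p'" "q = a * q'" using a by (simp_all add: p'_def q'_def)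
    have "a * c = a * (a * (p'\<^sup>2 + q'\<^sup>2))" unfolding disc p by (simp add: algebra_simps power2_eq_square)
    then have c: "c = a * (p'\<^sup>2 + q'\<^sup>2)" using a by simp
    define b where "b = Complex p' q'"
    have "K x = a * (dist (Rep_hyp3 x) (b, 0))\<^sup>2" for x
      unfolding K dist_Rep_sq cmod_power2 b_def p c
      by (simp add: algebra_simps power2_eq_square)
    then have "height (f x) = 1 / a * height x / (dist (Rep_hyp3 x) (b, 0))\<^sup>2" for x using hf by simp
    then show thesis using a by (intro inversive[of "1 / a" b]) auto
  qed
qed

text \<open>
  An isometry preserving heights acts on all horospheres about infinity by the same motion of
  the plane, its shadow.
\<close>

definition shadow :: "(hyp3 \<Rightarrow> hyp3) \<Rightarrow> complex \<Rightarrow> complex" where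
  "shadow f z = base (f (mk z 1))"

definition lift :: "(complex \<Rightarrow> complex) \<Rightarrow> hyp3 \<Rightarrow> hyp3" where
  "lift s x = mk (s (base x)) (height x)"

lemma height_lift [simp]: "height (lift s x) = height x"
  and base_lift [simp]: "base (lift s x) = s (base x)"
  by (simp_all add: lift_def)

lemma height_preserving_isometry:
  assumes f: "hyp_isometry f" and h: "\<And>x. height (f x) = height x"
  shows "f x = lift (shadow f) x" "dist (shadow f z) (shadow f w) = dist z w"
proof -
  have *: "(norm (base (f x) - base (f y)))\<^sup>2 = (norm (base x - base y))\<^sup>2" for x y
    using hyp_isometry_cosh[OF f, of x y] by (simp add: hyp_cosh_alt h)
  have "(norm (base (f x) - base (f (mk (base x) 1))))\<^sup>2 = 0"
    unfolding * by simp
  then have "base (f x) = shadow f (base x)"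
    by (simp add: shadow_def)
  then show "f x = lift (shadow f) x" by (intro hyp3_eqI) (simp_all add: h)
  show "dist (shadow f z) (shadow f w) = dist z w"
    using *[of "mk z 1" "mk w 1"] by (simp add: shadow_def dist_norm)
qed

lemma shadow_comp:
  assumes "hyp_isometry f" "\<And>x. height (f x) = height x" "\<And>x. height (g x) = height x" 
  shows "shadow (f \<circ> g) = shadow f \<circ> shadow g"
proof
  fix z
  have "f (g (mk z 1)) = lift (shadow f) (g (mk z 1))"
    by (rule height_preserving_isometry(1)[OF assms(1,2)])
  then show "shadow (f \<circ> g) z = (shadow f \<circ> shadow g) z" by (simp add: shadow_def[of "f \<circ> g"] shadow_def[of g])
qed

subsection \<open>Inversions\<close>

text \<open>Inversion of the ambient Euclidean space in the unit sphere about a boundary point.\<close>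

definition einv :: "complex \<Rightarrow> complex \<times> real \<Rightarrow> complex \<times> real" where
  "einv b p = (b, 0) + (p - (b, 0)) /\<^sub>R (dist p (b, 0))\<^sup>2"

text \<open>
  Expanding the inner products shows that inversion divides distances by the product of the
  distances from the centre.
\<close>

lemma dist_inversion:
  fixes u v :: "'a::real_inner"
  assumes "u \<noteq> 0" "v \<noteq> 0"
  shows "dist (u /\<^sub>R (norm u)\<^sup>2) (v /\<^sub>R (norm v)\<^sup>2) = dist u v / (norm u * norm v)"
proof (rule power2_eq_imp_eq)
  define n m where "n = norm u" and "m = norm v"
  have nm: "n > 0" "m > 0" using assms by (auto simp: n_def m_def)
  have i: "inner u u = n\<^sup>2" "inner v v = m\<^sup>2" by (simp_all add: n_def m_def power2_norm_eq_inner)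
  have "(dist (u /\<^sub>R n\<^sup>2) (v /\<^sub>R m\<^sup>2))\<^sup>2 = inner u u / (n\<^sup>2)\<^sup>2 - 2 * inner u v / (n\<^sup>2 * m\<^sup>2) + inner v v / (m\<^sup>2)\<^sup>2"
    unfolding dist_norm power2_norm_eq_inner
    by (simp add: inner_diff_left inner_diff_right inner_commute divide_inverse power2_eq_square algebra_simps)
  also have "\<dots> = (n\<^sup>2 - 2 * inner u v + m\<^sup>2) / (n * m)\<^sup>2"
    unfolding i using nm by (simp add: divide_simps power2_eq_square)
  also have "n\<^sup>2 - 2 * inner u v + m\<^sup>2 = (dist u v)\<^sup>2"
    unfolding dist_norm power2_norm_eq_inner
    by (simp add: inner_diff_left inner_diff_right inner_commute i)
  finally show "(dist (u /\<^sub>R (norm u)\<^sup>2) (v /\<^sub>R (norm v)\<^sup>2))\<^sup>2 = (dist u v / (norm u * norm v))\<^sup>2"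
    by (simp add: n_def m_def power_divide)
qed (auto)

lemma dist_einv:
  assumes "p \<noteq> (b, 0)" "q \<noteq> (b, 0)"
  shows "dist (einv b p) (einv b q) = dist p q / (dist p (b, 0) * dist q (b, 0))"
  using dist_inversion[of "p - (b, 0)" "q - (b, 0)"] assms by (simp add: einv_def dist_norm)

lemma dist_einv_center:
  assumes "p \<noteq> (b, 0)"
  shows "dist (einv b p) (b, 0) = 1 / dist p (b, 0)"
  using assms by (simp add: einv_def dist_norm power2_eq_square divide_inverse)

lemma snd_einv: "snd (einv b p) = snd p / (dist p (b, 0))\<^sup>2"
  by (simp add: einv_def divide_inverse)

lemma einv_einv: "p \<noteq> (b, 0) \<Longrightarrow> einv b (einv b p) = p"
  unfolding einv_def[of b "einv b p"] dist_einv_center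
  by (simp add: einv_def power_divide)

lemma Rep_ne_bdry [simp]: "Rep_hyp3 x \<noteq> (b, 0)"
  by (metis height_def height_nz snd_conv)

lemma dist_bdry_pos [simp]: "dist (Rep_hyp3 x) (b, 0) > 0"
  by simp

lemma dist_bdry_nz [simp]: "dist (Rep_hyp3 x) (b, 0) \<noteq> 0"
  by simp

definition hinv :: "complex \<Rightarrow> hyp3 \<Rightarrow> hyp3" where
  "hinv b x = Abs_hyp3 (einv b (Rep_hyp3 x))"

lemma Rep_hinv: "Rep_hyp3 (hinv b x) = einv b (Rep_hyp3 x)"
  unfolding hinv_def by (rule Abs_hyp3_inverse) (simp add: snd_einv flip: height_def)

lemma height_hinv: "height (hinv b x) = height x / (dist (Rep_hyp3 x) (b, 0))\<^sup>2"
  by (simp add: height_def Rep_hinv snd_einv)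

lemma hinv_hinv [simp]: "hinv b (hinv b x) = x"
  by (metis Rep_hinv Rep_hyp3_inverse Rep_ne_bdry einv_einv)

lemma hyp_isometry_hinv: "hyp_isometry (hinv b)"
proof -
  have "hyp_cosh (hinv b x) (hinv b y) = hyp_cosh x y" for x y
    unfolding hyp_cosh_def height_hinv Rep_hinv dist_einv[OF Rep_ne_bdry Rep_ne_bdry]
    by (simp add: power_divide power_mult_distrib)
  then show ?thesis unfolding hyp_isometry_def
    by (metis dist_eq_iff hinv_hinv involuntory_imp_bij)
qed

lemma dist_scaleR_both: "dist (r *\<^sub>R x) (r *\<^sub>R y) = \<bar>r\<bar> * dist x y" for x y :: "'a::real_normed_vector"
  by (simp add: dist_norm flip: scaleR_diff_right)

definition hscale :: "real \<Rightarrow> hyp3 \<Rightarrow> hyp3" where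
  "hscale r x = mk (r *\<^sub>R base x) (r * height x)"

lemma height_hscale [simp]: "r > 0 \<Longrightarrow> height (hscale r x) = r * height x"
  and base_hscale [simp]: "r > 0 \<Longrightarrow> base (hscale r x) = r *\<^sub>R base x"
  by (simp_all add: hscale_def)

lemma hscale_hscale: "r > 0 \<Longrightarrow> s > 0 \<Longrightarrow> hscale r (hscale s x) = hscale (r * s) x"
  by (rule hyp3_eqI) simp_all

lemma hscale_1 [simp]: "hscale 1 x = x"
  by (rule hyp3_eqI) simp_all

lemma hyp_isometry_hscale:
  assumes r: "r > 0" shows "hyp_isometry (hscale r)"
proof -
  have "hyp_cosh (hscale r x) (hscale r y) = hyp_cosh x y" for x y
  proof -
    have e: "Rep_hyp3 (hscale r z) = r *\<^sub>R Rep_hyp3 z" for z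
      using r by (simp add: prod_eq_iff flip: height_def)
    show ?thesis using r unfolding hyp_cosh_def e dist_scaleR_both by (simp add: power_mult_distrib power2_eq_square)
  qed
  moreover have "bij (hscale r)"
    by (rule bij_betwI[where g="hscale (1/r)"]) (use r in \<open>auto simp: hscale_hscale\<close>)
  ultimately show ?thesis unfolding hyp_isometry_def by (metis dist_eq_iff)
qed

text \<open>
  An isometry moving infinity is, up to a similarity, the inversion in the point \<open>b\<close> that it sends
  to infinity. It therefore extends to the boundary plane, with the distortion of an inversion.
\<close>

lemma inversive_extension:
  assumes f: "hyp_isometry f" and r: "r > 0"
    and h: "\<And>x. height (f x) = r * height x / (dist (Rep_hyp3 x) (b, 0))\<^sup>2"
  obtains F a where "\<And>x. Rep_hyp3 (f x) = F (Rep_hyp3 x)"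
    "\<And>p q. p \<noteq> (b, 0) \<Longrightarrow> q \<noteq> (b, 0) \<Longrightarrow> dist (F p) (F q) = r * dist p q / (dist p (b, 0) * dist q (b, 0))"
    "\<And>p. p \<noteq> (b, 0) \<Longrightarrow> dist (F p) (a, 0) = r / dist p (b, 0)"
    "\<And>p. snd (F p) = r * snd p / (dist p (b, 0))\<^sup>2"
proof -
  define g where "g = hscale (1 / r) \<circ> f \<circ> hinv b"
  have gi: "hyp_isometry g" unfolding g_def
    using hyp_isometry_comp[OF hyp_isometry_comp[OF hyp_isometry_hscale f] hyp_isometry_hinv] r by simp
  have gh: "height (g x) = height x" for x
    using r by (simp add: g_def h Rep_hinv dist_einv_center height_hinv power_divide)
  note g = height_preserving_isometry[OF gi gh]
  define \<sigma> where "\<sigma> = shadow g"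
  define S where "S p = (\<sigma> (fst p), snd p)" for p :: "complex \<times> real"
  define F where "F p = r *\<^sub>R S (einv b p)" for p
  have S: "dist (S p) (S q) = dist p q" for p q
    using g(2) by (simp add: S_def dist_prod_def \<sigma>_def)
  show thesis
  proof (rule that[of F "r *\<^sub>R \<sigma> b"])
    fix x
    have "f x = hscale r (g (hinv b x))"
      using r by (simp add: g_def hscale_hscale)
    moreover have "g (hinv b x) = lift \<sigma> (hinv b x)" unfolding \<sigma>_def by (rule g(1))
    ultimately have "f x = hscale r (lift \<sigma> (hinv b x))" by simp
    then show "Rep_hyp3 (f x) = F (Rep_hyp3 x)"
      using r by (simp add: F_def S_def prod_eq_iff Rep_hinv height_hinv flip: height_def)
         (simp add: height_def snd_einv)
  next
    fix p q :: "complex \<times> real" assume "p \<noteq> (b, 0)" "q \<noteq> (b, 0)"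
    then show "dist (F p) (F q) = r * dist p q / (dist p (b, 0) * dist q (b, 0))"
      using r by (simp add: F_def dist_scaleR_both S dist_einv)
  next
    fix p :: "complex \<times> real" assume p: "p \<noteq> (b, 0)"
    have "(r *\<^sub>R \<sigma> b, 0) = r *\<^sub>R S (b, 0)" by (simp add: S_def)
    then show "dist (F p) (r *\<^sub>R \<sigma> b, 0) = r / dist p (b, 0)"
      using r p by (simp add: F_def dist_scaleR_both S dist_einv_center)
  next
    fix p show "snd (F p) = r * snd p / (dist p (b, 0))\<^sup>2"
      by (simp add: F_def S_def snd_einv)
  qed
qed

text \<open>
  The point sent to infinity is where the height function of the isometry blows up.
\<close>

lemma pole_unique:
  assumes "r > 0" "s > 0"
    "\<And>x. r * height x / (dist (Rep_hyp3 x) (b, 0))\<^sup>2 = s * height x / (dist (Rep_hyp3 x) (c, 0))\<^sup>2"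
  shows "b = c"
proof (rule ccontr)
  assume "b \<noteq> c"
  then have n: "(norm (b - c))\<^sup>2 > 0" by simp
  \<comment> \<open>The two sides are compared at heights 1 and 2 over \<open>b\<close>.\<close>
  have *: "r * ((norm (b - c))\<^sup>2 + t\<^sup>2) = s * t\<^sup>2" if t: "t > 0" for t
  proof -
    define N where "N = (norm (b - c))\<^sup>2 + t\<^sup>2"
    have N: "N > 0" using n t by (simp add: add_pos_pos N_def)
    have "r * t / t\<^sup>2 = s * t / N"
      using assms(3)[of "mk b t"] t unfolding dist_Rep_sq by (simp add: N_def)
    then have "r * N = s * t\<^sup>2" using t N by (simp add: field_simps power2_eq_square)
    then show ?thesis by (simp add: N_def)
  qed
  have "r * (norm (b - c))\<^sup>2 + r = s" "r * (norm (b - c))\<^sup>2 + r * 4 = s * 4"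
    using *[of 1] *[of 2] by (simp_all add: distrib_left)
  then have "r * (norm (b - c))\<^sup>2 = 0" by linarith
  then show False using n assms(1) by simp
qed

subsection \<open>Geodesics with finite endpoints\<close>

text \<open>The geodesic from \<open>e2\<close> (as \<open>t\<close> tends to \<open>-\<infinity>\<close>) to \<open>e1\<close>: a Euclidean half-circle.\<close>

definition semi :: "complex \<Rightarrow> complex \<Rightarrow> real \<Rightarrow> hyp3" where
  "semi e1 e2 t = mk ((e1 + e2) /\<^sub>R 2 + tanh t *\<^sub>R ((e1 - e2) /\<^sub>R 2)) (norm (e1 - e2) / 2 / cosh t)"

lemma semi_coords:
  assumes "e1 \<noteq> e2"
  shows "base (semi e1 e2 t) = (e1 + e2) /\<^sub>R 2 + tanh t *\<^sub>R ((e1 - e2) /\<^sub>R 2)"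
    "height (semi e1 e2 t) = norm (e1 - e2) / 2 / cosh t"
  using assms by (simp_all add: semi_def)

lemma tanh_cosh_sq: "(tanh t)\<^sup>2 = 1 - 1 / (cosh t)\<^sup>2" for t :: real
proof -
  have "(tanh t)\<^sup>2 = (sinh t)\<^sup>2 / (cosh t)\<^sup>2" by (simp add: tanh_def power_divide)
  also have "\<dots> = ((cosh t)\<^sup>2 - 1) / (cosh t)\<^sup>2" by (simp add: cosh_square_eq)
  also have "\<dots> = 1 - 1 / (cosh t)\<^sup>2" by (simp add: diff_divide_distrib)
  finally show ?thesis .
qed

lemma geodesic_line_semi:
  assumes "e1 \<noteq> e2" shows "geodesic_line (semi e1 e2)"
  unfolding geodesic_line_def
proof (intro allI)
  fix s t :: real
  define R where "R = norm (e1 - e2) / 2"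
  have R: "R > 0" using assms by (simp add: R_def)
  have cp: "cosh s > 0" "cosh t > 0" by simp_all
  have "base (semi e1 e2 s) - base (semi e1 e2 t) = (tanh s - tanh t) *\<^sub>R ((e1 - e2) /\<^sub>R 2)"
    by (simp add: semi_coords[OF assms] complex_eq_iff field_simps)
  then have "(norm (base (semi e1 e2 s) - base (semi e1 e2 t)))\<^sup>2 = (tanh s - tanh t)\<^sup>2 * R\<^sup>2"
    by (simp add: R_def power_mult_distrib power_divide)
  then have "hyp_cosh (semi e1 e2 s) (semi e1 e2 t) =
      ((tanh s - tanh t)\<^sup>2 * R\<^sup>2 + (R / cosh s)\<^sup>2 + (R / cosh t)\<^sup>2) / (2 * (R / cosh s) * (R / cosh t))"
    unfolding hyp_cosh_alt by (simp add: semi_coords[OF assms] R_def)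
  also have "(tanh s - tanh t)\<^sup>2 * R\<^sup>2 + (R / cosh s)\<^sup>2 + (R / cosh t)\<^sup>2 = R\<^sup>2 * (2 - 2 * tanh s * tanh t)"
    unfolding power2_diff tanh_cosh_sq by (simp add: algebra_simps power_divide)
  also have "R\<^sup>2 * (2 - 2 * tanh s * tanh t) / (2 * (R / cosh s) * (R / cosh t)) = cosh s * cosh t * (1 - tanh s * tanh t)"
    using R by (simp add: power2_eq_square field_simps)
  also have "\<dots> = cosh (s - t)"
    using cp by (simp add: cosh_diff tanh_def field_simps)
  finally have "cosh (dist (semi e1 e2 s) (semi e1 e2 t)) = cosh \<bar>s - t\<bar>" by (simp add: cosh_dist)
  then show "dist (semi e1 e2 s) (semi e1 e2 t) = \<bar>s - t\<bar>"
    by (metis abs_ge_zero arcosh_cosh_real zero_le_dist)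
qed

lemma dist_semi_ends:
  assumes "e1 \<noteq> e2"
  shows "(dist (Rep_hyp3 (semi e1 e2 t)) (e1, 0))\<^sup>2 = (norm (e1 - e2))\<^sup>2 * (1 - tanh t) / 2"
    "(dist (Rep_hyp3 (semi e1 e2 t)) (e2, 0))\<^sup>2 = (norm (e1 - e2))\<^sup>2 * (1 + tanh t) / 2"
proof -
  have h: "(height (semi e1 e2 t))\<^sup>2 = (norm (e1 - e2))\<^sup>2 / 4 * (1 - (tanh t)\<^sup>2)"
    by (simp add: semi_coords[OF assms] tanh_cosh_sq power_divide)
  have "base (semi e1 e2 t) - e1 = (tanh t - 1) *\<^sub>R ((e1 - e2) /\<^sub>R 2)"
    by (simp add: semi_coords[OF assms] complex_eq_iff field_simps)
  then have "(norm (base (semi e1 e2 t) - e1))\<^sup>2 = (tanh t - 1)\<^sup>2 * (norm (e1 - e2))\<^sup>2 / 4"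
    by (simp add: power_mult_distrib power_divide)
  then show "(dist (Rep_hyp3 (semi e1 e2 t)) (e1, 0))\<^sup>2 = (norm (e1 - e2))\<^sup>2 * (1 - tanh t) / 2"
    unfolding dist_Rep_sq diff_0_right h by (simp add: power2_eq_square field_simps)
  have "base (semi e1 e2 t) - e2 = (tanh t + 1) *\<^sub>R ((e1 - e2) /\<^sub>R 2)"
    by (simp add: semi_coords[OF assms] complex_eq_iff field_simps)
  then have "(norm (base (semi e1 e2 t) - e2))\<^sup>2 = (tanh t + 1)\<^sup>2 * (norm (e1 - e2))\<^sup>2 / 4"
    by (simp add: power_mult_distrib power_divide)
  then show "(dist (Rep_hyp3 (semi e1 e2 t)) (e2, 0))\<^sup>2 = (norm (e1 - e2))\<^sup>2 * (1 + tanh t) / 2"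
    unfolding dist_Rep_sq diff_0_right h by (simp add: power2_eq_square field_simps)
qed

text \<open>
  The case of equality in the Cauchy-Schwarz inequality.
\<close>

lemma inner_scaleR_eq_case:
  fixes q w :: "'a::real_inner"
  assumes "w \<noteq> 0" "(inner q w)\<^sup>2 = inner q q * inner w w"
  shows "q = (inner q w / inner w w) *\<^sub>R w"
proof -
  define m where "m = inner q w / inner w w"
  have W: "inner w w \<noteq> 0" using assms(1) by simp
  have m: "m * inner w w = inner q w" using W by (simp add: m_def)
  have "inner w w * inner (q - m *\<^sub>R w) (q - m *\<^sub>R w) = inner w w * inner q q - 2 * inner q w * (m * inner w w) + (m * inner w w)\<^sup>2"
    by (simp add: inner_diff_left inner_diff_right inner_commute algebra_simps power2_eq_square)
  also have "\<dots> = 0" unfolding m using assms(2) by (simp add: power2_eq_square algebra_simps)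
  finally show ?thesis using W by (simp add: m_def)
qed

text \<open>
  The product of the Euclidean distances to the endpoints, divided by the height, is smallest
  exactly on the geodesic, where the ratio of the two distances is the exponential of the
  parameter.
\<close>

lemma semi_eqI:
  assumes ne: "e1 \<noteq> e2"
    and eq: "dist (Rep_hyp3 x) (e1, 0) * dist (Rep_hyp3 x) (e2, 0) = height x * norm (e1 - e2)"
  shows "x = semi e1 e2 (ln (dist (Rep_hyp3 x) (e2, 0) / dist (Rep_hyp3 x) (e1, 0)))"
proof -
  define w where "w = (e1 - e2) /\<^sub>R 2"
  define q where "q = base x - (e1 + e2) /\<^sub>R 2"
  define t where "t = height x"
  define A B where "A = dist (Rep_hyp3 x) (e1, 0)" and "B = dist (Rep_hyp3 x) (e2, 0)"
  have e: "base x - e1 = q - w" "base x - e2 = q + w"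
    by (simp_all add: q_def w_def complex_eq_iff field_simps)
  have w: "w \<noteq> 0" using ne by (simp add: w_def)
  define N W D where "N = inner q q" and "W = inner w w" and "D = inner q w"
  have W: "W > 0" using w by (simp add: W_def)
  have A2: "A\<^sup>2 = N - 2 * D + W + t\<^sup>2" and B2: "B\<^sup>2 = N + 2 * D + W + t\<^sup>2"
    unfolding A_def B_def dist_Rep_sq e N_def W_def D_def power2_norm_eq_inner t_def
    by (simp_all add: inner_diff_left inner_diff_right inner_add_left inner_add_right inner_commute)
  have nw: "norm (e1 - e2) = 2 * norm w" by (simp add: w_def)
  have "A\<^sup>2 * B\<^sup>2 = 4 * t\<^sup>2 * W"
    using arg_cong[OF eq, of "\<lambda>x. x\<^sup>2"] unfolding A_def B_def t_def nw W_def power_mult_distrib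
    by (simp add: power2_norm_eq_inner)
  then have key: "(N + t\<^sup>2 - W)\<^sup>2 + 4 * (N * W - D\<^sup>2) = 0"
    unfolding A2 B2 by (simp add: algebra_simps power2_eq_square)
  have CS: "D\<^sup>2 \<le> N * W" unfolding D_def N_def W_def by (rule Cauchy_Schwarz_ineq)
  then have S: "N + t\<^sup>2 = W" and P: "D\<^sup>2 = N * W" using key
    by (smt (verit) zero_le_power2 power2_less_0 zero_eq_power2)+
  define l where "l = D / W"
  have q: "q = l *\<^sub>R w" using inner_scaleR_eq_case[OF w] P by (simp add: l_def D_def W_def N_def)
  have D: "D = l * W" using W by (simp add: l_def)
  have N: "N = l\<^sup>2 * W" using P W D by (simp add: power2_eq_square)
  have A2': "A\<^sup>2 = 2 * W * (1 - l)" and B2': "B\<^sup>2 = 2 * W * (1 + l)"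
    using S D unfolding A2 B2 by (simp_all add: algebra_simps)
  have AB: "A > 0" "B > 0" by (simp_all add: A_def B_def)
  have l: "1 - l > 0" "1 + l > 0" using AB A2' B2' W
    by (metis mult_pos_pos zero_less_mult_pos zero_less_numeral zero_less_power)+
  have r: "(B / A)\<^sup>2 = (1 + l) / (1 - l)" unfolding power_divide A2' B2' using W by simp
  have th: "tanh (ln (B / A)) = l"
  proof -
    have "tanh (ln (B / A)) = ((B / A)\<^sup>2 - 1) / ((B / A)\<^sup>2 + 1)" using AB by (simp add: tanh_ln_real)
    also have "\<dots> = l" unfolding r using l by (simp add: field_simps)
    finally show ?thesis .
  qed
  have t: "t > 0" by (simp add: t_def)
  show ?thesis unfolding A_def[symmetric] B_def[symmetric]
  proof (rule hyp3_eqI)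
    show "base x = base (semi e1 e2 (ln (B / A)))"
      using q by (simp add: semi_coords[OF ne] th q_def w_def algebra_simps)
    have "t\<^sup>2 = W * (1 - l\<^sup>2)" using S N by (simp add: algebra_simps)
    also have "1 - l\<^sup>2 = 1 / (cosh (ln (B / A)))\<^sup>2" using tanh_cosh_sq[of "ln (B / A)"] th by simp
    also have "W = (norm (e1 - e2) / 2)\<^sup>2" unfolding nw W_def by (simp add: power2_norm_eq_inner)
    finally have "t\<^sup>2 = (norm (e1 - e2) / 2 / cosh (ln (B / A)))\<^sup>2" by (simp add: power_divide)
    then show "height x = height (semi e1 e2 (ln (B / A)))"
      unfolding semi_coords[OF ne] t_def by (rule power2_eq_imp_eq) (simp_all add: less_imp_le)
  qed
qed

text \<open>
  An isometry whose isometric hemispheres (about \<open>b\<close>, and about \<open>a\<close> for its inverse) are far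
  apart contracts a neighbourhood of \<open>a\<close>, and its inverse contracts one of \<open>b\<close>.
\<close>

lemma fixed_point_near_pole:
  fixes F :: "complex \<times> real \<Rightarrow> complex \<times> real"
  assumes F1: "\<And>p q. p \<noteq> (b, 0) \<Longrightarrow> q \<noteq> (b, 0) \<Longrightarrow> dist (F p) (F q) = r * dist p q / (dist p (b, 0) * dist q (b, 0))"
    and F2: "\<And>p. p \<noteq> (b, 0) \<Longrightarrow> dist (F p) (a, 0) = r / dist p (b, 0)"
    and F3: "\<And>p. snd (F p) = r * snd p / (dist p (b, 0))\<^sup>2"
    and r: "0 < r" "r \<le> 1" and d: "dist a b \<ge> 4"
  obtains e where "F (e, 0) = (e, 0)" "dist e a \<le> 1 / (dist a b - 1)"
proof -
  define S where "S = {p :: complex \<times> real. snd p = 0} \<inter> cball (a, 0 :: real) 1"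
  have ge: "dist p (b, 0) \<ge> dist a b - 1" if "p \<in> S" for p
  proof -
    have "dist (a, 0::real) (b, 0) = dist a b" by (simp add: dist_prod_def)
    then show ?thesis using that dist_triangle[of "(a, 0::real)" "(b, 0)" p] by (simp add: S_def dist_commute)
  qed
  have ge3: "dist p (b, 0) \<ge> 3" and ne: "p \<noteq> (b, 0)" if "p \<in> S" for p
    using ge[OF that] d by (force)+
  have near: "dist (F p) (a, 0) \<le> 1 / (dist a b - 1)" if "p \<in> S" for p
    unfolding F2[OF ne[OF that]] using r ge[OF that] d by (intro frac_le) auto
  have "closed {p :: complex \<times> real. snd p = 0}" by (intro closed_Collect_eq continuous_intros)
  then have cS: "complete S" unfolding S_def by (intro compact_imp_complete closed_Int_compact) auto
  have aS: "(a, 0) \<in> S" by (simp add: S_def)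
  have FS: "F ` S \<subseteq> S"
  proof
    fix y assume "y \<in> F ` S"
    then obtain p where p: "p \<in> S" "y = F p" by auto
    have "1 / (dist a b - 1) \<le> 1" using d by simp
    then have "dist (F p) (a, 0) \<le> 1" using near[OF p(1)] by linarith
    moreover have "snd (F p) = 0" using p by (simp add: F3 S_def)
    ultimately show "y \<in> S" using p by (simp add: S_def dist_commute)
  qed
  have lip: "dist (F p) (F q) \<le> 1/9 * dist p q" if "p \<in> S" "q \<in> S" for p q
  proof -
    have "3 * 3 \<le> dist p (b, 0) * dist q (b, 0)" using ge3 that by (intro mult_mono) auto
    moreover have "r * dist p q \<le> dist p q" using r by (simp add: mult_left_le_one_le)
    ultimately have "r * dist p q / (dist p (b, 0) * dist q (b, 0)) \<le> dist p q / 9" by (intro frac_le) auto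
    then show ?thesis by (simp add: F1 ne that)
  qed
  have "\<exists>!p\<in>S. F p = p"
    by (rule Banach_fix[OF cS _ _ _ FS lip]) (use aS in auto)
  then obtain p where p: "p \<in> S" "F p = p" by blast
  show thesis
  proof (rule that[of "fst p"])
    have "p = (fst p, 0)" using p(1) by (simp add: S_def prod_eq_iff)
    then show "F (fst p, 0) = (fst p, 0)" using p by simp
    have "dist (fst p) a \<le> dist p (a, 0)" using dist_fst_le[of p "(a, 0)"] by simp
    then show "dist (fst p) a \<le> 1 / (dist a b - 1)" using near[OF p(1)] p(2) by simp
  qed
qed

lemma bdry_eqI:
  fixes p q :: "complex \<times> real"
  assumes "\<And>x. dist p (Rep_hyp3 x) = dist q (Rep_hyp3 x)" "snd p = 0" "snd q = 0"
  shows "p = q"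
proof -
  obtain u v where p: "p = (u, 0)" "q = (v, 0)" using assms(2,3) by (metis prod.collapse)
  have "(dist p (Rep_hyp3 (mk u 1)))\<^sup>2 = (dist q (Rep_hyp3 (mk u 1)))\<^sup>2" using assms(1)[of "mk u 1"] by simp
  then have "(norm (v - u))\<^sup>2 = 0" unfolding p by (simp add: dist_Pair_sq)
  then show ?thesis using p by simp
qed

lemma inverse_height:
  fixes F :: "complex \<times> real \<Rightarrow> complex \<times> real"
  assumes ext: "\<And>x. Rep_hyp3 (f x) = F (Rep_hyp3 x)"
    and F2: "\<And>p. p \<noteq> (b, 0) \<Longrightarrow> dist (F p) (a, 0) = r / dist p (b, 0)"
    and h: "\<And>x. height (f x) = r * height x / (dist (Rep_hyp3 x) (b, 0))\<^sup>2"
    and r: "0 < r" and fg: "\<And>x. f (g x) = x"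
  shows "height (g y) = r * height y / (dist (Rep_hyp3 y) (a, 0))\<^sup>2"
proof -
  have "dist (Rep_hyp3 y) (a, 0) = r / dist (Rep_hyp3 (g y)) (b, 0)"
    using F2[of "Rep_hyp3 (g y)"] ext[of "g y"] fg by simp
  moreover have "height y = r * height (g y) / (dist (Rep_hyp3 (g y)) (b, 0))\<^sup>2" using h[of "g y"] fg by simp
  ultimately show ?thesis using r by (simp add: power_divide power2_eq_square)
qed

text \<open>
  For the fixed points \<open>e1\<close> and \<open>e2\<close>, the distortion formula shows that the product of the
  distances from them divided by the height is invariant, so the geodesic joining them is preserved,
  and that the ratio of these distances is multiplied by a constant, so it is translated.
\<close>

lemma axis_exists:
  assumes f: "hyp_isometry f" and g: "hyp_isometry g" and fg: "\<And>x. f (g x) = x" 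
    and r: "0 < r" "r \<le> 1" and d: "dist a b \<ge> 4"
    and hf: "\<And>x. height (f x) = r * height x / (dist (Rep_hyp3 x) (b, 0))\<^sup>2"
    and hg: "\<And>x. height (g x) = r * height x / (dist (Rep_hyp3 x) (a, 0))\<^sup>2"
  obtains e1 e2 l where "dist e1 a \<le> 1 / (dist a b - 1)" "dist e2 b \<le> 1 / (dist a b - 1)"
    "l > 0" "\<And>t. f (semi e1 e2 t) = semi e1 e2 (t + l)"
proof -
  have gf: "g (f x) = x" for x
    using f fg by (metis bij_is_inj hyp_isometry_def inj_eq)
  obtain F a' where F0: "\<And>x. Rep_hyp3 (f x) = F (Rep_hyp3 x)" and
    F1: "\<And>p q. p \<noteq> (b, 0) \<Longrightarrow> q \<noteq> (b, 0) \<Longrightarrow> dist (F p) (F q) = r * dist p q / (dist p (b, 0) * dist q (b, 0))" and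
    F2: "\<And>p. p \<noteq> (b, 0) \<Longrightarrow> dist (F p) (a', 0) = r / dist p (b, 0)" and
    F3: "\<And>p. snd (F p) = r * snd p / (dist p (b, 0))\<^sup>2"
    using inversive_extension[OF f r(1) hf] by metis
  have "a' = a" using pole_unique[OF r(1) r(1)] inverse_height[OF F0 F2 hf r(1) fg] hg by metis
  note F2 = F2[unfolded this]
  obtain G b' where G0: "\<And>x. Rep_hyp3 (g x) = G (Rep_hyp3 x)" and
    G1: "\<And>p q. p \<noteq> (a, 0) \<Longrightarrow> q \<noteq> (a, 0) \<Longrightarrow> dist (G p) (G q) = r * dist p q / (dist p (a, 0) * dist q (a, 0))" and
    G2: "\<And>p. p \<noteq> (a, 0) \<Longrightarrow> dist (G p) (b', 0) = r / dist p (a, 0)" and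
    G3: "\<And>p. snd (G p) = r * snd p / (dist p (a, 0))\<^sup>2"
    using inversive_extension[OF g r(1) hg] by metis
  have "b' = b" using pole_unique[OF r(1) r(1)] inverse_height[OF G0 G2 hg r(1) gf] hf by metis
  note G2 = G2[unfolded this]
  obtain e1 where e1: "F (e1, 0) = (e1, 0)" "dist e1 a \<le> 1 / (dist a b - 1)"
    using fixed_point_near_pole[OF F1 F2 F3 r d] by blast
  obtain e2 where e2: "G (e2, 0) = (e2, 0)" "dist e2 b \<le> 1 / (dist a b - 1)"
    using fixed_point_near_pole[OF G1 G2 G3 r] d by (metis dist_commute)
  have third: "1 / (dist a b - 1) \<le> 1/3" using d by (simp add: field_simps)
  have bd: "dist (z, 0::real) (w, 0) = dist z w" for z w :: complex by (simp add: dist_prod_def)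
  have e1b: "dist e1 b > 3" using dist_triangle[of a b e1] dist_commute[of a e1] e1(2) third d by linarith
  have e2a: "dist e2 a > 3" using dist_triangle[of a b e2] dist_commute[of a e2] e2(2) third d by linarith
  have ne: "(e1, 0) \<noteq> (b, 0)" "(e2, 0) \<noteq> (a, 0)" using e1b e2a by auto
  have e2b: "dist e2 b = r / dist e2 a" using G2[OF ne(2)] e2(1) by (simp add: bd)
  moreover have "dist e2 a > 0" using e2a by linarith
  ultimately have "dist e2 b > 0" using r by simp
  then have ne2: "(e2, 0) \<noteq> (b, 0)" by auto
  \<comment> \<open>The fixed point of the inverse extension is one of the extension itself, because
    points of the boundary are determined by their distances to interior points.\<close>
  have Fe2: "F (e2, 0) = (e2, 0)"
  proof (rule bdry_eqI)
    fix y
    have "dist (F (e2, 0)) (F (Rep_hyp3 (g y))) = r * dist (e2, 0) (Rep_hyp3 (g y)) / (dist e2 b * dist (Rep_hyp3 (g y)) (b, 0))"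
      using F1[OF ne2, of "Rep_hyp3 (g y)"] by (simp add: bd)
    also have "F (Rep_hyp3 (g y)) = Rep_hyp3 y" by (simp add: fg flip: F0)
    also have "dist (e2, 0) (Rep_hyp3 (g y)) = r * dist (e2, 0) (Rep_hyp3 y) / (dist e2 a * dist (Rep_hyp3 y) (a, 0))"
      using G1[OF ne(2), of "Rep_hyp3 y"] by (simp add: bd e2(1) G0)
    also have "dist (Rep_hyp3 (g y)) (b, 0) = r / dist (Rep_hyp3 y) (a, 0)" using G2 by (simp add: G0)
    finally show "dist (F (e2, 0)) (Rep_hyp3 y) = dist (e2, 0) (Rep_hyp3 y)"
      using r e2a ne(2) unfolding e2b by (simp add: field_simps)
  qed (simp_all add: F3)
  have e12: "e1 \<noteq> e2" using e1b e2(2) third by auto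
  define \<alpha> \<beta> where "\<alpha> = dist e1 b" and "\<beta> = dist e2 b"
  have \<alpha>\<beta>: "\<alpha> > 3" "\<beta> > 0" "\<beta> \<le> 1/3" using e1b \<open>dist e2 b > 0\<close> e2(2) third by (auto simp: \<alpha>_def \<beta>_def)
  have "dist e1 e2 = r * dist e1 e2 / (\<alpha> * \<beta>)"
    using F1[OF ne(1) ne2] by (simp add: e1 Fe2 bd \<alpha>_def \<beta>_def)
  then have r\<alpha>\<beta>: "r = \<alpha> * \<beta>" using e12 \<alpha>\<beta> by (simp add: field_simps)
  have D1: "dist (Rep_hyp3 (f x)) (e1, 0) = r * dist (Rep_hyp3 x) (e1, 0) / (dist (Rep_hyp3 x) (b, 0) * \<alpha>)" for x
    using F1[OF Rep_ne_bdry ne(1), of x] by (simp add: e1 F0 \<alpha>_def bd)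
  have D2: "dist (Rep_hyp3 (f x)) (e2, 0) = r * dist (Rep_hyp3 x) (e2, 0) / (dist (Rep_hyp3 x) (b, 0) * \<beta>)" for x
    using F1[OF Rep_ne_bdry ne2, of x] by (simp add: Fe2 F0 \<beta>_def bd)
  define l where "l = ln (\<alpha> / \<beta>)"
  have "l > 0" using \<alpha>\<beta> by (simp add: l_def)
  have "f (semi e1 e2 t) = semi e1 e2 (t + l)" for t
  proof -
    define x where "x = semi e1 e2 t"
    define A B where "A = dist (Rep_hyp3 x) (e1, 0)" and "B = dist (Rep_hyp3 x) (e2, 0)"
    define n where "n = dist (Rep_hyp3 x) (b, 0)"
    have pos: "A > 0" "B > 0" "n > 0" by (simp_all add: A_def B_def n_def)
    have A2: "A\<^sup>2 = (norm (e1 - e2))\<^sup>2 * (1 - tanh t) / 2" and B2: "B\<^sup>2 = (norm (e1 - e2))\<^sup>2 * (1 + tanh t) / 2"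
      using dist_semi_ends[OF e12] by (simp_all add: A_def B_def x_def)
    have "(A * B)\<^sup>2 = (norm (e1 - e2) * height x)\<^sup>2"
    proof -
      have "(A * B)\<^sup>2 = (norm (e1 - e2))\<^sup>2 * ((norm (e1 - e2))\<^sup>2 / 4 * (1 - (tanh t)\<^sup>2))"
        unfolding power_mult_distrib A2 B2 by (simp add: algebra_simps power2_eq_square)
      also have "(norm (e1 - e2))\<^sup>2 / 4 * (1 - (tanh t)\<^sup>2) = (height x)\<^sup>2"
        by (simp add: x_def semi_coords[OF e12] tanh_cosh_sq power_divide)
      finally show ?thesis by (simp add: power_mult_distrib)
    qed
    then have AB: "A * B = norm (e1 - e2) * height x"
      by (rule power2_eq_imp_eq) (use pos in \<open>simp_all add: less_imp_le\<close>)
    have "dist (Rep_hyp3 (f x)) (e1, 0) * dist (Rep_hyp3 (f x)) (e2, 0) = r * r * (A * B) / (n * n * (\<alpha> * \<beta>))"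
      unfolding D1 D2 A_def B_def n_def by (simp add: mult_ac)
    also have "\<dots> = r * (norm (e1 - e2) * height x) / (n * n)"
      unfolding AB r\<alpha>\<beta>[symmetric] using r by simp
    also have "\<dots> = height (f x) * norm (e1 - e2)" unfolding hf n_def by (simp add: power2_eq_square)
    finally have "f x = semi e1 e2 (ln (dist (Rep_hyp3 (f x)) (e2, 0) / dist (Rep_hyp3 (f x)) (e1, 0)))"
      by (rule semi_eqI[OF e12])
    also have "dist (Rep_hyp3 (f x)) (e2, 0) / dist (Rep_hyp3 (f x)) (e1, 0) = B / A * (\<alpha> / \<beta>)"
      unfolding D1 D2 A_def[symmetric] B_def[symmetric] n_def[symmetric] using r \<alpha>\<beta> pos by (simp add: field_simps)
    also have "ln (B / A * (\<alpha> / \<beta>)) = ln (B / A) + l" unfolding l_def by (rule ln_mult_pos) (use pos \<alpha>\<beta> in auto)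
    also have "ln (B / A) = t"
    proof -
      have "x = semi e1 e2 (ln (B / A))"
        using semi_eqI[OF e12, of x] AB by (simp add: A_def B_def mult.commute)
      then have "dist (semi e1 e2 t) (semi e1 e2 (ln (B / A))) = 0" by (simp add: x_def)
      then have "\<bar>t - ln (B / A)\<bar> = 0"
        using geodesic_line_semi[OF e12] unfolding geodesic_line_def by metis
      then show ?thesis by simp
    qed
    finally show ?thesis by (simp add: x_def)
  qed
  then show thesis using that e1 e2 \<open>l > 0\<close> by blast
qed

section \<open>Groups of Euclidean motions acting freely on the plane\<close>

lemma plane_isometry_cases:
  fixes f :: "complex \<Rightarrow> complex"
  assumes f: "\<And>z w. dist (f z) (f w) = dist z w"
  obtains (rotary) u c where "norm u = 1" "\<And>z. f z = u * z + c"
    | (reflexive) u c where "norm u = 1" "\<And>z. f z = u * cnj z + c"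
proof -
  define c u where "c = f 0" and "u = f 1 - f 0"
  have u: "norm u = 1" using f[of 1 0] by (simp add: u_def dist_norm)
  then have u0: "u \<noteq> 0" by auto
  define g where "g z = (f z - c) / u" for z
  have fg: "f z = u * g z + c" for z using u0 by (simp add: g_def)
  have dg: "norm (g z - g w) = norm (z - w)" for z w
    using f[of z w] u by (simp add: g_def dist_norm norm_divide flip: diff_divide_distrib)
  have g01: "g 0 = 0" "g 1 = 1" using u0 by (simp_all add: g_def c_def u_def)
  have n: "(Re (g z))\<^sup>2 + (Im (g z))\<^sup>2 = (Re z)\<^sup>2 + (Im z)\<^sup>2" for z
    using arg_cong[OF dg[of z 0], of "\<lambda>x. x\<^sup>2"] g01 unfolding cmod_power2 by simp
  have n1: "(Re (g z) - 1)\<^sup>2 + (Im (g z))\<^sup>2 = (Re z - 1)\<^sup>2 + (Im z)\<^sup>2" for z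
    using arg_cong[OF dg[of z 1], of "\<lambda>x. x\<^sup>2"] g01 unfolding cmod_power2 by simp
  have re: "Re (g z) = Re z" for z using n[of z] n1[of z] by (simp add: power2_eq_square algebra_simps)
  then have im: "(Im (g z))\<^sup>2 = (Im z)\<^sup>2" for z using n[of z] by simp
  have i: "(Im (g z) - Im (g \<i>))\<^sup>2 = (Im z - 1)\<^sup>2" for z
    using arg_cong[OF dg[of z \<i>], of "\<lambda>x. x\<^sup>2"] re unfolding cmod_power2 by simp
  have "(Im (g \<i>))\<^sup>2 = 1" using im[of \<i>] by simp
  then consider "Im (g \<i>) = 1" | "Im (g \<i>) = -1" by (auto simp: power2_eq_1_iff)
  then show thesis
  proof cases
    case 1
    then have "Im (g z) = Im z" for z using i[of z] im[of z] by (simp add: power2_eq_square algebra_simps)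
    then have "g z = z" for z using re by (simp add: complex_eq_iff)
    then show thesis using rotary[OF u] fg by simp
  next
    case 2
    then have "Im (g z) = - Im z" for z using i[of z] im[of z] by (simp add: power2_eq_square algebra_simps)
    then have "g z = cnj z" for z using re by (simp add: complex_eq_iff)
    then show thesis using reflexive[OF u] fg by simp
  qed
qed

text \<open>
  The least positive element generates, by division with remainder.
\<close>

lemma discrete_real_subgroup:
  fixes S :: "real set"
  assumes diff: "\<And>x y. x \<in> S \<Longrightarrow> y \<in> S \<Longrightarrow> x - y \<in> S"
    and fin: "\<And>C. finite (S \<inter> {-C..C})"
    and x: "x \<in> S" "x \<noteq> 0"
  obtains c where "c > 0" "S = range (\<lambda>k::int. of_int k * c)"
proof -
  have z: "0 \<in> S" using diff[OF x(1) x(1)] by simp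
  have neg: "- y \<in> S" if "y \<in> S" for y using diff[OF z that] by simp
  have add: "y + w \<in> S" if "y \<in> S" "w \<in> S" for y w using diff[OF that(1) neg[OF that(2)]] by simp
  have nat: "of_nat n * y \<in> S" if "y \<in> S" for y and n :: nat
    by (induction n) (use that z add in \<open>auto simp: algebra_simps\<close>)
  have int: "of_int k * y \<in> S" if "y \<in> S" for y and k :: int
    by (cases k rule: int_cases2) (use nat[OF that] neg in auto)
  define P where "P = {y \<in> S. 0 < y \<and> y \<le> \<bar>x\<bar>}"
  have finP: "finite P" by (rule finite_subset[OF _ fin[of "\<bar>x\<bar>"]]) (auto simp: P_def)
  have "\<bar>x\<bar> \<in> P" using x neg by (auto simp: P_def abs_real_def)
  then have c: "Min P \<in> P" and m: "\<And>y. y \<in> P \<Longrightarrow> Min P \<le> y"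
    using Min_in[OF finP] Min_le[OF finP] by blast+
  define c where "c = Min P"
  have c0: "c > 0" "c \<in> S" "c \<le> \<bar>x\<bar>" using c by (auto simp: c_def P_def)
  have "y \<in> range (\<lambda>k::int. of_int k * c)" if y: "y \<in> S" for y
  proof -
    define r where "r = y - of_int \<lfloor>y / c\<rfloor> * c"
    have "r \<in> S" using diff[OF y int[OF c0(2)]] by (simp add: r_def)
    moreover have "0 \<le> r" "r < c"
      using c0(1) floor_divide_lower[of c y] floor_divide_upper[of c y] by (auto simp: r_def algebra_simps)
    moreover have "\<not> 0 < r"
    proof
      assume "0 < r"
      then have "r \<in> P" using calculation c0 by (simp add: P_def)
      then show False using m[of r] calculation by (simp add: c_def)
    qed
    ultimately have "r = 0" by linarith
    then have "y = of_int \<lfloor>y / c\<rfloor> * c" by (simp add: r_def)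
    then show ?thesis by blast
  qed
  then have "S = range (\<lambda>k::int. of_int k * c)" using int[OF c0(2)] by auto
  then show thesis using that c0 by blast
qed

text \<open>
  The cusp group acts on the plane in this way; for a cusp of rank 2 the quotient is a torus or
  a Klein bottle. Local finiteness of orbits is the form in which discreteness is used.
\<close>

locale plane_group =
  fixes G :: "(complex \<Rightarrow> complex) set"
  assumes isom: "f \<in> G \<Longrightarrow> dist (f z) (f w) = dist z w"
    and id_in: "id \<in> G"
    and comp_in: "f \<in> G \<Longrightarrow> g \<in> G \<Longrightarrow> f \<circ> g \<in> G"
    and inverse_in: "f \<in> G \<Longrightarrow> \<exists>g\<in>G. f \<circ> g = id \<and> g \<circ> f = id"
    and free: "f \<in> G \<Longrightarrow> f z = z \<Longrightarrow> f = id"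
    and locally_finite: "finite {f \<in> G. dist (f z) z \<le> R}"
begin

definition T :: "complex set" where "T = {c. (\<lambda>z. z + c) \<in> G}"

lemma T_zero: "0 \<in> T" using id_in by (simp add: T_def id_def)

lemma T_add: "c \<in> T \<Longrightarrow> d \<in> T \<Longrightarrow> c + d \<in> T"
  using comp_in[of "\<lambda>z. z + d" "\<lambda>z. z + c"] by (simp add: T_def comp_def add.assoc)

lemma T_minus: "c \<in> T \<Longrightarrow> - c \<in> T"
proof -
  assume "c \<in> T"
  then obtain g where g: "g \<in> G" "(\<lambda>z. z + c) \<circ> g = id" using inverse_in by (auto simp: T_def)
  have "g z = z - c" for z using fun_cong[OF g(2), of z] by (simp add: algebra_simps)
  then have "g = (\<lambda>z. z + - c)" by (simp add: fun_eq_iff)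
  then show "- c \<in> T" using g(1) by (simp add: T_def)
qed

lemma T_diff: "c \<in> T \<Longrightarrow> d \<in> T \<Longrightarrow> c - d \<in> T"
  using T_add[OF _ T_minus] by fastforce

lemma T_of_nat: "c \<in> T \<Longrightarrow> of_nat n * c \<in> T"
  by (induction n) (auto simp: T_zero T_add algebra_simps)

lemma T_of_int: "c \<in> T \<Longrightarrow> of_int k * c \<in> T"
  by (cases k rule: int_cases2) (auto simp: T_of_nat T_minus)

text \<open>A rotation has a fixed point, so only translations and glide reflections remain.\<close>

lemma motion_cases:
  assumes "f \<in> G"
  obtains (translation) c where "c \<in> T" "f = (\<lambda>z. z + c)"
    | (glide) u c where "norm u = 1" "f = (\<lambda>z. u * cnj z + c)"
  using isom[OF assms]
proof (cases f rule: plane_isometry_cases)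
  case (rotary u c)
  show thesis
  proof (cases "u = 1")
    case True
    then have "f = (\<lambda>z. z + c)" using rotary by (simp add: fun_eq_iff)
    then show ?thesis using translation assms by (simp add: T_def)
  next
    case False
    then have "1 - u \<noteq> 0" by simp
    then have "f (c / (1 - u)) = c / (1 - u)" using rotary by (simp add: field_simps)
    then have "f = id" using free assms by blast
    then have "f = (\<lambda>z. z + 0)" by (simp add: fun_eq_iff)
    then show ?thesis using translation T_zero by blast
  qed
next
  case (reflexive u c)
  then show ?thesis using glide by (auto simp: fun_eq_iff)
qed

text \<open>
  The product of two glide reflections preserves orientation, so it is a translation, and hence
  their axes are parallel.
\<close>

lemma glide_axis:
  obtains u where "norm u = 1" "\<And>f. f \<in> G \<Longrightarrow> (\<exists>c\<in>T. f = (\<lambda>z. z + c)) \<or> (\<exists>c. f = (\<lambda>z. u * cnj z + c))"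
proof (cases "\<exists>u c. norm u = 1 \<and> (\<lambda>z. u * cnj z + c) \<in> G")
  case False
  have "\<exists>c\<in>T. f = (\<lambda>z. z + c)" if "f \<in> G" for f
    using that by (cases rule: motion_cases) (use False that in auto)
  then show ?thesis using that[of 1] by auto
next
  case True
  then obtain u c where u: "norm u = 1" "(\<lambda>z. u * cnj z + c) \<in> G" by auto
  show thesis
  proof (rule that[OF u(1)])
    fix f assume f: "f \<in> G"
    then show "(\<exists>c\<in>T. f = (\<lambda>z. z + c)) \<or> (\<exists>c. f = (\<lambda>z. u * cnj z + c))"
    proof (cases rule: motion_cases)
      case (glide v d)
      define h where "h = (\<lambda>z. u * cnj z + c) \<circ> f"
      have h: "h z = (u * cnj v) * z + (u * cnj d + c)" for z by (simp add: h_def glide algebra_simps)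
      have "h \<in> G" unfolding h_def by (rule comp_in[OF u(2) f])
      then have "u * cnj v = 1"
      proof (cases rule: motion_cases)
        case (translation e)
        then show ?thesis using h[of 0] h[of 1] by simp
      next
        case (glide w e)
        have "u * cnj v + w * 0 = w" "u * cnj v * \<i> = - w * \<i>"
          using h[of 0] h[of 1] h[of \<i>] glide by (simp_all)
        then have "w = 0" by simp
        then show ?thesis using glide by simp
      qed
      moreover have "v * cnj v = 1" using glide complex_norm_square[of v] by simp
      ultimately have "(u - v) * cnj v = 0" by (simp add: left_diff_distrib)
      then have "u = v" using glide by auto
      then show ?thesis using glide by auto
    qed auto
  qed
qed

text \<open>
  The square of a glide reflection is the translation along its axis by twice its shift. This
  shift is nonzero, for otherwise there would be fixed points.
\<close>

lemma square_translation:
  assumes f: "f \<in> G"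
  obtains t where "t \<in> T" "f \<circ> f = (\<lambda>z. z + t)" "t = 0 \<Longrightarrow> f = id"
  using f
proof (cases rule: motion_cases)
  case (translation c)
  then show thesis using that[of "c + c"] T_add[of c c] by (auto simp: fun_eq_iff)
next
  case (glide u c)
  have uu: "u * cnj u = 1" using glide(1) complex_norm_square[of u] by simp
  have "(f \<circ> f) z = (u * cnj u) * z + (u * cnj c + c)" for z using glide by (simp add: algebra_simps)
  then have ff: "f \<circ> f = (\<lambda>z. z + (u * cnj c + c))" unfolding uu by (simp add: fun_eq_iff)
  show thesis
  proof (rule that[OF _ ff])
    show "u * cnj c + c \<in> T" using comp_in[OF f f] ff by (simp add: T_def)
    assume "u * cnj c + c = 0"
    then have "u * cnj c = - c" by (simp add: eq_neg_iff_add_eq_0)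
    then have "f (c / 2) = c / 2" using glide by simp
    then show "f = id" using free f by blast
  qed
qed

lemma finite_T: "finite (T \<inter> cball 0 R)"
proof -
  have "finite ((\<lambda>f. f 0) ` {f \<in> G. dist (f 0) 0 \<le> R})" using locally_finite by blast
  moreover have "T \<inter> cball 0 R \<subseteq> (\<lambda>f. f 0) ` {f \<in> G. dist (f 0) 0 \<le> R}"
  proof
    fix c assume "c \<in> T \<inter> cball 0 R"
    then show "c \<in> (\<lambda>f. f 0) ` {f \<in> G. dist (f 0) 0 \<le> R}"
      by (intro image_eqI[of _ _ "\<lambda>z. z + c"]) (auto simp: T_def)
  qed
  ultimately show ?thesis by (rule finite_subset[rotated])
qed

lemma T_line_generator:
  assumes v: "v \<in> T" "v \<noteq> 0"
  obtains c where "c > 0" "{s. s *\<^sub>R v \<in> T} = range (\<lambda>k::int. of_int k * c)"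
proof -
  define S where "S = {s. s *\<^sub>R v \<in> T}"
  have "finite (S \<inter> {-C..C})" for C
  proof (rule inj_on_finite[of "\<lambda>s. s *\<^sub>R v"])
    show "inj_on (\<lambda>s. s *\<^sub>R v) (S \<inter> {-C..C})" using v by (auto simp: inj_on_def)
    show "(\<lambda>s. s *\<^sub>R v) ` (S \<inter> {-C..C}) \<subseteq> T \<inter> cball 0 (C * norm v)"
      by (auto simp: S_def intro!: mult_right_mono)
  qed (rule finite_T)
  moreover have "x - y \<in> S" if "x \<in> S" "y \<in> S" for x y
    using that T_diff by (auto simp: S_def scaleR_left_diff_distrib)
  moreover have "1 \<in> S" using v by (simp add: S_def)
  ultimately show thesis using discrete_real_subgroup[of S 1] that by (auto simp: S_def)
qed

definition rank2 :: bool where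
  "rank2 \<longleftrightarrow> (\<exists>v\<in>T. \<exists>w\<in>T. Im (cnj v * w) \<noteq> 0)"

lemma parallel_real_multiple:
  assumes "Im (cnj v * w) = 0" "v \<noteq> 0"
  obtains s where "w = s *\<^sub>R v"
proof -
  have "cnj v * w = of_real (Re (cnj v * w))" using assms(1) by (simp add: complex_eq_iff)
  then have "v * cnj v * w = of_real (Re (cnj v * w)) * v" by (metis mult.assoc mult.commute)
  then have "of_real ((norm v)\<^sup>2) * w = of_real (Re (cnj v * w)) * v" by (simp flip: complex_norm_square)
  then have "w = (Re (cnj v * w) / (norm v)\<^sup>2) *\<^sub>R v"
    using assms(2) by (simp add: scaleR_conv_of_real field_simps)
  then show thesis by (rule that)
qed

lemma funpow_translation:
  assumes "f \<circ> f = (\<lambda>z. z + t)"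
  shows "(f ^^ (2 * n)) z = z + of_nat n * t"
proof (induction n)
  case (Suc n)
  have "(f ^^ (2 * Suc n)) z = (f \<circ> f) ((f ^^ (2 * n)) z)" by simp
  also have "\<dots> = (z + of_nat n * t) + t" unfolding assms Suc.IH ..
  finally show ?case by (simp add: algebra_simps)
qed simp

text \<open>
  If all translation vectors are parallel then, by discreteness, they are integer multiples
  of one of them. The squares of two motions are translations, so suitable powers of
  the motions are equal or inverse to each other.
\<close>

lemma rank2I:
  assumes k: "k1 \<in> G" "k2 \<in> G"
    and ind: "\<And>n m. k1 ^^ n = k2 ^^ m \<Longrightarrow> n = 0" "\<And>n m. k1 ^^ n \<circ> k2 ^^ m = id \<Longrightarrow> n = 0"
      "\<And>m. k2 ^^ m = id \<Longrightarrow> m = 0"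
  shows rank2
proof (rule ccontr)
  assume nr: "\<not> rank2"
  obtain t1 where t1: "t1 \<in> T" "k1 \<circ> k1 = (\<lambda>z. z + t1)" "t1 = 0 \<Longrightarrow> k1 = id"
    using square_translation[OF k(1)] by blast
  obtain t2 where t2: "t2 \<in> T" "k2 \<circ> k2 = (\<lambda>z. z + t2)" "t2 = 0 \<Longrightarrow> k2 = id"
    using square_translation[OF k(2)] by blast
  have t10: "t1 \<noteq> 0" using t1(3) ind(1)[of 1 0] by auto
  have t20: "t2 \<noteq> 0" using t2(3) ind(3)[of 1] by auto
  have "Im (cnj t1 * t2) = 0" using nr t1 t2 by (auto simp: rank2_def)
  then obtain s where s: "t2 = s *\<^sub>R t1" using parallel_real_multiple t10 by blast
  obtain c where c: "c > 0" "{s. s *\<^sub>R t1 \<in> T} = range (\<lambda>k::int. of_int k * c)"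
    using T_line_generator[OF t1(1) t10] by blast
  have "s \<in> {s. s *\<^sub>R t1 \<in> T}" "1 \<in> {s. s *\<^sub>R t1 \<in> T}" using s t1 t2 by auto
  then have "s \<in> range (\<lambda>k::int. of_int k * c)" "1 \<in> range (\<lambda>k::int. of_int k * c)" unfolding c by auto
  then obtain m k :: int where mk: "s = of_int m * c" "1 = of_int k * c" by (elim rangeE)
  have m0: "m \<noteq> 0" using mk t20 s by auto
  have e: "of_int m * t1 = of_int k * t2"
    unfolding s scaleR_conv_of_real mk(1) using arg_cong[OF mk(2), of complex_of_real] by simp
  define N M where "N = nat \<bar>m\<bar>" and "M = nat \<bar>k\<bar>"
  have N0: "2 * N \<noteq> 0" using m0 by (simp add: N_def)
  have "of_nat N * t1 = of_nat M * t2 \<or> of_nat N * t1 = - of_nat M * t2"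
  proof -
    have sq: "(of_nat (nat \<bar>j\<bar>) :: complex)\<^sup>2 = (of_int j)\<^sup>2" for j by (cases "j \<ge> 0") auto
    have "(of_nat N * t1)\<^sup>2 = (of_nat M * t2)\<^sup>2"
      unfolding power_mult_distrib N_def M_def sq unfolding power_mult_distrib[symmetric] e ..
    then show ?thesis by (simp add: power2_eq_iff)
  qed
  then show False
  proof
    assume "of_nat N * t1 = of_nat M * t2"
    then have "k1 ^^ (2 * N) = k2 ^^ (2 * M)"
      by (simp add: fun_eq_iff funpow_translation[OF t1(2)] funpow_translation[OF t2(2)])
    then show False using ind(1)[of "2 * N" "2 * M"] N0 by metis
  next
    assume "of_nat N * t1 = - of_nat M * t2"
    then have "k1 ^^ (2 * N) \<circ> k2 ^^ (2 * M) = id"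
      by (simp add: fun_eq_iff funpow_translation[OF t1(2)] funpow_translation[OF t2(2)])
    then show False using ind(2)[of "2 * N" "2 * M"] N0 by metis
  qed
qed

end

text \<open>
  Up to the factor \<open>norm v\<close>, these are the coordinates orthogonal and parallel to \<open>v\<close>.
\<close>

definition cross :: "complex \<Rightarrow> complex \<Rightarrow> real" where "cross v z = Im (cnj v * z)"
definition along :: "complex \<Rightarrow> complex \<Rightarrow> real" where "along v z = Re (cnj v * z)"

lemma cross_simps [simp]:
  "cross v (z + w) = cross v z + cross v w" "cross v (z - w) = cross v z - cross v w"
  "cross v (- z) = - cross v z" "cross v 0 = 0" "cross v v = 0" "cross v (s *\<^sub>R z) = s * cross v z"
  "cross v (z / 2) = cross v z / 2"
  by (simp_all add: cross_def algebra_simps)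

lemma along_simps [simp]:
  "along v (z + w) = along v z + along v w" "along v (z - w) = along v z - along v w"
  "along v (- z) = - along v z" "along v 0 = 0" "along v (s *\<^sub>R z) = s * along v z"
  "along v (z / 2) = along v z / 2"
  by (simp_all add: along_def algebra_simps)

lemma along_self [simp]: "along v v = (norm v)\<^sup>2"
  unfolding along_def cmod_power2 by (simp add: power2_eq_square)

lemma cross_of_int [simp]: "cross v (of_int k * z) = of_int k * cross v z"
  "cross v (of_nat n * z) = of_nat n * cross v z"
  "along v (of_int k * z) = of_int k * along v z" "along v (of_nat n * z) = of_nat n * along v z"
  by (simp_all add: cross_def along_def algebra_simps)

lemma abs_cross_le: "\<bar>cross v z\<bar> \<le> norm v * norm z" "\<bar>along v z\<bar> \<le> norm v * norm z"
  unfolding cross_def along_def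
  using abs_Im_le_cmod[of "cnj v * z"] abs_Re_le_cmod[of "cnj v * z"] by (simp_all add: norm_mult)

lemma norm_le_cross_along: "norm v * norm z \<le> \<bar>cross v z\<bar> + \<bar>along v z\<bar>"
  unfolding cross_def along_def using cmod_le[of "cnj v * z"] by (simp add: norm_mult)

lemma cross_along_eqI: "v \<noteq> 0 \<Longrightarrow> cross v z = cross v w \<Longrightarrow> along v z = along v w \<Longrightarrow> z = w"
  using norm_le_cross_along[of v "z - w"] by (simp add: mult_le_0_iff)

context plane_group
begin

text \<open>
  Motions act on the coordinate across an adapted vector by shifts. Without glide reflections
  every vector is adapted, and with them those orthogonal to the glide axes are.
\<close>

definition adapted :: "complex \<Rightarrow> bool" where
  "adapted v \<longleftrightarrow> (\<forall>f\<in>G. \<forall>z. cross v (f z) = cross v z + cross v (f 0))"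

lemma cross_zero_multiple:
  assumes "cross v w = 0" "v \<noteq> 0"
  obtains s where "w = s *\<^sub>R v"
  using parallel_real_multiple[of v w] assms unfolding cross_def by metis

lemma adaptedD: "adapted v \<Longrightarrow> f \<in> G \<Longrightarrow> cross v (f z) = cross v z + cross v (f 0)"
  unfolding adapted_def by blast

lemma shift_in: "f \<in> G \<Longrightarrow> t \<in> T \<Longrightarrow> (\<lambda>z. f z + t) \<in> G"
  using comp_in[of "\<lambda>z. z + t" f] by (simp add: T_def comp_def)

text \<open>
  Composing with multiples of the translation by \<open>v\<close> bounds the coordinate along \<open>v\<close>, so
  that local finiteness makes the group of shifts across \<open>v\<close> discrete.
\<close>

lemma adapted_shifts:
  assumes v: "v \<in> T" "v \<noteq> 0" "adapted v" and g: "g \<in> G" "cross v (g 0) \<noteq> 0"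
  obtains c where "c > 0" "(\<lambda>f. cross v (f 0)) ` G = range (\<lambda>k::int. of_int k * c)"
proof (rule discrete_real_subgroup[where S="(\<lambda>f. cross v (f 0)) ` G"])
  fix x y assume "x \<in> (\<lambda>f. cross v (f 0)) ` G" "y \<in> (\<lambda>f. cross v (f 0)) ` G"
  then obtain f h where f: "f \<in> G" "x = cross v (f 0)" and h: "h \<in> G" "y = cross v (h 0)" by auto
  obtain h' where h': "h' \<in> G" "h \<circ> h' = id" using inverse_in[OF h(1)] by blast
  have "h (h' 0) = 0" using fun_cong[OF h'(2), of 0] by simp
  then have "cross v (h' 0) = - y"
    using adaptedD[OF v(3) h(1), of "h' 0"] h(2) by simp
  moreover have "cross v ((f \<circ> h') 0) = cross v (h' 0) + x"
    using adaptedD[OF v(3) f(1), of "h' 0"] f(2) by simp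
  ultimately show "x - y \<in> (\<lambda>f. cross v (f 0)) ` G"
    using comp_in[OF f(1) h'(1)] by (intro image_eqI[of _ _ "f \<circ> h'"]) auto
next
  fix C
  define R where "R = (C + (norm v)\<^sup>2) / norm v"
  have "(\<lambda>f. cross v (f 0)) ` G \<inter> {-C..C} \<subseteq> (\<lambda>f. cross v (f 0)) ` {f \<in> G. dist (f 0) 0 \<le> R}"
  proof
    fix x assume "x \<in> (\<lambda>f. cross v (f 0)) ` G \<inter> {-C..C}"
    then obtain f where f: "f \<in> G" "x = cross v (f 0)" "\<bar>x\<bar> \<le> C" by (auto simp: abs_le_iff)
    define n where "n = \<lfloor>along v (f 0) / (norm v)\<^sup>2\<rfloor>"
    define h where "h = (\<lambda>z. f z + of_int (- n) * v)"
    have h: "h \<in> G" unfolding h_def by (intro shift_in f T_of_int v)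
    have hx: "cross v (h 0) = x" by (simp add: h_def f)
    have "along v (h 0) = along v (f 0) - of_int n * (norm v)\<^sup>2" by (simp add: h_def)
    then have "0 \<le> along v (h 0)" "along v (h 0) < (norm v)\<^sup>2"
      using v(2) floor_divide_lower[of "(norm v)\<^sup>2" "along v (f 0)"] floor_divide_upper[of "(norm v)\<^sup>2" "along v (f 0)"]
      by (auto simp: n_def algebra_simps)
    then have "norm v * norm (h 0) \<le> C + (norm v)\<^sup>2" using norm_le_cross_along[of v "h 0"] f hx by linarith
    then have "norm (h 0) \<le> R" using v(2) by (simp add: R_def field_simps)
    then show "x \<in> (\<lambda>f. cross v (f 0)) ` {f \<in> G. dist (f 0) 0 \<le> R}" using h hx by force
  qed
  then show "finite ((\<lambda>f. cross v (f 0)) ` G \<inter> {-C..C})" by (rule finite_subset) (use locally_finite in blast)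
next
  show "cross v (g 0) \<in> (\<lambda>f. cross v (f 0)) ` G" "cross v (g 0) \<noteq> 0" using g by auto
qed (use that in blast)

text \<open>
  An element of the cusp group that matches two points of a half-circle preserves heights, so its
  shadow exchanges two points of the diameter that are symmetric about the midpoint. That
  there is no such fold keeps the half-circle from meeting its translates by the cusp group. The diameter
  of interest is known up to a small error only, whence the stable version.
\<close>

definition unfolded :: "complex \<Rightarrow> complex \<Rightarrow> bool" where
  "unfolded e1 e2 \<longleftrightarrow> (\<forall>f\<in>G. \<forall>s. f \<noteq> id \<longrightarrow> \<bar>s\<bar> \<le> 1 \<longrightarrow>
     f ((e1 + e2) /\<^sub>R 2 + s *\<^sub>R ((e1 - e2) /\<^sub>R 2)) \<noteq> (e1 + e2) /\<^sub>R 2 - s *\<^sub>R ((e1 - e2) /\<^sub>R 2))"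

definition stably_unfoldable :: "complex \<Rightarrow> complex \<Rightarrow> bool" where
  "stably_unfoldable a b \<longleftrightarrow> (\<exists>\<delta>>0. \<forall>N. \<exists>p\<in>G. dist (p a) b > N \<and>
     (\<forall>e1 e2. dist e1 (p a) \<le> \<delta> \<longrightarrow> dist e2 b \<le> \<delta> \<longrightarrow> unfolded e1 e2))"

lemma stably_unfoldableI:
  assumes "\<delta> > 0" "v \<in> T" "v \<noteq> 0" "p \<in> G"
    and unf: "\<And>n e1 e2. dist e1 (p a + of_nat n * v) \<le> \<delta> \<Longrightarrow> dist e2 b \<le> \<delta> \<Longrightarrow> unfolded e1 e2"
  shows "stably_unfoldable a b"
  unfolding stably_unfoldable_def
proof (intro exI[of _ \<delta>] conjI allI assms(1))
  fix N :: real
  obtain n :: nat where n: "real n * norm v > N + dist (p a) b"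
    using reals_Archimedean3[of "norm v"] assms(3) by auto
  define q where "q = (\<lambda>z. p z + of_nat n * v)"
  have "q \<in> G" unfolding q_def by (intro shift_in assms T_of_nat)
  moreover have "real n * norm v \<le> dist (q a) b + dist (p a) b"
    using norm_triangle_ineq4[of "q a - b" "p a - b"] by (simp add: q_def dist_norm norm_mult)
  then have "dist (q a) b > N" using n by linarith
  ultimately show "\<exists>p\<in>G. dist (p a) b > N \<and>
     (\<forall>e1 e2. dist e1 (p a) \<le> \<delta> \<longrightarrow> dist e2 b \<le> \<delta> \<longrightarrow> unfolded e1 e2)"
    using unf[of _ n] by (intro bexI[of _ q]) (auto simp: q_def)
qed

lemma folding_shift:
  assumes "adapted v" "f \<in> G"
    "f ((e1 + e2) /\<^sub>R 2 + s *\<^sub>R ((e1 - e2) /\<^sub>R 2)) = (e1 + e2) /\<^sub>R 2 - s *\<^sub>R ((e1 - e2) /\<^sub>R 2)"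
  shows "cross v (f 0) = - s * (cross v e1 - cross v e2)"
proof -
  define m d where "m = (e1 + e2) /\<^sub>R 2" and "d = (e1 - e2) /\<^sub>R 2"
  have "cross v (m - s *\<^sub>R d) = cross v (m + s *\<^sub>R d) + cross v (f 0)"
    using adaptedD[OF assms(1,2), of "m + s *\<^sub>R d"] assms(3) unfolding m_def d_def by simp
  then show ?thesis by (simp add: d_def algebra_simps)
qed

lemma folding_small_shift:
  assumes "adapted v" "f \<in> G" "cross v (f 0) = 0" "cross v e1 \<noteq> cross v e2"
    "f ((e1 + e2) /\<^sub>R 2 + s *\<^sub>R ((e1 - e2) /\<^sub>R 2)) = (e1 + e2) /\<^sub>R 2 - s *\<^sub>R ((e1 - e2) /\<^sub>R 2)"
  shows "f = id"
proof -
  have "s = 0" using folding_shift[OF assms(1,2,5)] assms(3,4) by simp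
  then show ?thesis using free[OF assms(2)] assms(5) by simp
qed

lemma cross_near:
  assumes "dist e1 (a + of_nat n * v) \<le> \<delta>" "dist e2 b \<le> \<delta>"
  shows "\<bar>(cross v e1 - cross v e2) - (cross v a - cross v b)\<bar> \<le> 2 * norm v * \<delta>"
    "\<bar>(along v e1 + along v e2) - (along v a + along v b + of_nat n * (norm v)\<^sup>2)\<bar> \<le> 2 * norm v * \<delta>"
proof -
  have "norm v * norm (e1 - (a + of_nat n * v)) \<le> norm v * \<delta>" "norm v * norm (e2 - b) \<le> norm v * \<delta>"
    using assms by (auto simp: dist_norm intro: mult_left_mono)
  then have "\<bar>cross v (e1 - (a + of_nat n * v))\<bar> \<le> norm v * \<delta>" "\<bar>cross v (e2 - b)\<bar> \<le> norm v * \<delta>"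
    "\<bar>along v (e1 - (a + of_nat n * v))\<bar> \<le> norm v * \<delta>" "\<bar>along v (e2 - b)\<bar> \<le> norm v * \<delta>"
    using abs_cross_le order_trans by blast+
  then show "\<bar>(cross v e1 - cross v e2) - (cross v a - cross v b)\<bar> \<le> 2 * norm v * \<delta>"
    "\<bar>(along v e1 + along v e2) - (along v a + along v b + of_nat n * (norm v)\<^sup>2)\<bar> \<le> 2 * norm v * \<delta>"
    by simp_all
qed

text \<open>
  In the direction \<open>v\<close> segments can be made long without changing their width across \<open>v\<close>. If that
  width is smaller than every nonzero shift across \<open>v\<close>, then a motion folding the segment
  shifts by 0, so it fixes the midpoint.
\<close>

lemma stably_unfoldable_transverse:
  assumes v: "v \<in> T" "v \<noteq> 0" "adapted v"
    and c: "c > 0" "(\<lambda>f. cross v (f 0)) ` G = range (\<lambda>k::int. of_int k * c)"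
    and ab: "cross v a - cross v b \<notin> (\<lambda>f. cross v (f 0)) ` G"
  shows "stably_unfoldable a b"
proof -
  define k where "k = \<lfloor>(cross v a - cross v b) / c\<rfloor>"
  have "of_int (- k) * c \<in> (\<lambda>f. cross v (f 0)) ` G" unfolding c(2) by blast
  then obtain p where p: "p \<in> G" "cross v (p 0) = - of_int k * c" by auto
  define D where "D = cross v (p a) - cross v b"
  have D: "D = cross v a - cross v b - of_int k * c" using adaptedD[OF v(3) p(1), of a] p(2) unfolding D_def by linarith
  have "of_int k * c \<in> (\<lambda>f. cross v (f 0)) ` G" unfolding c(2) by blast
  then have "D \<noteq> 0" using ab D by auto
  moreover have "D \<ge> 0" "D < c"
    using c(1) floor_divide_lower[of c "cross v a - cross v b"] floor_divide_upper[of c "cross v a - cross v b"]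
    by (auto simp: D k_def algebra_simps)
  ultimately have D0: "0 < D" "D < c" by auto
  define \<epsilon> where "\<epsilon> = min (D / 2) ((c - D) / 2)"
  have "\<epsilon> \<le> D / 2" "\<epsilon> \<le> (c - D) / 2" unfolding \<epsilon>_def by (rule min.cobounded1, rule min.cobounded2)
  moreover have "\<epsilon> > 0" using D0 by (simp add: \<epsilon>_def)
  ultimately have \<epsilon>: "\<epsilon> > 0" "\<epsilon> < D" "D + \<epsilon> < c" using D0 by (simp_all add: field_simps)
  define \<delta> where "\<delta> = \<epsilon> / (2 * norm v)"
  have nv: "2 * norm v * \<delta> = \<epsilon>" using v(2) by (simp add: \<delta>_def)
  show ?thesis
  proof (rule stably_unfoldableI[OF _ v(1,2) p(1)])
    show "\<delta> > 0" using \<epsilon> v(2) by (simp add: \<delta>_def)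
    fix n e1 e2 assume e: "dist e1 (p a + of_nat n * v) \<le> \<delta>" "dist e2 b \<le> \<delta>"
    have w: "\<bar>(cross v e1 - cross v e2) - D\<bar> \<le> \<epsilon>" using cross_near(1)[OF e] unfolding D_def nv .
    show "unfolded e1 e2" unfolding unfolded_def
    proof (intro ballI allI impI notI)
      fix f s assume f: "f \<in> G" "f \<noteq> id" and s: "\<bar>s\<bar> \<le> 1"
        and eq: "f ((e1 + e2) /\<^sub>R 2 + s *\<^sub>R ((e1 - e2) /\<^sub>R 2)) = (e1 + e2) /\<^sub>R 2 - s *\<^sub>R ((e1 - e2) /\<^sub>R 2)"
      have "\<bar>cross v (f 0)\<bar> = \<bar>s\<bar> * \<bar>cross v e1 - cross v e2\<bar>"
        using folding_shift[OF v(3) f(1) eq] by (simp add: abs_mult)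
      also have "\<dots> \<le> 1 * \<bar>cross v e1 - cross v e2\<bar>" by (intro mult_right_mono s) simp
      finally have "\<bar>cross v (f 0)\<bar> \<le> \<bar>cross v e1 - cross v e2\<bar>" by simp
      moreover have "\<bar>cross v e1 - cross v e2\<bar> < c" using w \<epsilon> by (simp add: abs_le_iff abs_less_iff)
      ultimately have lt: "\<bar>cross v (f 0)\<bar> < c" by (rule le_less_trans)
      have "cross v (f 0) \<in> range (\<lambda>k::int. of_int k * c)" unfolding c(2)[symmetric] using f(1) by blast
      then obtain j :: int where j: "cross v (f 0) = of_int j * c" by blast
      have "\<bar>real_of_int j\<bar> * c < 1 * c" using lt c(1) unfolding j by (simp add: abs_mult)
      then have "j = 0" using c(1) by simp
      then have "cross v (f 0) = 0" using j by simp
      moreover have "cross v e1 \<noteq> cross v e2" using w \<epsilon> by auto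
      ultimately show False using folding_small_shift[OF v(3) f(1) _ _ eq] f(2) by blast
    qed
  qed
qed

text \<open>
  With a glide reflection, take \<open>v\<close> orthogonal to the glide axes. If the shortest shift across
  \<open>v\<close> itself is the width of the segment, then a folding motion with this shift
  is a glide reflection, whose axis contains the midpoint of the segment; as the axes are a discrete
  family, this would place the point \<open>a\<close> in the orbit of \<open>b\<close>.
\<close>

lemma stably_unfoldable_glide:
  assumes v: "v \<in> T" "v \<noteq> 0" and u: "norm u = 1" "u * cnj v = - v"
    and form: "\<And>f. f \<in> G \<Longrightarrow> (\<exists>c\<in>T. f = (\<lambda>z. z + c)) \<or> (\<exists>c. f = (\<lambda>z. u * cnj z + c))"
    and glide: "(\<lambda>z. u * cnj z + g0) \<in> G"
    and rank: "\<exists>f\<in>G. cross v (f 0) \<noteq> 0"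
    and ab: "\<And>f. f \<in> G \<Longrightarrow> f b \<noteq> a"
  shows "stably_unfoldable a b"
proof -
  have uv: "cnj v * u = - cnj (cnj v)"
  proof -
    have "cnj v * u = - v" using u(2) by (simp add: mult.commute)
    then show ?thesis by simp
  qed
  have cu: "cnj v * (u * cnj z) = - cnj (cnj v * z)" for z
    using uv by (metis complex_cnj_mult mult.assoc mult_minus_left)
  have X: "cross v (u * cnj z) = cross v z" "along v (u * cnj z) = - along v z" for z
    unfolding cross_def along_def cu by simp_all
  have ad: "adapted v" unfolding adapted_def
  proof (intro ballI allI)
    fix f z assume "f \<in> G"
    from form[OF this] show "cross v (f z) = cross v z + cross v (f 0)" by (auto simp: X)
  qed
  obtain g where g: "g \<in> G" "cross v (g 0) \<noteq> 0" using rank by blast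
  obtain c where c: "c > 0" "(\<lambda>f. cross v (f 0)) ` G = range (\<lambda>k::int. of_int k * c)"
    using adapted_shifts[OF v ad g] .
  show ?thesis
  proof (cases "cross v a - cross v b \<in> (\<lambda>f. cross v (f 0)) ` G")
    case False
    then show ?thesis using stably_unfoldable_transverse[OF v ad c] by blast
  next
    case True
    then obtain k :: int where k: "cross v a - cross v b = of_int k * c" unfolding c(2) by auto
    have "of_int (1 - k) * c \<in> (\<lambda>f. cross v (f 0)) ` G" unfolding c(2) by blast
    then obtain p where p: "p \<in> G" "cross v (p 0) = of_int (1 - k) * c" by auto
    define a' where "a' = p a"
    have a': "cross v a' - cross v b = c"
      using adaptedD[OF ad p(1), of a] p(2) k unfolding a'_def by (simp add: algebra_simps)
    have ab': "f b \<noteq> a'" if f: "f \<in> G" for f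
    proof
      assume e: "f b = a'"
      obtain q where q: "q \<in> G" "q \<circ> p = id" using inverse_in[OF p(1)] by blast
      have "(q \<circ> f) b = a" using fun_cong[OF q(2), of a] e by (simp add: a'_def)
      then show False using ab comp_in[OF q(1) f] by blast
    qed
    \<comment> \<open>A glide reflection and a translation with the same shift across \<open>v\<close> would differ by a
      reflection, which has fixed points.\<close>
    have is_glide: "\<exists>d. f = (\<lambda>z. u * cnj z + d)" if f: "f \<in> G" and fc: "\<bar>cross v (f 0)\<bar> = c" for f
    proof (rule ccontr)
      assume "\<nexists>d. f = (\<lambda>z. u * cnj z + d)"
      then obtain t where t: "t \<in> T" "f = (\<lambda>z. z + t)" using form[OF f] by blast
      obtain j :: int where j: "cross v g0 = of_int j * c"
        using imageI[OF glide, of "\<lambda>f. cross v (f 0)"] unfolding c(2) by auto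
      obtain i :: int where i: "cross v g0 = of_int i * cross v t"
      proof (cases "cross v t \<ge> 0")
        case True
        then have "cross v t = c" using fc t by simp
        then show thesis using that[of j] j by simp
      next
        case False
        then have "cross v t = - c" using fc t by simp
        then show thesis using that[of "- j"] j by simp
      qed
      define d where "d = g0 + of_int (- i) * t"
      have h: "(\<lambda>z. u * cnj z + d) \<in> G"
        using shift_in[OF glide T_of_int[OF t(1), of "- i"]] by (simp add: d_def algebra_simps)
      have "cross v d = 0" using i by (simp add: d_def)
      then obtain s where s: "d = s *\<^sub>R v" using cross_zero_multiple[OF _ v(2)] by blast
      have "u * cnj d = - d" unfolding s complex_cnj_scaleR mult_scaleR_right u(2) by simp
      then have "u * cnj (d / 2) + d = d / 2" by simp
      then have "(\<lambda>z. u * cnj z + d) = id" using free[OF h] by blast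
      then have e: "u * cnj z + d = z" for z by (metis id_apply)
      have "d = 0" using e[of 0] by simp
      moreover have "u = 1" using e[of 1] calculation by simp
      ultimately show False using e[of \<i>] by simp
    qed
    \<comment> \<open>The glide axis of \<open>f\<close> is the line on which \<open>2 * along v\<close> equals \<open>along v (f 0)\<close>.\<close>
    define y where "y = along v a' + along v b"
    define Q where "Q = (\<lambda>f. along v (f 0)) ` {f \<in> G. \<bar>cross v (f 0)\<bar> = c \<and> \<bar>along v (f 0) - y\<bar> \<le> 1}"
    have "finite Q" unfolding Q_def
    proof (intro finite_imageI finite_subset[OF _ locally_finite[of 0 "(c + (\<bar>y\<bar> + 1)) / norm v"]] subsetI)
      fix f assume "f \<in> {f \<in> G. \<bar>cross v (f 0)\<bar> = c \<and> \<bar>along v (f 0) - y\<bar> \<le> 1}"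
      then have f: "f \<in> G" "\<bar>cross v (f 0)\<bar> = c" "\<bar>along v (f 0) - y\<bar> \<le> 1" by auto
      have "norm v * norm (f 0) \<le> c + (\<bar>y\<bar> + 1)" using norm_le_cross_along[of v "f 0"] f by linarith
      then show "f \<in> {f \<in> G. dist (f 0) 0 \<le> (c + (\<bar>y\<bar> + 1)) / norm v}" using f v(2) by (simp add: field_simps)
    qed
    moreover have "y \<notin> Q"
    proof
      assume "y \<in> Q"
      then obtain f where f: "f \<in> G" "\<bar>cross v (f 0)\<bar> = c" "along v (f 0) = y" by (auto simp: Q_def)
      obtain d where d: "f = (\<lambda>z. u * cnj z + d)" using is_glide f by blast
      have cd: "\<bar>cross v d\<bar> = c" "along v d = y" using f d by auto
      have fz: "cross v (f z) = cross v z + cross v d" "along v (f z) = y - along v z" for z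
        using X cd unfolding d by auto
      show False
      proof (cases "cross v d \<ge> 0")
        case True
        then have "f b = a'" using fz[of b] cd a' by (intro cross_along_eqI[OF v(2)]) (auto simp: y_def)
        then show False using ab' f by blast
      next
        case False
        then have "f a' = b" using fz[of a'] cd a' by (intro cross_along_eqI[OF v(2)]) (auto simp: y_def)
        moreover obtain f' where "f' \<in> G" "f' \<circ> f = id" using inverse_in f(1) by blast
        ultimately show False using ab' by (metis comp_apply id_apply)
      qed
    qed
    ultimately obtain \<eta> where \<eta>: "\<eta> > 0" "\<And>x. x \<in> Q \<Longrightarrow> \<eta> \<le> dist y x"
      using finite_set_avoid[of Q y] by metis
    define \<epsilon> where "\<epsilon> = min (min \<eta> 1) c / 2"
    have \<epsilon>: "\<epsilon> > 0" "\<epsilon> < \<eta>" "\<epsilon> \<le> 1" "\<epsilon> < c" using \<eta>(1) c(1) by (auto simp: \<epsilon>_def min_def)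
    define \<delta> where "\<delta> = \<epsilon> / (2 * norm v)"
    have nv: "2 * norm v * \<delta> = \<epsilon>" using v(2) by (simp add: \<delta>_def)
    show ?thesis
    proof (rule stably_unfoldableI[OF _ v p(1)])
      show "\<delta> > 0" using \<epsilon> v(2) by (simp add: \<delta>_def)
      fix n e1 e2 assume e: "dist e1 (p a + of_nat n * v) \<le> \<delta>" "dist e2 b \<le> \<delta>"
      note near = cross_near[OF e, unfolded nv, folded a'_def]
      have w: "\<bar>(cross v e1 - cross v e2) - c\<bar> \<le> \<epsilon>" using near(1) unfolding a' .
      have w2: "\<bar>(along v e1 + along v e2) - (y + of_nat n * (norm v)\<^sup>2)\<bar> \<le> \<epsilon>" using near(2) unfolding y_def .
      show "unfolded e1 e2" unfolding unfolded_def
      proof (intro ballI allI impI notI)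
        fix f s assume f: "f \<in> G" "f \<noteq> id" and s: "\<bar>s\<bar> \<le> 1"
          and eq: "f ((e1 + e2) /\<^sub>R 2 + s *\<^sub>R ((e1 - e2) /\<^sub>R 2)) = (e1 + e2) /\<^sub>R 2 - s *\<^sub>R ((e1 - e2) /\<^sub>R 2)"
        have "\<bar>cross v (f 0)\<bar> = \<bar>s\<bar> * \<bar>cross v e1 - cross v e2\<bar>"
          using folding_shift[OF ad f(1) eq] by (simp add: abs_mult)
        also have "\<dots> \<le> 1 * \<bar>cross v e1 - cross v e2\<bar>" by (intro mult_right_mono s) simp
        finally have "\<bar>cross v (f 0)\<bar> \<le> \<bar>cross v e1 - cross v e2\<bar>" by simp
        moreover have "\<bar>cross v e1 - cross v e2\<bar> < 2 * c" using w \<epsilon> by (simp add: abs_le_iff abs_less_iff)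
        ultimately have lt: "\<bar>cross v (f 0)\<bar> < 2 * c" by (rule le_less_trans)
        have "cross v (f 0) \<in> range (\<lambda>k::int. of_int k * c)" unfolding c(2)[symmetric] using f(1) by blast
      then obtain j :: int where j: "cross v (f 0) = of_int j * c" by blast
        have "\<bar>real_of_int j\<bar> * c < 2 * c" using lt c(1) unfolding j by (simp add: abs_mult)
        then have "\<bar>real_of_int j\<bar> < 2" using c(1) by simp
        then have "j = 0 \<or> \<bar>j\<bar> = 1" by linarith
        moreover have "cross v e1 \<noteq> cross v e2" using w \<epsilon> by auto
        then have "j \<noteq> 0" using folding_small_shift[OF ad f(1) _ _ eq] f(2) j by auto
        ultimately have "\<bar>real_of_int j\<bar> = 1" by linarith
        then have fc: "\<bar>cross v (f 0)\<bar> = c" using j c(1) by (simp add: abs_mult)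
        then obtain d where d: "f = (\<lambda>z. u * cnj z + d)" using is_glide f(1) by blast
        have "along v ((e1 + e2) /\<^sub>R 2 - s *\<^sub>R ((e1 - e2) /\<^sub>R 2)) =
          - along v ((e1 + e2) /\<^sub>R 2 + s *\<^sub>R ((e1 - e2) /\<^sub>R 2)) + along v d"
          using X(2)[of "(e1 + e2) /\<^sub>R 2 + s *\<^sub>R ((e1 - e2) /\<^sub>R 2)"] unfolding eq[symmetric] d by simp
        then have da: "along v d = along v e1 + along v e2" by (simp add: algebra_simps)
        define h where "h = (\<lambda>z. f z + of_int (- int n) * v)"
        have h: "h \<in> G" unfolding h_def by (intro shift_in f T_of_int v)
        have "cross v (h 0) = cross v (f 0)" "along v (h 0) = along v d - of_nat n * (norm v)\<^sup>2"
          by (simp_all add: h_def d)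
        then have "\<bar>cross v (h 0)\<bar> = c" and hy: "\<bar>along v (h 0) - y\<bar> \<le> \<epsilon>" using fc da w2 by auto
        then have "along v (h 0) \<in> Q" using h \<epsilon> by (auto simp: Q_def)
        then show False using \<eta>(2) hy \<epsilon> by (fastforce simp: dist_real_def abs_minus_commute)
      qed
    qed
  qed
qed

text \<open>A lattice is the intersection of the preimages of its shift groups across two basis vectors.\<close>

lemma translation_group_separates:
  assumes tr: "\<And>f. f \<in> G \<Longrightarrow> \<exists>c\<in>T. f = (\<lambda>z. z + c)" and rank2
    and d: "d \<notin> T"
  obtains v where "v \<in> T" "v \<noteq> 0" "adapted v" "\<exists>w\<in>T. cross v w \<noteq> 0" "\<And>w. w \<in> T \<Longrightarrow> cross v d \<noteq> cross v w"
proof -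
  have ad: "adapted v" for v unfolding adapted_def
  proof (intro ballI allI)
    fix f z assume "f \<in> G"
    from tr[OF this] show "cross v (f z) = cross v z + cross v (f 0)" by auto
  qed
  have T0: "(\<lambda>f. cross v (f 0)) ` G = cross v ` T" for v
  proof
    show "(\<lambda>f. cross v (f 0)) ` G \<subseteq> cross v ` T" using tr by fastforce
    show "cross v ` T \<subseteq> (\<lambda>f. cross v (f 0)) ` G"
    proof
      fix x assume "x \<in> cross v ` T"
      then obtain w where "w \<in> T" "x = cross v w" by auto
      then show "x \<in> (\<lambda>f. cross v (f 0)) ` G" by (intro image_eqI[of _ _ "\<lambda>z. z + w"]) (auto simp: T_def)
    qed
  qed
  obtain v0 w0 where v0: "v0 \<in> T" "w0 \<in> T" "cross v0 w0 \<noteq> 0" using \<open>rank2\<close> by (auto simp: rank2_def cross_def)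
  then have v00: "v0 \<noteq> 0" by (auto simp: cross_def)
  obtain t where t: "t > 0" "{s. s *\<^sub>R v0 \<in> T} = range (\<lambda>k::int. of_int k * t)"
    using T_line_generator[OF v0(1) v00] .
  define v where "v = t *\<^sub>R v0"
  have "1 * t \<in> {s. s *\<^sub>R v0 \<in> T}" unfolding t(2) by (rule range_eqI[of _ _ 1]) simp
  then have v: "v \<in> T" "v \<noteq> 0" using t(1) v00 by (auto simp: v_def)
  have vc: "cross v z = t * cross v0 z" for z by (simp add: cross_def v_def algebra_simps)
  have prim: "\<exists>k::int. s *\<^sub>R v = of_int k * v" if "s *\<^sub>R v \<in> T" for s
  proof -
    have "s * t \<in> {s. s *\<^sub>R v0 \<in> T}" using that by (simp add: v_def)
    then obtain k :: int where "s * t = of_int k * t" unfolding t(2) by auto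
    then show ?thesis using t(1) by (intro exI[of _ k]) (simp add: scaleR_conv_of_real)
  qed
  have g: "(\<lambda>z. z + w0) \<in> G" "cross v (0 + w0) \<noteq> 0" using v0 t(1) by (simp_all add: T_def vc)
  obtain c where c: "c > 0" "cross v ` T = range (\<lambda>k::int. of_int k * c)"
    using adapted_shifts[OF v ad g] unfolding T0 .
  have "1 * c \<in> cross v ` T" unfolding c(2) by (rule range_eqI[of _ _ 1]) simp
  then obtain w where w: "w \<in> T" "cross v w = c" by auto
  have wc: "cross w v = - c" using w(2) by (simp add: cross_def algebra_simps)
  have decomp: "\<exists>k::int. \<exists>s. z = of_int k * w + s *\<^sub>R v" if "cross v z \<in> cross v ` T" for z
  proof -
    obtain k :: int where k: "cross v z = of_int k * c" using \<open>cross v z \<in> cross v ` T\<close> unfolding c(2) by auto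
    have "cross v (z - of_int k * w) = 0" using k w by simp
    then obtain s where "z - of_int k * w = s *\<^sub>R v" using cross_zero_multiple[OF _ v(2)] by blast
    then show ?thesis by (intro exI[of _ k] exI[of _ s]) (simp add: algebra_simps)
  qed
  show thesis
  proof (cases "cross v d \<in> cross v ` T")
    case False
    show thesis by (rule that[OF v ad]) (use False w c(1) in auto)
  next
    case True
    then obtain k s where d1: "d = of_int k * w + s *\<^sub>R v" using decomp by blast
    have "cross w d \<noteq> cross w x" if x: "x \<in> T" for x
    proof
      assume e: "cross w d = cross w x"
      obtain l r where x1: "x = of_int l * w + r *\<^sub>R v" using decomp x by blast
      have "r *\<^sub>R v = x - of_int l * w" using x1 by simp
      also have "\<dots> \<in> T" by (intro T_diff x T_of_int w)
      finally have "r *\<^sub>R v \<in> T" .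
      moreover have "s = r" using e wc c(1) by (simp add: d1 x1)
      ultimately have "d \<in> T" unfolding d1 by (intro T_add T_of_int w) simp
      then show False using \<open>d \<notin> T\<close> by blast
    qed
    moreover have "w \<noteq> 0" using w c(1) by auto
    moreover have "cross w v \<noteq> 0" using wc c(1) by simp
    ultimately show thesis using that[OF w(1) _ ad] v(1) by blast
  qed
qed

text \<open>
  If there are glide reflections, reflecting a lattice vector in the glide axes and taking the
  difference yields a lattice vector orthogonal to them.
\<close>

theorem rank2_stably_unfoldable:
  assumes rank2 and ab: "\<And>f. f \<in> G \<Longrightarrow> f b \<noteq> a"
  shows "stably_unfoldable a b"
proof -
  obtain u where u: "norm u = 1"
    and form: "\<And>f. f \<in> G \<Longrightarrow> (\<exists>c\<in>T. f = (\<lambda>z. z + c)) \<or> (\<exists>c. f = (\<lambda>z. u * cnj z + c))"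
    using glide_axis by blast
  show ?thesis
  proof (cases "\<exists>c. (\<lambda>z. u * cnj z + c) \<in> G")
    case False
    then have tr: "\<exists>c\<in>T. f = (\<lambda>z. z + c)" if "f \<in> G" for f using form[OF that] that by auto
    have "a - b \<notin> T"
    proof
      assume "a - b \<in> T"
      then show False using ab[of "\<lambda>z. z + (a - b)"] by (simp add: T_def)
    qed
    then obtain v where v: "v \<in> T" "v \<noteq> 0" "adapted v" "\<exists>w\<in>T. cross v w \<noteq> 0"
      "\<And>w. w \<in> T \<Longrightarrow> cross v (a - b) \<noteq> cross v w"
      using translation_group_separates[OF tr \<open>rank2\<close>] by metis
    obtain w where w: "w \<in> T" "cross v w \<noteq> 0" using v(4) by blast
    obtain c where c: "c > 0" "(\<lambda>f. cross v (f 0)) ` G = range (\<lambda>k::int. of_int k * c)"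
      using adapted_shifts[OF v(1-3), of "\<lambda>z. z + w"] w by (auto simp: T_def)
    have "cross v a - cross v b \<notin> (\<lambda>f. cross v (f 0)) ` G"
    proof
      assume "cross v a - cross v b \<in> (\<lambda>f. cross v (f 0)) ` G"
      then obtain f where f: "f \<in> G" "cross v (a - b) = cross v (f 0)" by auto
      obtain t where "t \<in> T" "f = (\<lambda>z. z + t)" using tr[OF f(1)] by blast
      then show False using v(5)[of t] f(2) by simp
    qed
    then show ?thesis using stably_unfoldable_transverse[OF v(1-3) c] by blast
  next
    case True
    then obtain g0 where g0: "(\<lambda>z. u * cnj z + g0) \<in> G" by blast
    have uu: "u * cnj u = 1" using u complex_norm_square[of u] by simp
    have refl: "u * cnj t \<in> T" if t: "t \<in> T" for t
    proof -
      obtain h where h: "h \<in> G" "(\<lambda>z. u * cnj z + g0) \<circ> h = id" using inverse_in[OF g0] by blast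
      \<comment> \<open>Conjugating a translation by a glide reflection reflects its vector.\<close>
      define k where "k = (\<lambda>z. u * cnj z + g0) \<circ> ((\<lambda>z. z + t) \<circ> h)"
      have k: "k \<in> G" unfolding k_def using t by (intro comp_in g0 h) (simp add: T_def)
      have "k z = z + u * cnj t" for z
      proof -
        have "u * cnj (h z) + g0 = z" using fun_cong[OF h(2), of z] by simp
        then show ?thesis by (simp add: k_def algebra_simps)
      qed
      then have "k = (\<lambda>z. z + u * cnj t)" by (simp add: fun_eq_iff)
      then show ?thesis using k by (simp add: T_def)
    qed
    obtain v0 w0 where vw: "v0 \<in> T" "w0 \<in> T" "cross v0 w0 \<noteq> 0" using \<open>rank2\<close> by (auto simp: rank2_def cross_def)
    have "\<not> (u * cnj v0 = v0 \<and> u * cnj w0 = w0)"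
    proof
      assume e: "u * cnj v0 = v0 \<and> u * cnj w0 = w0"
      have "cnj v0 * w0 = cnj v0 * (u * cnj w0)" using e by simp
      also have "\<dots> = (u * cnj v0) * cnj w0" by (simp add: mult_ac)
      also have "\<dots> = cnj (cnj v0 * w0)" using e by simp
      finally have "Im (cnj v0 * w0) = Im (cnj (cnj v0 * w0))" by simp
      then show False using vw by (simp add: cross_def mult.commute)
    qed
    then obtain t where t: "t \<in> T" "u * cnj t \<noteq> t" using vw by blast
    define v where "v = t - u * cnj t"
    have v: "v \<in> T" "v \<noteq> 0" using t refl T_diff by (auto simp: v_def)
    have "u * cnj v = u * cnj t - (u * cnj u) * t" by (simp add: v_def algebra_simps)
    then have uv: "u * cnj v = - v" by (simp add: uu v_def)
    have "\<exists>w\<in>T. cross v w \<noteq> 0"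
    proof (rule ccontr)
      assume "\<not> ?thesis"
      then obtain r s where "v0 = r *\<^sub>R v" "w0 = s *\<^sub>R v"
        using cross_zero_multiple[OF _ v(2)] vw by metis
      then have "cross v0 w0 = 0" by (simp add: cross_def)
      then show False using vw by simp
    qed
    then obtain w where "w \<in> T" "cross v w \<noteq> 0" by blast
    then have rk: "\<exists>f\<in>G. cross v (f 0) \<noteq> 0" by (intro bexI[of _ "\<lambda>z. z + w"]) (auto simp: T_def)
    show ?thesis by (rule stably_unfoldable_glide[OF v u uv _ g0 rk]) (use form ab in blast)+
  qed
qed

text \<open>
  If the translations are all parallel then the quotient of the plane is a cylinder or a
  Moebius band of infinite area: it contains arbitrarily many disjoint discs of a fixed radius.
\<close>

lemma not_rank2_packing:
  assumes nr: "\<not> rank2" and nt: "G \<noteq> {id}"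
  obtains \<rho> z where "\<rho> > 0"
    "\<And>i j f w. f \<in> G \<Longrightarrow> w \<in> ball (z i) \<rho> \<Longrightarrow> f w \<in> ball (z j) \<rho> \<Longrightarrow> i = (j::nat) \<and> f = id"
proof -
  obtain u where u: "norm u = 1"
    and form: "\<And>f. f \<in> G \<Longrightarrow> (\<exists>c\<in>T. f = (\<lambda>z. z + c)) \<or> (\<exists>c. f = (\<lambda>z. u * cnj z + c))"
    using glide_axis by blast
  obtain k where k: "k \<in> G" "k \<noteq> id" using nt id_in by blast
  obtain v where v: "v \<in> T" "v \<noteq> 0" using square_translation[OF k(1)] k(2) by metis
  have par: "cross v t = 0" if "t \<in> T" for t using nr v(1) that by (auto simp: rank2_def cross_def)
  have flip: "\<exists>t. t \<in> T \<and> t = u * cnj c + c \<and> t \<noteq> 0" if g: "(\<lambda>z. u * cnj z + c) \<in> G" for c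
  proof -
    obtain t where t: "t \<in> T" "(\<lambda>z. u * cnj z + c) \<circ> (\<lambda>z. u * cnj z + c) = (\<lambda>z. z + t)"
      "t = 0 \<Longrightarrow> (\<lambda>z. u * cnj z + c) = id" using square_translation[OF g] by metis
    have "t = u * cnj c + c" using fun_cong[OF t(2), of 0] by simp
    moreover have "(\<lambda>z. u * cnj z + c) \<noteq> id"
    proof
      assume "(\<lambda>z. u * cnj z + c) = id"
      then have e: "u * cnj z + c = z" for z by (metis id_apply)
      have "c = 0" using e[of 0] by simp
      moreover have "u = 1" using e[of 1] calculation by simp
      ultimately show False using e[of \<i>] by simp
    qed
    ultimately show ?thesis using t by blast
  qed
  have uu: "u * cnj u = 1" using u complex_norm_square[of u] by simp
  have X: "cross v (u * cnj z) = - cross v z" if g: "(\<lambda>z. u * cnj z + c) \<in> G" for c z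
  proof -
    obtain t where t: "t \<in> T" "t = u * cnj c + c" "t \<noteq> 0" using flip[OF g] by blast
    have "u * cnj t = (u * cnj u) * c + u * cnj c" by (simp add: t(2) algebra_simps)
    then have ut: "u * cnj t = t" by (simp add: uu t(2))
    obtain s where s: "t = s *\<^sub>R v" using cross_zero_multiple[OF par[OF t(1)] v(2)] by blast
    then have "s \<noteq> 0" using t by auto
    moreover have "s *\<^sub>R (u * cnj v) = s *\<^sub>R v" using ut unfolding s by simp
    ultimately have uv: "u * cnj v = v" by simp
    have "cnj v * (u * cnj z) = (u * cnj v) * cnj z" by (simp add: mult_ac)
    then have e: "cnj v * (u * cnj z) = cnj (cnj v * z)" unfolding uv by simp
    show ?thesis unfolding cross_def e by simp
  qed
  \<comment> \<open>All glide reflections have the same axis.\<close>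
  obtain \<kappa> where \<kappa>: "\<And>c. (\<lambda>z. u * cnj z + c) \<in> G \<Longrightarrow> cross v c = \<kappa>"
  proof (cases "\<exists>c. (\<lambda>z. u * cnj z + c) \<in> G")
    case True
    then obtain c0 where c0: "(\<lambda>z. u * cnj z + c0) \<in> G" by blast
    show thesis
    proof (rule that)
      fix c assume c: "(\<lambda>z. u * cnj z + c) \<in> G"
      have "(\<lambda>z. u * cnj z + c) \<circ> (\<lambda>z. u * cnj z + c0) = (\<lambda>z. z + (u * cnj c0 + c))"
      proof
        fix z
        have "((\<lambda>z. u * cnj z + c) \<circ> (\<lambda>z. u * cnj z + c0)) z = (u * cnj u) * z + (u * cnj c0 + c)"
          by (simp add: algebra_simps)
        then show "((\<lambda>z. u * cnj z + c) \<circ> (\<lambda>z. u * cnj z + c0)) z = z + (u * cnj c0 + c)"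
          unfolding uu by simp
      qed
      then have "u * cnj c0 + c \<in> T" using comp_in[OF c c0] by (simp add: T_def)
      then have "cross v (u * cnj c0 + c) = 0" by (rule par)
      then show "cross v c = cross v c0" using X[OF c0, of c0] by simp
    qed
  qed blast
  have "finite (T \<inter> cball 0 1)" by (rule finite_T)
  then obtain m where m: "m > 0" "\<And>t. t \<in> T \<inter> cball 0 1 \<Longrightarrow> t \<noteq> 0 \<Longrightarrow> m \<le> dist 0 t"
    using finite_set_avoid[of "T \<inter> cball 0 1" 0] by blast
  define \<rho> where "\<rho> = min (min m 1) (norm v) / 2"
  have \<rho>: "\<rho> > 0" "2 * \<rho> \<le> m" "2 * \<rho> \<le> 1" "2 * \<rho> \<le> norm v" using m(1) v(2) by (auto simp: \<rho>_def)
  define z where "z n = (\<kappa> / 2 / (norm v)\<^sup>2 + (real n + 1)) *\<^sub>R (\<i> * v)" for n :: nat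
  have "cross v (\<i> * v) = (norm v)\<^sup>2" unfolding cross_def cmod_power2 by (simp add: power2_eq_square)
  then have cz: "cross v (z n) = \<kappa> / 2 + (real n + 1) * (norm v)\<^sup>2" for n
    using v(2) by (simp add: z_def distrib_right)
  have near: "\<bar>cross v w - (\<kappa> / 2 + (real n + 1) * (norm v)\<^sup>2)\<bar> < (norm v)\<^sup>2 / 2" if "w \<in> ball (z n) \<rho>" for w n
  proof -
    have "\<bar>cross v (w - z n)\<bar> \<le> norm v * norm (w - z n)" by (rule abs_cross_le)
    also have "\<dots> < norm v * \<rho>" using that v(2) by (simp add: dist_norm norm_minus_commute)
    also have "\<dots> \<le> norm v * (norm v / 2)" using \<rho> by (intro mult_left_mono) auto
    finally show ?thesis using cz by (simp add: power2_eq_square)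
  qed
  show thesis
  proof (rule that[OF \<rho>(1)])
    fix i j f w assume f: "f \<in> G" and w: "w \<in> ball (z i) \<rho>" and fw: "f w \<in> ball (z j) \<rho>"
    have nn: "(norm v)\<^sup>2 > 0" using v(2) by simp
    show "i = j \<and> f = id"
    proof (cases "\<exists>c\<in>T. f = (\<lambda>z. z + c)")
      case True
      then obtain c where c: "c \<in> T" "f = (\<lambda>z. z + c)" by blast
      have "cross v (f w) = cross v w" using c par by simp
      then have "\<bar>(real i + 1) * (norm v)\<^sup>2 - (real j + 1) * (norm v)\<^sup>2\<bar> < (norm v)\<^sup>2"
        using near[OF w] near[OF fw] by linarith
      then have "\<bar>real i - real j\<bar> * (norm v)\<^sup>2 < 1 * (norm v)\<^sup>2" by (simp add: abs_mult flip: left_diff_distrib)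
      then have "\<bar>real i - real j\<bar> < 1" using nn by (simp only: mult_less_cancel_right_pos)
      then have ij: "i = j" by linarith
      have "norm c < 2 * \<rho>"
        using dist_triangle_less_add[of w "z i" \<rho> "f w" \<rho>] w fw ij c by (simp add: dist_commute dist_norm)
      then have "c = 0" using m(2)[of c] \<rho> c(1) by force
      then show ?thesis using ij c by (simp add: fun_eq_iff)
    next
      case False
      then obtain c where c: "f = (\<lambda>z. u * cnj z + c)" using form[OF f] by blast
      then have "cross v (f w) = \<kappa> - cross v w" using X \<kappa> f by simp
      moreover have "cross v x > \<kappa> / 2" if "x \<in> ball (z n) \<rho>" for x n
      proof -
        have "real n * (norm v)\<^sup>2 \<ge> 0" by simp
        then show ?thesis using near[OF that] nn unfolding distrib_right mult_1 by linarith
      qed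
      from this[OF w] this[OF fw] have "cross v w + cross v (f w) > \<kappa>" by linarith
      ultimately show ?thesis by simp
    qed
  qed
qed

end

section \<open>Discrete groups with a cusp at infinity\<close>

text \<open>
  The element \<open>g\<close> sends the boundary point \<open>b\<close> to infinity, and \<open>sqrt r\<close> is the radius of its
  isometric hemisphere, on which it preserves heights.
\<close>

definition moves :: "(hyp3 \<Rightarrow> hyp3) \<Rightarrow> complex \<Rightarrow> real \<Rightarrow> bool" where
  "moves g b r \<longleftrightarrow> r > 0 \<and> (\<forall>x. height (g x) = r * height x / (dist (Rep_hyp3 x) (b, 0))\<^sup>2)"

lemma moves_above: "moves g b r \<Longrightarrow> t > 0 \<Longrightarrow> height (g (mk b t)) = r / t"
  by (simp add: moves_def dist_Pair_sq) (simp add: power2_eq_square)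

lemma dist_le_arcosh:
  assumes "hyp_cosh x y \<le> c" shows "dist x y \<le> arcosh c"
proof -
  have c: "c \<ge> 1" using assms hyp_cosh_ge_1[of x y] by linarith
  then have "cosh (dist x y) \<le> cosh (arcosh c)" using assms by (simp add: cosh_dist)
  then show ?thesis using c cosh_real_nonneg_le_iff[of "dist x y" "arcosh c"] arcosh_nonneg_real[of c] by simp
qed

text \<open>Low points of a half-circle of large radius are horizontally close to its ends.\<close>

lemma semi_near_end:
  assumes ne: "e1 \<noteq> e2"
  shows "t \<le> 0 \<Longrightarrow> norm (base (semi e1 e2 t) - e2) \<le> (height (semi e1 e2 t))\<^sup>2 / (norm (e1 - e2) / 2)"
    "t \<ge> 0 \<Longrightarrow> norm (base (semi e1 e2 t) - e1) \<le> (height (semi e1 e2 t))\<^sup>2 / (norm (e1 - e2) / 2)"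
proof -
  define R where "R = norm (e1 - e2) / 2"
  have R: "R > 0" using ne by (simp add: R_def)
  have hz: "height (semi e1 e2 t) = R / cosh t" by (simp add: semi_coords[OF ne] R_def)
  have b: "\<bar>tanh t\<bar> \<le> 1" using tanh_real_bounds[of t] by (simp add: abs_le_iff)
  have "1 - \<bar>tanh t\<bar> \<le> (1 - \<bar>tanh t\<bar>) * (1 + \<bar>tanh t\<bar>)" using b by (intro mult_le_cancel_left1[THEN iffD2]) auto
  also have "\<dots> = 1 - (tanh t)\<^sup>2" by (simp add: algebra_simps power2_eq_square flip: abs_mult)
  also have "\<dots> = (height (semi e1 e2 t))\<^sup>2 / R\<^sup>2" using R unfolding hz tanh_cosh_sq by (simp add: power_divide)
  finally have "(1 - \<bar>tanh t\<bar>) * R \<le> (height (semi e1 e2 t))\<^sup>2 / R\<^sup>2 * R" using R by (intro mult_right_mono) auto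
  also have "\<dots> = (height (semi e1 e2 t))\<^sup>2 / R" using R by (simp add: power2_eq_square)
  finally have half: "(1 - \<bar>tanh t\<bar>) * R \<le> (height (semi e1 e2 t))\<^sup>2 / R" .
  {
    assume t: "t \<le> 0"
    have "base (semi e1 e2 t) - e2 = (1 + tanh t) *\<^sub>R ((e1 - e2) /\<^sub>R 2)"
      unfolding semi_coords[OF ne] by (simp add: complex_eq_iff field_simps)
    then have "norm (base (semi e1 e2 t) - e2) = \<bar>1 + tanh t\<bar> * R" by (simp add: R_def)
    also have "\<bar>1 + tanh t\<bar> = 1 - \<bar>tanh t\<bar>" using b t by (simp add: abs_of_nonpos)
    finally show "norm (base (semi e1 e2 t) - e2) \<le> (height (semi e1 e2 t))\<^sup>2 / (norm (e1 - e2) / 2)"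
      using half unfolding R_def by simp
  next
    assume t: "t \<ge> 0"
    have "base (semi e1 e2 t) - e1 = (tanh t - 1) *\<^sub>R ((e1 - e2) /\<^sub>R 2)"
      unfolding semi_coords[OF ne] by (simp add: complex_eq_iff field_simps)
    then have "norm (base (semi e1 e2 t) - e1) = \<bar>tanh t - 1\<bar> * R" by (simp add: R_def)
    also have "\<bar>tanh t - 1\<bar> = 1 - \<bar>tanh t\<bar>" using b t by (simp add: abs_of_nonneg)
    finally show "norm (base (semi e1 e2 t) - e1) \<le> (height (semi e1 e2 t))\<^sup>2 / (norm (e1 - e2) / 2)"
      using half unfolding R_def by simp
  }
qed

text \<open>
  A discrete torsion-free group of isometries, discreteness being expressed by the finiteness
  of the set of elements that move a given point a bounded distance.
\<close>

locale kleinian_group =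
  fixes \<Gamma> :: "(hyp3 \<Rightarrow> hyp3) set"
  assumes isom: "g \<in> \<Gamma> \<Longrightarrow> hyp_isometry g"
    and id_in: "id \<in> \<Gamma>"
    and comp_in: "f \<in> \<Gamma> \<Longrightarrow> g \<in> \<Gamma> \<Longrightarrow> f \<circ> g \<in> \<Gamma>"
    and inverse_in: "g \<in> \<Gamma> \<Longrightarrow> \<exists>h\<in>\<Gamma>. g \<circ> h = id \<and> h \<circ> g = id"
    and torsion_free: "g \<in> \<Gamma> \<Longrightarrow> g ^^ n = id \<Longrightarrow> n > 0 \<Longrightarrow> g = id"
    and proper: "finite {g \<in> \<Gamma>. dist (g x) x \<le> R}"
begin

lemma funpow_in: "g \<in> \<Gamma> \<Longrightarrow> g ^^ n \<in> \<Gamma>"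
  by (induction n) (auto simp: id_in comp_in)

text \<open>The powers of an element fixing a point are finitely many.\<close>

lemma free:
  assumes g: "g \<in> \<Gamma>" "g x = x"
  shows "g = id"
proof -
  have fix_n: "(g ^^ n) x = x" for n by (induction n) (use g in auto)
  have "range (\<lambda>n. g ^^ n) \<subseteq> {h \<in> \<Gamma>. dist (h x) x \<le> 0}" using funpow_in g fix_n by auto
  then have "finite (range (\<lambda>n. g ^^ n))" using proper finite_subset by blast
  then have "\<not> inj (\<lambda>n. g ^^ n)" using finite_imageD infinite_UNIV_nat by blast
  then obtain i j where "g ^^ i = g ^^ j" "i \<noteq> j" by (auto simp: inj_def)
  then obtain i j where ij: "g ^^ i = g ^^ j" "i < j" by (metis linorder_neqE_nat)
  have inj: "inj (g ^^ i)" using isom[OF g(1)] by (simp add: hyp_isometry_def bij_is_inj inj_fn)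
  have "g ^^ (j - i) = id"
  proof
    fix y
    have "(g ^^ i) ((g ^^ (j - i)) y) = (g ^^ i) y"
      using ij by (metis comp_apply funpow_add le_add_diff_inverse less_imp_le)
    then show "(g ^^ (j - i)) y = id y" using inj by (simp add: inj_eq)
  qed
  then show ?thesis using torsion_free[OF g(1)] ij(2) by simp
qed

end

text \<open>
  The horoball above height 1 projects to an embedded horocusp. As an element that does not
  preserve it acts on heights like an inversion, embeddedness takes the stronger form that
  points at height \<open>t\<close> are mapped to height at most \<open>1 / t\<close>.
\<close>

locale cusp_at_infinity = kleinian_group +
  assumes dichotomy: "g \<in> \<Gamma> \<Longrightarrow> (\<forall>x. height (g x) = height x) \<or> (\<forall>x. height x * height (g x) \<le> 1)"
begin

definition parabolics :: "(hyp3 \<Rightarrow> hyp3) set" where "parabolics = {g \<in> \<Gamma>. \<forall>x. height (g x) = height x}"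

lemma parabolics_sub: "g \<in> parabolics \<Longrightarrow> g \<in> \<Gamma>" and parabolics_height: "g \<in> parabolics \<Longrightarrow> height (g x) = height x"
  by (simp_all add: parabolics_def)

lemma parabolics_comp: "f \<in> parabolics \<Longrightarrow> g \<in> parabolics \<Longrightarrow> f \<circ> g \<in> parabolics"
  by (simp add: parabolics_def comp_in)

lemma parabolics_inverse: "g \<in> parabolics \<Longrightarrow> h \<in> \<Gamma> \<Longrightarrow> g \<circ> h = id \<Longrightarrow> h \<in> parabolics"
  unfolding parabolics_def by (simp add: fun_eq_iff) metis

lemma lift_shadow: "q \<in> parabolics \<Longrightarrow> q x = lift (shadow q) x"
  using height_preserving_isometry(1) isom parabolics_sub parabolics_height by blast

lemma base_parabolic: "q \<in> parabolics \<Longrightarrow> base (q x) = shadow q (base x)"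
  using lift_shadow[of q x] by simp

sublocale cusp: plane_group "shadow ` parabolics"
proof
  fix f z w assume "f \<in> shadow ` parabolics"
  then show "dist (f z) (f w) = dist z w"
    using height_preserving_isometry(2) isom parabolics_sub parabolics_height by blast
next
  have "id \<in> parabolics" by (simp add: parabolics_def id_in)
  moreover have "shadow id = id" by (simp add: shadow_def fun_eq_iff)
  ultimately show "id \<in> shadow ` parabolics" by force
next
  fix f g assume "f \<in> shadow ` parabolics" "g \<in> shadow ` parabolics"
  then obtain p q where pq: "p \<in> parabolics" "q \<in> parabolics" "f = shadow p" "g = shadow q" by auto
  then have "f \<circ> g = shadow (p \<circ> q)" using shadow_comp isom parabolics_sub parabolics_height by metis
  then show "f \<circ> g \<in> shadow ` parabolics" using parabolics_comp pq by blast
next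
  fix f assume "f \<in> shadow ` parabolics"
  then obtain p where p: "p \<in> parabolics" "f = shadow p" by auto
  obtain q where q: "q \<in> \<Gamma>" "p \<circ> q = id" "q \<circ> p = id" using inverse_in parabolics_sub p by blast
  have qP: "q \<in> parabolics" using parabolics_inverse p q by blast
  have "shadow id = id" by (simp add: shadow_def fun_eq_iff)
  then have "f \<circ> shadow q = id" "shadow q \<circ> f = id"
    using shadow_comp[OF isom[OF parabolics_sub[OF p(1)]] parabolics_height[OF p(1)] parabolics_height[OF qP]]
      shadow_comp[OF isom[OF parabolics_sub[OF qP]] parabolics_height[OF qP] parabolics_height[OF p(1)]] q p by simp_all
  then show "\<exists>g\<in>shadow ` parabolics. f \<circ> g = id \<and> g \<circ> f = id" using qP by blast
next
  fix f z assume "f \<in> shadow ` parabolics" and fz: "f z = z"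
  then obtain p where p: "p \<in> parabolics" "f = shadow p" by auto
  have "p (mk z 1) = mk z 1" using lift_shadow[OF p(1)] p(2) fz by (simp add: lift_def)
  then have "p = id" using free parabolics_sub p by blast
  then show "f = id" using p by (simp add: shadow_def fun_eq_iff)
next
  fix z R
  have "{f \<in> shadow ` parabolics. dist (f z) z \<le> R} \<subseteq> shadow ` {g \<in> \<Gamma>. dist (g (mk z 1)) (mk z 1) \<le> arcosh (1 + R\<^sup>2 / 2)}"
  proof
    fix f assume "f \<in> {f \<in> shadow ` parabolics. dist (f z) z \<le> R}"
    then obtain p where p: "p \<in> parabolics" "f = shadow p" "dist (f z) z \<le> R" by auto
    have pm: "p (mk z 1) = mk (f z) 1" using lift_shadow[OF p(1)] p(2) by (simp add: lift_def)
    have "(dist (f z) z)\<^sup>2 \<le> R\<^sup>2" using p(3) by (intro power_mono) auto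
    then have "hyp_cosh (mk (f z) 1) (mk z 1) \<le> 1 + R\<^sup>2 / 2"
      by (simp add: hyp_cosh_def dist_Pair_sq dist_norm)
    then have "dist (p (mk z 1)) (mk z 1) \<le> arcosh (1 + R\<^sup>2 / 2)"
      unfolding pm by (rule dist_le_arcosh)
    then show "f \<in> shadow ` {g \<in> \<Gamma>. dist (g (mk z 1)) (mk z 1) \<le> arcosh (1 + R\<^sup>2 / 2)}"
      using p parabolics_sub by blast
  qed
  then show "finite {f \<in> shadow ` parabolics. dist (f z) z \<le> R}"
    by (rule finite_subset) (use proper in blast)
qed

lemma nonparabolic_bound: "g \<in> \<Gamma> \<Longrightarrow> g \<notin> parabolics \<Longrightarrow> height x * height (g x) \<le> 1"
  using dichotomy by (auto simp: parabolics_def)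

lemma moves_exists:
  assumes "g \<in> \<Gamma>" "g \<notin> parabolics"
  obtains b r where "moves g b r"
  using isom[OF assms(1)]
proof (cases rule: hyp_isometry_height_cases)
  case (affine l)
  have "height (mk 0 (1 + 1 / l)) * height (g (mk 0 (1 + 1 / l))) \<le> 1" using nonparabolic_bound[OF assms] .
  moreover have "1 + 1 / l > 0" using affine(1) by (simp add: add_pos_pos)
  ultimately have "(1 + 1 / l) * (l * (1 + 1 / l)) \<le> 1" by (simp add: affine(2))
  moreover have "(1 + 1 / l) * (l * (1 + 1 / l)) = (l + 1) * (1 + 1 / l)" using affine(1) by (simp add: field_simps)
  moreover have "(l + 1) * (1 + 1 / l) > 1 * 1" using affine(1) by (intro mult_strict_mono) auto
  ultimately show ?thesis by simp
next
  case (inversive b r)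
  then show ?thesis using that[of b r] by (simp add: moves_def)
qed

lemma moves_le_1:
  assumes "g \<in> \<Gamma>" "g \<notin> parabolics" "moves g b r"
  shows "r \<le> 1"
  using nonparabolic_bound[OF assms(1,2), of "mk b 1"] assms(3) by (simp add: moves_def dist_Pair_sq)

lemma moves_not_parabolic: "moves g b r \<Longrightarrow> g \<notin> parabolics"
proof
  assume m: "moves g b r" and g: "g \<in> parabolics"
  have "height (g (mk b t)) = r / t" if "t > 0" for t
    using moves_above[OF m that] .
  from this[of 1] this[of 2] show False using parabolics_height[OF g] by simp
qed

lemma moves_comp_left: "q \<in> parabolics \<Longrightarrow> moves g b r \<Longrightarrow> moves (q \<circ> g) b r"
  by (simp add: moves_def parabolics_height)

lemma moves_comp_right:
  assumes "q \<in> parabolics" "q' \<in> parabolics" "q \<circ> q' = id" "moves g b r"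
  shows "moves (g \<circ> q') (shadow q b) r"
proof -
  have "dist (Rep_hyp3 (q' x)) (b, 0) = dist (Rep_hyp3 x) (shadow q b, 0)" for x
  proof -
    have "shadow q (base (q' x)) = base x" using base_parabolic[OF assms(1)] assms(3) by (metis comp_apply id_apply)
    moreover have "dist (shadow q (base (q' x))) (shadow q b) = dist (base (q' x)) b"
      using assms(1) by (intro cusp.isom) auto
    ultimately have "norm (base (q' x) - b) = norm (base x - shadow q b)" by (simp add: dist_norm)
    then have "(dist (Rep_hyp3 (q' x)) (b, 0))\<^sup>2 = (dist (Rep_hyp3 x) (shadow q b, 0))\<^sup>2"
      unfolding dist_Rep_sq parabolics_height[OF assms(2)] by simp
    then show ?thesis by simp
  qed
  then show ?thesis using assms(4) by (simp add: moves_def parabolics_height[OF assms(2)])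
qed

lemma moves_inverse:
  assumes g: "g \<in> \<Gamma>" "moves g b r" and g': "g \<circ> g' = id"
  obtains a where "moves g' a r"
proof -
  have r: "r > 0" and h: "height (g x) = r * height x / (dist (Rep_hyp3 x) (b, 0))\<^sup>2" for x
    using g(2) by (auto simp: moves_def)
  obtain F a where "\<And>x. Rep_hyp3 (g x) = F (Rep_hyp3 x)"
    "\<And>p. p \<noteq> (b, 0) \<Longrightarrow> dist (F p) (a, 0) = r / dist p (b, 0)"
    using inversive_extension[OF isom[OF g(1)] r h] by metis
  then have "height (g' y) = r * height y / (dist (Rep_hyp3 y) (a, 0))\<^sup>2" for y
    using inverse_height[of g F b a r g' y] h r g' by (simp add: fun_eq_iff)
  then show thesis using r by (intro that[of a]) (simp add: moves_def)
qed

text \<open>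
  The two horoballs \<open>g\<^sup>-\<^sup>1 H\<close> and \<open>k\<^sup>-\<^sup>1 H\<close>, where \<open>H\<close> is the horoball above height 1, are Euclidean
  balls of diameters \<open>r\<close> and \<open>s\<close> resting on \<open>b\<close> and \<open>c\<close>. Unless they coincide they are disjoint,
  and this bounds the distance of \<open>b\<close> from \<open>c\<close> below.
\<close>

lemma poles_apart:
  assumes g: "g \<in> \<Gamma>" "moves g b r" and k: "k \<in> \<Gamma>" "moves k c s"
    and g': "g' \<in> \<Gamma>" "g' \<circ> g = id" and kg: "k \<circ> g' \<notin> parabolics"
  shows "r * s \<le> (dist b c)\<^sup>2"
proof (rule field_le_epsilon)
  fix e :: real assume e: "e > 0"
  define t where "t = sqrt e"
  have t: "t > 0" "t\<^sup>2 = e" using e by (simp_all add: t_def)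
  define x where "x = mk b t"
  have rs: "r > 0" "s > 0" using g k by (auto simp: moves_def)
  have e0: "height (g x) * height ((k \<circ> g') (g x)) \<le> 1"
    by (rule nonparabolic_bound[OF comp_in[OF k(1) g'(1)] kg])
  have e1: "(k \<circ> g') (g x) = k x" using g'(2) by (simp add: fun_eq_iff)
  have e2: "height (g x) = r / t" using moves_above[OF g(2) t(1)] by (simp add: x_def)
  have e3: "height (k x) = s * t / ((dist b c)\<^sup>2 + e)"
    using k(2) t unfolding moves_def x_def by (simp add: dist_Pair_sq dist_norm[of b c])
  have "r / t * (s * t / ((dist b c)\<^sup>2 + e)) \<le> 1" using e0 unfolding e1 e2 e3 .
  moreover have "r / t * (s * t / ((dist b c)\<^sup>2 + e)) = r * s / ((dist b c)\<^sup>2 + e)" using t by simp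
  moreover have "(dist b c)\<^sup>2 + e > 0" using e by (simp add: add_nonneg_pos)
  ultimately show "r * s \<le> (dist b c)\<^sup>2 + e" by (simp add: field_simps)
qed

text \<open>
  An element of the cusp groups at two different points fixes the geodesic joining them.
\<close>

lemma conjugate_parabolic_imp_id:
  assumes h: "h \<in> \<Gamma>" "h \<notin> parabolics" and h': "h' \<in> \<Gamma>" "h' \<circ> h = id" "h \<circ> h' = id"
    and q: "q \<in> parabolics" "h' \<circ> q \<circ> h \<in> parabolics"
  shows "q = id"
proof -
  have "h' \<notin> parabolics" using parabolics_inverse[of h' h] h h' by blast
  then obtain a r where a: "moves h' a r" using moves_exists h' by blast
  \<comment> \<open>The motion preserves heights and also heights seen from the point \<open>a\<close>, so it fixes \<open>a\<close>.\<close>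
  define y where "y = mk a 1"
  have hy: "h (h' y) = y" using h'(3) by (metis comp_apply id_apply)
  have "height (h' (q (h (h' y)))) = height (h' y)" using parabolics_height[OF q(2), of "h' y"] by simp
  then have "height (h' (q y)) = height (h' y)" unfolding hy .
  then have "r / (dist (Rep_hyp3 (q y)) (a, 0))\<^sup>2 = r"
    using a by (simp add: moves_def parabolics_height[OF q(1)] y_def dist_Pair_sq)
  moreover have "r > 0" using a by (simp add: moves_def)
  ultimately have "(dist (Rep_hyp3 (q y)) (a, 0))\<^sup>2 = 1" by (simp add: field_simps)
  then have "base (q y) = a" unfolding dist_Rep_sq by (simp add: parabolics_height[OF q(1)] y_def)
  then have "q y = y" by (intro hyp3_eqI) (simp_all add: y_def parabolics_height[OF q(1)])
  then show ?thesis using free parabolics_sub q by blast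
qed

text \<open>
  If the square of \<open>k\<close> fixes infinity then, commuting with \<open>k\<close>, it also fixes the image of
  infinity under \<open>k\<close>.
\<close>

lemma square_not_parabolic:
  assumes "k \<in> \<Gamma>" "k \<notin> parabolics"
  shows "k \<circ> k \<notin> parabolics"
proof
  assume kk: "k \<circ> k \<in> parabolics"
  obtain k' where k': "k' \<in> \<Gamma>" "k \<circ> k' = id" "k' \<circ> k = id" using inverse_in assms by blast
  have "k' \<circ> (k \<circ> k) \<circ> k = k \<circ> k" using k'(3) by (metis comp_assoc id_comp)
  then have "k \<circ> k = id" using conjugate_parabolic_imp_id[OF assms k'(1,3,2) kk] kk by simp
  then have "k ^^ 2 = id" by (simp add: numeral_2_eq_2)
  then have "k = id" using torsion_free[OF assms(1)] by simp
  then show False using assms by (simp add: parabolics_def id_in)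
qed

text \<open>
  The vertical geodesic below infinity ending at the pole of \<open>g\<close> joins two lifts of the
  cusp. An element of the cusp group carrying the pole of \<open>g\<close> to that of its inverse would give
  rise to an element exchanging the ends of such a geodesic, so its square fixes both.
\<close>

lemma poles_inequivalent:
  assumes g: "g \<in> \<Gamma>" "moves g b r" and g': "g' \<in> \<Gamma>" "g \<circ> g' = id" "g' \<circ> g = id" "moves g' a s"
    and f: "f \<in> shadow ` parabolics"
  shows "f b \<noteq> a"
proof
  assume fb: "f b = a"
  obtain q where q: "q \<in> parabolics" "f = shadow q" using f by auto
  obtain q' where q': "q' \<in> \<Gamma>" "q \<circ> q' = id" "q' \<circ> q = id" using inverse_in parabolics_sub q by blast
  have q'P: "q' \<in> parabolics" using parabolics_inverse q q' by blast
  have m: "moves (g \<circ> q') a r" using moves_comp_right[OF q(1) q'P q'(2) g(2)] fb q(2) by simp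
  have "r > 0" "s > 0" using g g' by (auto simp: moves_def)
  then have "\<not> s * r \<le> (dist a a)\<^sup>2" by (simp add: mult_pos_pos not_le)
  then have in_P: "(g \<circ> q') \<circ> g \<in> parabolics"
    using poles_apart[OF g'(1,4) comp_in[OF g(1) q'(1)] m g(1) g'(2)] by blast
  define k where "k = q' \<circ> g"
  have k: "k \<in> \<Gamma>" unfolding k_def by (intro comp_in q' g)
  have "k \<circ> k = q' \<circ> ((g \<circ> q') \<circ> g)" by (simp add: k_def comp_assoc)
  then have "k \<circ> k \<in> parabolics" using parabolics_comp[OF q'P in_P] by simp
  then have kP: "k \<in> parabolics" using square_not_parabolic[OF k] by blast
  have "q \<circ> k = g" unfolding k_def using q'(2) by (metis comp_assoc id_comp)
  then have "g \<in> parabolics" using parabolics_comp[OF q(1) kP] by simp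
  then show False using moves_not_parabolic g(2) by blast
qed

text \<open>
  A point near the top of the horoball resting on \<open>b\<close> which \<open>k\<close> does not move far down lies near
  the top of the horoball resting on the pole of \<open>k\<close> as well. The two horoballs then coincide.
\<close>

lemma near_pole_imp_coset:
  assumes g: "g \<in> \<Gamma>" "moves g b r" and r: "r \<ge> 19/20" and g': "g' \<in> \<Gamma>" "g' \<circ> g = id"
    and k: "k \<in> \<Gamma>" "k \<notin> parabolics"
    and x: "height x \<ge> 9/10" "height (k x) \<ge> 9/10" and near: "dist (base x) b \<le> 1/10"
  shows "k \<circ> g' \<in> parabolics"
proof (rule ccontr)
  assume kg: "k \<circ> g' \<notin> parabolics"
  obtain c s where c: "moves k c s" using moves_exists k by blast
  have le: "r * s \<le> (dist b c)\<^sup>2" by (rule poles_apart[OF g k(1) c g' kg])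
  define t t' where "t = height x" and "t' = height (k x)"
  have t: "t \<ge> 9/10" "t' \<ge> 9/10" "t * t' \<le> 1" using x nonparabolic_bound[OF k] by (simp_all add: t_def t'_def)
  define n where "n = (norm (base x - c))\<^sup>2"
  have s: "0 < s" "s \<le> 1" using c moves_le_1[OF k c] by (auto simp: moves_def)
  have nt: "n + t\<^sup>2 > 0" using t by (simp add: n_def add_nonneg_pos)
  have "t' = s * t / (n + t\<^sup>2)"
    using c by (simp add: moves_def t_def t'_def dist_Rep_sq n_def)
  then have eq: "t' * (n + t\<^sup>2) = s * t" using nt by simp
  have "t' * n \<ge> 0" using t by (simp add: n_def)
  then have "t * t' * t \<le> s * t" using eq by (simp add: power2_eq_square algebra_simps)
  then have "t * t' \<le> s" using t by (intro mult_right_le_imp_le[of "t * t'" t s]) auto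
  moreover have "9/10 * (9/10) \<le> t * t'" using t by (intro mult_mono) auto
  ultimately have s81: "s \<ge> 81/100" by simp
  have "t * (9/10) \<le> t * t'" using t by (intro mult_left_mono) auto
  then have t1: "t \<le> 10/9" using t by linarith
  have "t' * n \<le> t - t' * t\<^sup>2"
    using eq s t mult_right_mono[of s 1 t] by (simp add: algebra_simps)
  also have "\<dots> = t * (1 - t' * t)" by (simp add: power2_eq_square algebra_simps)
  also have "\<dots> \<le> (10/9) * (1 - 81/100)" using t t1 \<open>9/10 * (9/10) \<le> t * t'\<close> by (intro mult_mono) (auto simp: mult.commute)
  finally have "t' * n \<le> 19/90" by simp
  moreover have "9/10 * n \<le> t' * n" using t by (intro mult_right_mono) (auto simp: n_def)
  ultimately have "n \<le> 1/4" by simp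
  then have "(norm (base x - c))\<^sup>2 \<le> (1/2)\<^sup>2" unfolding n_def by (simp add: power_divide)
  then have "norm (base x - c) \<le> 1/2" by (rule power2_le_imp_le) simp
  then have "dist b c \<le> 6/10"
    using dist_triangle[of b c "base x"] near by (simp add: dist_norm norm_minus_commute)
  then have "(dist b c)\<^sup>2 \<le> (6/10)\<^sup>2" by (intro power_mono) auto
  moreover have "19/20 * (81/100) \<le> r * s" using r s81 by (intro mult_mono) auto
  ultimately show False using le by (simp add: power2_eq_square)
qed

text \<open>
  Consider the axis of a long-range element \<open>h\<close> and a fundamental arc of it, running up from the
  horoball at \<open>b\<close> and down to the one at \<open>a\<close>. An element of the cusp group meeting the arc with
  itself preserves heights and would fold its shadow. Any other element exchanges heights above and
  below 1, so it can only match the two ends of the arc, and then it is \<open>h\<close> or its inverse.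
\<close>

lemma arc_embedded:
  assumes h: "h \<in> \<Gamma>" "moves h b r" and h': "h' \<in> \<Gamma>" "h \<circ> h' = id" "h' \<circ> h = id" "moves h' a r"
    and r: "r \<ge> 19/20" and l: "l > 0" "\<And>t. h (semi e1 e2 t) = semi e1 e2 (t + l)"
    and e: "dist e1 a \<le> 1/100" "dist e2 b \<le> 1/100" and R: "norm (e1 - e2) \<ge> 200"
    and unf: "cusp.unfolded e1 e2"
    and low: "\<And>t. t0 \<le> t \<Longrightarrow> t \<le> t0 + l \<Longrightarrow> height (semi e1 e2 t) \<ge> 9/10"
    and t: "t \<in> {t0..<t0 + l}" "t' \<in> {t0..<t0 + l}" and k: "k \<in> \<Gamma>" "k (semi e1 e2 t) = semi e1 e2 t'"
  shows "t = t'"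
proof -
  have ne: "e1 \<noteq> e2" using R by auto
  have inj: "s = s'" if "semi e1 e2 s = semi e1 e2 s'" for s s'
    using geodesic_line_semi[OF ne] that unfolding geodesic_line_def by (metis abs_eq_0 dist_self eq_iff_diff_eq_0)
  show ?thesis
  proof (cases "k \<in> parabolics")
    case True
    have "height (semi e1 e2 t) = height (semi e1 e2 t')" using parabolics_height[OF True, of "semi e1 e2 t"] k(2) by simp
    then have "cosh t = cosh t'" using ne by (simp add: semi_coords[OF ne] field_simps)
    then have "cosh \<bar>t\<bar> = cosh \<bar>t'\<bar>" by simp
    then have "\<bar>t\<bar> = \<bar>t'\<bar>" by (metis abs_ge_zero arcosh_cosh_real)
    then consider "t = t'" | "t' = - t" by linarith
    then show ?thesis
    proof cases
      case 2
      have "shadow k (base (semi e1 e2 t)) = base (semi e1 e2 t')" using base_parabolic[OF True, of "semi e1 e2 t"] k(2) by simp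
      then have "shadow k ((e1 + e2) /\<^sub>R 2 + tanh t *\<^sub>R ((e1 - e2) /\<^sub>R 2)) = (e1 + e2) /\<^sub>R 2 - tanh t *\<^sub>R ((e1 - e2) /\<^sub>R 2)"
        unfolding semi_coords[OF ne] 2 by simp
      moreover have "\<bar>tanh t\<bar> \<le> 1" using tanh_real_bounds[of t] by (simp add: abs_le_iff)
      moreover have "shadow k \<in> shadow ` parabolics" using True by blast
      ultimately have "shadow k = id" using unf unfolding cusp.unfolded_def by blast
      then have "k x = x" for x using lift_shadow[OF True, of x] by (simp add: lift_def)
      then show ?thesis using inj k(2) by metis
    qed
  next
    case kP: False
    obtain k' where k': "k' \<in> \<Gamma>" "k \<circ> k' = id" "k' \<circ> k = id" using inverse_in k by blast
    have k'P: "k' \<notin> parabolics" using parabolics_inverse[of k' k] k k' kP by blast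
    define x y where "x = semi e1 e2 t" and "y = semi e1 e2 t'"
    have kx: "k x = y" using k by (simp add: x_def y_def)
    have k'y: "k' y = x" using k'(3) kx by (metis comp_apply id_apply)
    have hx: "height x \<ge> 9/10" "height y \<ge> 9/10" unfolding x_def y_def using t low[of t] low[of t'] by auto
    have "height x * height y \<le> 1" using nonparabolic_bound[OF k(1) kP, of x] kx by simp
    moreover have "height x * (9/10) \<le> height x * height y" by (rule mult_left_mono) (use hx in auto)
    moreover have "9/10 * height y \<le> height x * height y" by (rule mult_right_mono) (use hx in auto)
    ultimately have up: "height x \<le> 10/9" "height y \<le> 10/9" by linarith+
    have near: "dist (base z) b \<le> 1/10 \<or> dist (base z) a \<le> 1/10" if z: "z = semi e1 e2 s" "height z \<le> 10/9" for z s
    proof -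
      have "(height z)\<^sup>2 / (norm (e1 - e2) / 2) \<le> (10/9)\<^sup>2 / 100"
        using z(2) R by (intro frac_le power_mono) (auto simp: less_imp_le)
      then have s: "(height z)\<^sup>2 / (norm (e1 - e2) / 2) \<le> 2/100" by (simp add: power2_eq_square)
      show ?thesis
      proof (cases "s \<ge> 0")
        case True
        then have "norm (base z - e1) \<le> 2/100" using semi_near_end(2)[OF ne True] s unfolding z by linarith
        then show ?thesis using e(1) dist_triangle[of "base z" a e1] by (simp add: dist_norm)
      next
        case False
        then have "norm (base z - e2) \<le> 2/100" using semi_near_end(1)[OF ne, of s] s unfolding z by linarith
        then show ?thesis using e(2) dist_triangle[of "base z" b e2] by (simp add: dist_norm)
      qed
    qed
    have hb: "m \<circ> h' \<in> parabolics" if "m \<in> \<Gamma>" "m \<notin> parabolics" "height z \<ge> 9/10" "height (m z) \<ge> 9/10" "dist (base z) b \<le> 1/10" for m z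
      using near_pole_imp_coset[OF h r h'(1,3)] that by blast
    have ha: "m \<circ> h \<in> parabolics" if "m \<in> \<Gamma>" "m \<notin> parabolics" "height z \<ge> 9/10" "height (m z) \<ge> 9/10" "dist (base z) a \<le> 1/10" for m z
      using near_pole_imp_coset[OF h'(1,4) r h(1) h'(2)] that by blast
    have hP: "h \<notin> parabolics" "h' \<notin> parabolics" using moves_not_parabolic h h' by auto
    have inv: "m' \<in> parabolics" if "m \<in> parabolics" "m \<circ> m' = id" "m' \<in> \<Gamma>" for m m' using parabolics_inverse that by blast
    have cc: "k' (k z) = z" "k (k' z) = z" "h (h' z) = z" "h' (h z) = z" for z
      using k' h' by (metis comp_apply id_apply)+
    \<comment> \<open>If both ends are of the same kind then \<open>k \<circ> k\<close> belongs to the cusp group.\<close>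
    have kk: "k \<circ> k \<notin> parabolics" by (rule square_not_parabolic[OF k(1) kP])
    consider "dist (base x) b \<le> 1/10" "dist (base y) b \<le> 1/10" | "dist (base x) a \<le> 1/10" "dist (base y) a \<le> 1/10"
      | "dist (base x) b \<le> 1/10" "dist (base y) a \<le> 1/10" | "dist (base x) a \<le> 1/10" "dist (base y) b \<le> 1/10"
      using near[OF x_def up(1)] near[OF y_def up(2)] by blast
    then show ?thesis
    proof cases
      case 1
      have "k \<circ> h' \<in> parabolics" using hb[OF k(1) kP hx(1) _ 1(1)] hx kx by simp
      moreover have "h \<circ> k \<in> parabolics"
      proof (rule inv)
        show "k' \<circ> h' \<in> parabolics" using hb[OF k'(1) k'P hx(2) _ 1(2)] hx k'y by simp
      qed (auto simp: fun_eq_iff cc comp_in h k)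
      ultimately have "(k \<circ> h') \<circ> (h \<circ> k) \<in> parabolics" by (rule parabolics_comp)
      moreover have "(k \<circ> h') \<circ> (h \<circ> k) = k \<circ> k" by (simp add: fun_eq_iff cc)
      ultimately show ?thesis using kk by simp
    next
      case 2
      have "k \<circ> h \<in> parabolics" using ha[OF k(1) kP hx(1) _ 2(1)] hx kx by simp
      moreover have "h' \<circ> k \<in> parabolics"
      proof (rule inv)
        show "k' \<circ> h \<in> parabolics" using ha[OF k'(1) k'P hx(2) _ 2(2)] hx k'y by simp
      qed (auto simp: fun_eq_iff cc comp_in h' k)
      ultimately have "(k \<circ> h) \<circ> (h' \<circ> k) \<in> parabolics" by (rule parabolics_comp)
      moreover have "(k \<circ> h) \<circ> (h' \<circ> k) = k \<circ> k" by (simp add: fun_eq_iff cc)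
      ultimately show ?thesis using kk by simp
    next
      case 3
      have q: "k \<circ> h' \<in> parabolics" using hb[OF k(1) kP hx(1) _ 3(1)] hx kx by simp
      have "h' \<circ> k \<in> parabolics"
      proof (rule inv)
        show "k' \<circ> h \<in> parabolics" using ha[OF k'(1) k'P hx(2) _ 3(2)] hx k'y by simp
      qed (auto simp: fun_eq_iff cc comp_in h' k)
      moreover have "h' \<circ> (k \<circ> h') \<circ> h = h' \<circ> k" by (simp add: fun_eq_iff cc)
      ultimately have "k \<circ> h' = id" using conjugate_parabolic_imp_id[OF h(1) hP(1) h'(1,3,2) q] by simp
      then have "k z = h z" for z using cc(4)[of z] by (metis comp_apply id_apply)
      then have "semi e1 e2 t' = semi e1 e2 (t + l)" using k(2) l(2) by metis
      then have "t' = t + l" by (rule inj)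
      then show ?thesis using t by auto
    next
      case 4
      have q: "k \<circ> h \<in> parabolics" using ha[OF k(1) kP hx(1) _ 4(1)] hx kx by simp
      have "h \<circ> k \<in> parabolics"
      proof (rule inv)
        show "k' \<circ> h' \<in> parabolics" using hb[OF k'(1) k'P hx(2) _ 4(2)] hx k'y by simp
      qed (auto simp: fun_eq_iff cc comp_in h k)
      moreover have "h \<circ> (k \<circ> h) \<circ> h' = h \<circ> k" by (simp add: fun_eq_iff cc)
      ultimately have "k \<circ> h = id" using conjugate_parabolic_imp_id[OF h'(1) hP(2) h(1) h'(2,3) q] by simp
      then have "k (h z) = z" for z by (metis comp_apply id_apply)
      from this[of "semi e1 e2 (t - l)"] have "semi e1 e2 t' = semi e1 e2 (t - l)" using k(2) l(2)[of "t - l"] by simp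
      then have "t' = t - l" by (rule inj)
      then show ?thesis using t by auto
    qed
  qed
qed

end

lemma periodic_int:
  fixes c :: "real \<Rightarrow> 'a"
  assumes "\<And>t. c (t + l) = c t"
  shows "c (t + of_int n * l) = c t"
proof -
  have nat: "c (s + of_nat m * l) = c s" for s m
  proof (induction m)
    case (Suc m)
    have "c (s + of_nat (Suc m) * l) = c ((s + of_nat m * l) + l)" by (simp add: algebra_simps)
    then show ?case using assms Suc by simp
  qed simp
  show ?thesis
  proof (cases "n \<ge> 0")
    case True
    then show ?thesis using nat[of t "nat n"] by simp
  next
    case False
    then show ?thesis using nat[of "t + of_int n * l" "nat (- n)"] by simp
  qed
qed

text \<open>
  Families of geodesics are told apart by how far they reach up into the cusp.
\<close>

lemma infinite_if_unbounded:
  fixes S :: "hyp3 set set set"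
  assumes "\<And>B. \<exists>L\<in>S. (\<exists>Q\<in>L. \<exists>y\<in>Q. height y > B) \<and> (\<exists>B'. \<forall>Q\<in>L. \<forall>y\<in>Q. height y \<le> B')"
  shows "infinite S"
proof
  assume "finite S"
  define D where "D = {L \<in> S. \<exists>B'. \<forall>Q\<in>L. \<forall>y\<in>Q. height y \<le> B'}"
  have D: "finite D" using \<open>finite S\<close> by (simp add: D_def)
  have "\<forall>L\<in>D. \<exists>B'. \<forall>Q\<in>L. \<forall>y\<in>Q. height y \<le> B'" by (simp add: D_def)
  from bchoice[OF this] obtain f where "\<forall>L\<in>D. \<forall>Q\<in>L. \<forall>y\<in>Q. height y \<le> f L" by blast
  then have f: "\<And>L Q y. L \<in> D \<Longrightarrow> Q \<in> L \<Longrightarrow> y \<in> Q \<Longrightarrow> height y \<le> f L" by blast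
  obtain L Q y where L: "L \<in> S" "Q \<in> L" "y \<in> Q" "height y > Max (f ` D)" "\<exists>B'. \<forall>Q\<in>L. \<forall>y\<in>Q. height y \<le> B'"
    using assms[of "Max (f ` D)"] by blast
  then have "L \<in> D" by (simp add: D_def)
  then have "f L \<le> Max (f ` D)" using D by simp
  then show False using f[OF \<open>L \<in> D\<close> L(2,3)] L(4) by linarith
qed

context cusp_at_infinity
begin

lemma orbit_proj_image:
  assumes "h \<in> \<Gamma>" shows "orbit_proj \<Gamma> (h x) = orbit_proj \<Gamma> x"
proof
  show "orbit_proj \<Gamma> (h x) \<subseteq> orbit_proj \<Gamma> x"
    unfolding orbit_proj_def
  proof
    fix y assume "y \<in> (\<lambda>g. g (h x)) ` \<Gamma>"
    then obtain g where "g \<in> \<Gamma>" "y = (g \<circ> h) x" by auto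
    then show "y \<in> (\<lambda>g. g x) ` \<Gamma>" using comp_in[OF _ assms] by (intro image_eqI[of _ _ "g \<circ> h"])
  qed
  obtain h' where h': "h' \<in> \<Gamma>" "h' \<circ> h = id" using inverse_in[OF assms] by blast
  show "orbit_proj \<Gamma> x \<subseteq> orbit_proj \<Gamma> (h x)" unfolding orbit_proj_def
  proof
    fix y assume "y \<in> (\<lambda>g. g x) ` \<Gamma>"
    then obtain g where g: "g \<in> \<Gamma>" "y = g x" by auto
    have "(g \<circ> h') (h x) = y" using fun_cong[OF h'(2), of x] g by simp
    then show "y \<in> (\<lambda>g. g (h x)) ` \<Gamma>" using comp_in[OF g(1) h'(1)] by (intro image_eqI[of _ _ "g \<circ> h'"]) auto
  qed
qed

lemma orbit_proj_eqD:
  assumes "orbit_proj \<Gamma> x = orbit_proj \<Gamma> y"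
  obtains k where "k \<in> \<Gamma>" "k x = y"
proof -
  have "y \<in> orbit_proj \<Gamma> y" unfolding orbit_proj_def using id_in by (intro image_eqI[of _ _ id]) auto
  then have "y \<in> orbit_proj \<Gamma> x" using assms by simp
  then show thesis using that by (auto simp: orbit_proj_def)
qed

text \<open>
  Let \<open>g\<close> send \<open>b\<close> to infinity and infinity to \<open>a\<close>. For an element \<open>q\<close> of the cusp group carrying
  \<open>a\<close> far away, the axis of \<open>q \<circ> g\<close> is a large half-circle with ends close to \<open>b\<close> and to the
  image of \<open>a\<close>. The fundamental arc starting at height 1 ends close to height \<open>r\<close> and stays above
  the lower of the two, as heights along a half-circle are unimodal.
\<close>

lemma high_simple_closed_geodesic:
  assumes rank: "cusp.rank2" and g: "g \<in> \<Gamma>" "moves g b r" and r: "r \<ge> 19/20"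
  shows "\<exists>L\<in>simple_closed_geodesics \<Gamma>. (\<exists>Q\<in>L. \<exists>y\<in>Q. height y > B) \<and> (\<exists>B'. \<forall>Q\<in>L. \<forall>y\<in>Q. height y \<le> B')"
proof -
  obtain g' where g': "g' \<in> \<Gamma>" "g \<circ> g' = id" "g' \<circ> g = id" using inverse_in[OF g(1)] by blast
  obtain a where a: "moves g' a r" using moves_inverse[OF g g'(2)] .
  have "cusp.stably_unfoldable a b"
    by (rule cusp.rank2_stably_unfoldable[OF rank poles_inequivalent[OF g g' a]])
  then obtain \<delta> where \<delta>: "\<delta> > 0" and unf: "\<And>N. \<exists>p\<in>shadow ` parabolics. dist (p a) b > N \<and>
     (\<forall>e1 e2. dist e1 (p a) \<le> \<delta> \<longrightarrow> dist e2 b \<le> \<delta> \<longrightarrow> cusp.unfolded e1 e2)"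
    unfolding cusp.stably_unfoldable_def by blast
  define N where "N = max (max 500 (2 * B + 2)) (1 + 1 / \<delta>)"
  obtain q where q: "q \<in> parabolics" "dist (shadow q a) b > N"
    "\<And>e1 e2. dist e1 (shadow q a) \<le> \<delta> \<Longrightarrow> dist e2 b \<le> \<delta> \<Longrightarrow> cusp.unfolded e1 e2"
    using unf[of N] by blast
  obtain q' where q': "q' \<in> \<Gamma>" "q \<circ> q' = id" "q' \<circ> q = id" using inverse_in parabolics_sub q by blast
  have q'P: "q' \<in> parabolics" using parabolics_inverse q q' by blast
  define a' h h' where "a' = shadow q a" and "h = q \<circ> g" and "h' = g' \<circ> q'"
  have h: "h \<in> \<Gamma>" "moves h b r" unfolding h_def
    using comp_in parabolics_sub q(1) g moves_comp_left by blast+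
  have h': "h' \<in> \<Gamma>" "moves h' a' r" unfolding h'_def a'_def
    using comp_in q' g' moves_comp_right[OF q(1) q'P q'(2) a] by blast+
  have c1: "g (g' z) = z" "g' (g z) = z" "q (q' z) = z" "q' (q z) = z" for z
    using g' q' by (metis comp_apply id_apply)+
  have hh': "h \<circ> h' = id" "h' \<circ> h = id" unfolding h_def h'_def by (simp_all add: fun_eq_iff c1)
  define d where "d = dist a' b"
  have d: "d > 500" "d > 2 * B + 2" "d > 1 + 1 / \<delta>" using q(2) by (auto simp: d_def a'_def N_def)
  have r0: "0 < r" "r \<le> 1" using h moves_le_1[OF h(1) moves_not_parabolic[OF h(2)] h(2)] by (auto simp: moves_def)
  have mh: "height (h x) = r * height x / (dist (Rep_hyp3 x) (b, 0))\<^sup>2"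
    "height (h' x) = r * height x / (dist (Rep_hyp3 x) (a', 0))\<^sup>2" for x
    using h(2) h'(2) by (auto simp: moves_def)
  have hh: "h (h' x) = x" for x using hh'(1) by (metis comp_apply id_apply)
  have d4: "dist a' b \<ge> 4" using d by (simp add: d_def)
  obtain e1 e2 l where e: "dist e1 a' \<le> 1 / (d - 1)" "dist e2 b \<le> 1 / (d - 1)"
    and l: "l > 0" "\<And>t. h (semi e1 e2 t) = semi e1 e2 (t + l)"
    using axis_exists[OF isom[OF h(1)] isom[OF h'(1)] hh r0 d4 mh] unfolding d_def by blast
  have "1 / (d - 1) \<le> 1 / 100" using d by (intro divide_left_mono) auto
  then have e': "dist e1 a' \<le> 1/100" "dist e2 b \<le> 1/100" using e by linarith+
  have "1 / (d - 1) \<le> \<delta>" using d \<delta> by (simp add: field_simps)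
  then have uf: "cusp.unfolded e1 e2" using e q(3) by (intro q(3)) (auto simp: a'_def)
  define R where "R = norm (e1 - e2) / 2"
  have "d \<le> dist e1 e2 + 2/100"
    using e' dist_triangle[of a' b e1] dist_triangle[of e1 b e2] unfolding d_def by (simp add: dist_commute)
  then have R: "norm (e1 - e2) \<ge> 200" "R \<ge> 100" "R > B" using d by (simp_all add: R_def dist_norm)
  have ne: "e1 \<noteq> e2" using R by auto
  have hs: "height (semi e1 e2 t) = R / cosh t" for t by (simp add: semi_coords[OF ne] R_def)
  \<comment> \<open>The arc starts at height 1 over a point close to \<open>b\<close>.\<close>
  define t0 where "t0 = - arcosh R"
  have t0: "t0 \<le> 0" "cosh t0 = R" using R by (simp_all add: t0_def)
  have low0: "height (semi e1 e2 t0) = 1" using t0 R by (simp add: hs)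
  have low1: "height (semi e1 e2 (t0 + l)) \<ge> 9/10"
  proof -
    have "norm (base (semi e1 e2 t0) - e2) \<le> 1 / R" using semi_near_end(1)[OF ne t0(1)] low0 by (simp add: R_def)
    also have "\<dots> \<le> 1/100" using R by (intro divide_left_mono) auto
    finally have "norm (base (semi e1 e2 t0) - b) \<le> 2/100"
      using e'(2) dist_triangle[of "base (semi e1 e2 t0)" b e2] by (simp add: dist_norm)
    then have "(norm (base (semi e1 e2 t0) - b))\<^sup>2 \<le> (2/100)\<^sup>2" by (intro power_mono) auto
    then have D: "(dist (Rep_hyp3 (semi e1 e2 t0)) (b, 0))\<^sup>2 \<le> 101/100"
      unfolding dist_Rep_sq low0 by (simp add: power2_eq_square)
    have "9/10 \<le> (19/20) / (101/100 :: real)" by simp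
    also have "\<dots> \<le> r * 1 / (dist (Rep_hyp3 (semi e1 e2 t0)) (b, 0))\<^sup>2"
      using r D by (intro frac_le) auto
    also have "\<dots> = height (semi e1 e2 (t0 + l))" using mh(1)[of "semi e1 e2 t0"] l(2) low0 by simp
    finally show ?thesis .
  qed
  have low: "height (semi e1 e2 t) \<ge> 9/10" if t: "t0 \<le> t" "t \<le> t0 + l" for t
  proof (cases "t \<le> 0")
    case True
    have "cosh \<bar>t\<bar> \<le> cosh \<bar>t0\<bar>" using t True by (subst cosh_real_nonneg_le_iff) auto
    then have "R / cosh t0 \<le> R / cosh t" using R by (intro divide_left_mono) auto
    moreover have "R / cosh t0 = 1" using low0 unfolding hs .
    ultimately show ?thesis unfolding hs by linarith
  next
    case False
    have "cosh t \<le> cosh (t0 + l)" using t False by (subst cosh_real_nonneg_le_iff) auto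
    then have "R / cosh (t0 + l) \<le> R / cosh t" using R by (intro divide_left_mono) auto
    then show ?thesis using low1 unfolding hs by linarith
  qed
  define \<gamma> where "\<gamma> t = semi e1 e2 (t0 + t)" for t
  define c where "c = orbit_proj \<Gamma> \<circ> \<gamma>"
  have per: "c (t + l) = c t" for t
    using orbit_proj_image[OF h(1), of "\<gamma> t"] l(2)[of "t0 + t"] by (simp add: c_def \<gamma>_def add.assoc)
  have "geodesic_line \<gamma>" using geodesic_line_semi[OF ne] by (simp add: geodesic_line_def \<gamma>_def)
  then have "closed_geodesic \<Gamma> c l" unfolding closed_geodesic_def using l(1) per c_def by blast
  moreover have "inj_on c {0..<l}"
  proof (rule inj_onI)
    fix s t assume s: "s \<in> {0..<l}" and t: "t \<in> {0..<l}" and eq: "c s = c t"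
    obtain k where "k \<in> \<Gamma>" "k (\<gamma> s) = \<gamma> t" using orbit_proj_eqD eq by (metis c_def comp_apply)
    then have "t0 + s = t0 + t"
      using arc_embedded[OF h h'(1) hh' h'(2) r l e' R(1) uf low, of t0 "t0 + s" "t0 + t" k] s t
      by (simp add: \<gamma>_def)
    then show "s = t" by simp
  qed
  ultimately have "range c \<in> simple_closed_geodesics \<Gamma>" unfolding simple_closed_geodesics_def by blast
  moreover have "\<gamma> (- t0) \<in> c (- t0)" "height (\<gamma> (- t0)) = R"
    using id_in by (auto simp: c_def orbit_proj_def \<gamma>_def hs image_iff intro!: bexI[of _ id])
  then have "\<exists>Q\<in>range c. \<exists>y\<in>Q. height y > B" using R by blast
  moreover have "height y \<le> max R (10/9)" if y: "Q \<in> range c" "y \<in> Q" for Q y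
  proof -
    obtain t where t: "Q = c t" using y by auto
    define s where "s = t + of_int (- \<lfloor>t / l\<rfloor>) * l"
    have s: "0 \<le> s" "s < l"
      using l(1) floor_divide_lower[of l t] floor_divide_upper[of l t] by (auto simp: s_def algebra_simps)
    have "c s = c t" unfolding s_def by (rule periodic_int) (rule per)
    then have "Q = c s" using t by simp
    then obtain k where k: "k \<in> \<Gamma>" "y = k (\<gamma> s)" using y by (auto simp: c_def orbit_proj_def)
    have lo: "height (\<gamma> s) \<ge> 9/10" unfolding \<gamma>_def using s by (intro low) auto
    show ?thesis
    proof (cases "k \<in> parabolics")
      case True
      have "R / cosh (t0 + s) \<le> R / 1" using R cosh_real_ge_1 by (intro divide_left_mono) auto
      then show ?thesis using parabolics_height[OF True, of "\<gamma> s"] k by (simp add: \<gamma>_def hs)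
    next
      case False
      have "height (\<gamma> s) * height y \<le> 1" using nonparabolic_bound[OF k(1) False] k(2) by simp
      moreover have "9/10 * height y \<le> height (\<gamma> s) * height y" using lo by (intro mult_right_mono) (auto simp: less_imp_le)
      ultimately have "height y \<le> 10/9" by linarith
      then show ?thesis by simp
    qed
  qed
  ultimately show ?thesis by blast
qed

theorem infinite_simple_closed_geodesics:
  assumes "cusp.rank2" "g \<in> \<Gamma>" "moves g b r" "r \<ge> 19/20"
  shows "infinite (simple_closed_geodesics \<Gamma>)"
  by (rule infinite_if_unbounded) (rule high_simple_closed_geodesic[OF assms])

end

section \<open>From the hypotheses on the manifold to a cusp at infinity\<close>

subsection \<open>The metric topology of the upper half-space\<close>

lemma Rep_dist_sq: "(dist (Rep_hyp3 x) (Rep_hyp3 y))\<^sup>2 = 2 * height x * height y * (hyp_cosh x y - 1)"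
  by (simp add: hyp_cosh_def)

lemma height_le_hyp_cosh: "height y \<le> 2 * hyp_cosh x y * height x"
proof -
  have "(height y)\<^sup>2 \<le> (norm (base x - base y))\<^sup>2 + (height x)\<^sup>2 + (height y)\<^sup>2" by simp
  also have "\<dots> = hyp_cosh x y * (2 * height x * height y)" by (simp add: hyp_cosh_alt)
  finally have "height y * height y \<le> (2 * hyp_cosh x y * height x) * height y" by (simp add: power2_eq_square)
  then show ?thesis by simp
qed

lemma continuous_on_Rep_hyp3: "continuous_on UNIV Rep_hyp3"
  unfolding continuous_on_iff
proof (intro ballI allI impI)
  fix x :: hyp3 and e :: real assume e: "e > 0"
  define m where "m = min 1 (e\<^sup>2 / (8 * (height x)\<^sup>2))"
  have m: "m > 0" "m \<le> 1" "8 * (height x)\<^sup>2 * m \<le> e\<^sup>2"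
  proof -
    show "m > 0" "m \<le> 1" using e by (simp_all add: m_def)
    have "m \<le> e\<^sup>2 / (8 * (height x)\<^sup>2)" by (simp add: m_def)
    then show "8 * (height x)\<^sup>2 * m \<le> e\<^sup>2" by (simp add: field_simps)
  qed
  show "\<exists>d>0. \<forall>y\<in>UNIV. dist y x < d \<longrightarrow> dist (Rep_hyp3 y) (Rep_hyp3 x) < e"
  proof (intro exI[of _ "arcosh (1 + m)"] conjI ballI impI)
    show "arcosh (1 + m) > 0" using m(1) by simp
    fix y assume d: "dist y x < arcosh (1 + m)"
    have "cosh (dist y x) < cosh (arcosh (1 + m))" using d m(1) by (subst cosh_real_nonneg_less_iff) auto
    then have c: "hyp_cosh x y < 1 + m" using m(1) by (simp add: cosh_dist hyp_cosh_commute)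
    have "height y \<le> 2 * hyp_cosh x y * height x" by (rule height_le_hyp_cosh)
    also have "\<dots> \<le> 2 * 2 * height x" using c m by (intro mult_right_mono mult_left_mono) (auto simp: less_imp_le)
    finally have "2 * height x * height y * (hyp_cosh x y - 1) \<le> 2 * height x * (4 * height x) * (hyp_cosh x y - 1)"
      by (intro mult_right_mono mult_left_mono) (auto simp: less_imp_le)
    also have "\<dots> < 2 * height x * (4 * height x) * m" using c by (intro mult_strict_left_mono) auto
    also have "\<dots> \<le> e\<^sup>2" using m(3) by (simp add: power2_eq_square)
    finally have "(dist (Rep_hyp3 y) (Rep_hyp3 x))\<^sup>2 < e\<^sup>2"
      by (simp add: Rep_dist_sq[symmetric] dist_commute)
    then show "dist (Rep_hyp3 y) (Rep_hyp3 x) < e" using e by (intro power_less_imp_less_base[of _ 2 e]) auto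
  qed
qed

lemma continuous_on_Abs_hyp3: "continuous_on {p. snd p > 0} Abs_hyp3"
  unfolding continuous_on_iff
proof (intro ballI allI impI)
  fix p :: "complex \<times> real" and e :: real assume p: "p \<in> {p. snd p > 0}" and e: "e > 0"
  define t where "t = snd p"
  have t: "t > 0" using p by (simp add: t_def)
  have ce: "cosh e > 1" using e cosh_real_strict_mono[of 0 e] by simp
  define d where "d = min (t / 2) (t * sqrt ((cosh e - 1) / 2))"
  have d: "d > 0" "d \<le> t / 2" "d \<le> t * sqrt ((cosh e - 1) / 2)" using t ce by (auto simp: d_def)
  show "\<exists>d>0. \<forall>q\<in>{p. snd p > 0}. dist q p < d \<longrightarrow> dist (Abs_hyp3 q) (Abs_hyp3 p) < e"
  proof (intro exI[of _ d] conjI ballI impI d(1))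
    fix q :: "complex \<times> real" assume q: "q \<in> {p. snd p > 0}" and qd: "dist q p < d"
    define s where "s = snd q"
    have "dist s t < d" using dist_snd_le[of q p] qd by (simp add: s_def t_def)
    then have "\<bar>s - t\<bar> < t / 2" using d(2) by (simp add: dist_real_def)
    then have s: "s > t / 2" "s > 0" using t by linarith+
    have R: "Rep_hyp3 (Abs_hyp3 q) = q" "Rep_hyp3 (Abs_hyp3 p) = p" using p q by (auto intro!: Abs_hyp3_inverse)
    have "(dist q p)\<^sup>2 < d\<^sup>2" using qd by (intro power_strict_mono) auto
    also have "\<dots> \<le> (t * sqrt ((cosh e - 1) / 2))\<^sup>2" using d by (intro power_mono) auto
    also have "\<dots> = t\<^sup>2 * ((cosh e - 1) / 2)" using ce by (simp add: power_mult_distrib)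
    finally have "(dist q p)\<^sup>2 < (t / 2) * t * (cosh e - 1)" by (simp add: power2_eq_square)
    also have "\<dots> \<le> (2 * s * t) * (cosh e - 1)" using s t ce by (intro mult_right_mono) auto
    finally have "(dist q p)\<^sup>2 / (2 * s * t) < cosh e - 1" using s t by (simp add: pos_divide_less_eq mult.commute)
    then have "cosh (dist (Abs_hyp3 q) (Abs_hyp3 p)) < cosh e"
      unfolding cosh_dist hyp_cosh_def height_def R by (simp add: s_def t_def)
    then show "dist (Abs_hyp3 q) (Abs_hyp3 p) < e"
      using e by (subst (asm) cosh_real_nonneg_less_iff) auto
  qed
qed

lemma compact_cball_hyp3: "compact (cball (x :: hyp3) R)"
proof -
  define C where "C = cosh (max R 0)"
  have C: "C \<ge> 1" unfolding C_def by (rule cosh_real_ge_1)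
  define K where "K = cball (base x) (2 * C * height x) \<times> {height x / (2 * C)..2 * C * height x}"
  have K: "compact K" unfolding K_def by (intro compact_Times) auto
  have pos: "height x / (2 * C) > 0" using C by simp
  have Kp: "K \<subseteq> {p. snd p > 0}" using pos by (auto simp: K_def)
  have "compact (Abs_hyp3 ` K)"
    by (rule compact_continuous_image[OF continuous_on_subset[OF continuous_on_Abs_hyp3 Kp] K])
  moreover have "cball x R \<subseteq> Abs_hyp3 ` K"
  proof
    fix y assume y: "y \<in> cball x R"
    have "cosh (dist x y) \<le> C" unfolding C_def using y by (subst cosh_real_nonneg_le_iff) auto
    then have c: "hyp_cosh x y \<le> C" "hyp_cosh y x \<le> C" by (simp_all add: cosh_dist hyp_cosh_commute)
    have "2 * hyp_cosh x y * height x \<le> 2 * C * height x" "2 * hyp_cosh y x * height y \<le> 2 * C * height y"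
      using c by (auto intro!: mult_right_mono simp: less_imp_le)
    then have h: "height y \<le> 2 * C * height x" "height x \<le> 2 * C * height y"
      using height_le_hyp_cosh[of y x] height_le_hyp_cosh[of x y] by linarith+
    have "(norm (base x - base y))\<^sup>2 \<le> (norm (base x - base y))\<^sup>2 + (height x)\<^sup>2 + (height y)\<^sup>2" by simp
    also have "\<dots> = hyp_cosh x y * (2 * height x * height y)" by (simp add: hyp_cosh_alt)
    also have "\<dots> \<le> C * (2 * height x * (2 * C * height x))"
      using c h C by (intro mult_mono) (auto simp: less_imp_le)
    also have "\<dots> = (2 * C * height x)\<^sup>2" by (simp add: power2_eq_square)
    finally have "norm (base x - base y) \<le> 2 * C * height x"
      using C by (intro power2_le_imp_le[of "norm (base x - base y)"]) (auto simp: less_imp_le)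
    then have "Rep_hyp3 y \<in> K"
      using h C unfolding K_def mem_Times_iff height_def[symmetric] by (simp add: dist_norm field_simps)
    then show "y \<in> Abs_hyp3 ` K" by (metis Rep_hyp3_inverse image_eqI)
  qed
  ultimately show ?thesis using closed_Int_compact[OF closed_cball[of x R]] by (metis inf.absorb1)
qed

subsection \<open>Discreteness\<close>

lemma group_facts:
  assumes "hyperbolic_3_manifold \<Gamma>"
  shows "g \<in> \<Gamma> \<Longrightarrow> hyp_isometry g" "id \<in> \<Gamma>" "f \<in> \<Gamma> \<Longrightarrow> g \<in> \<Gamma> \<Longrightarrow> f \<circ> g \<in> \<Gamma>"
    "g \<in> \<Gamma> \<Longrightarrow> \<exists>h\<in>\<Gamma>. g \<circ> h = id \<and> h \<circ> g = id"
    "g \<in> \<Gamma> \<Longrightarrow> g ^^ n = id \<Longrightarrow> n > 0 \<Longrightarrow> g = id"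
proof -
  have sub: "subgroup \<Gamma> hyp_isom" using assms by (simp add: hyperbolic_3_manifold_def)
  have ops: "x \<otimes>\<^bsub>hyp_isom\<^esub> y = x \<circ> y" "\<one>\<^bsub>hyp_isom\<^esub> = id" for x y by (simp_all add: hyp_isom_def)
  have car: "g \<in> carrier hyp_isom" if "g \<in> \<Gamma>" for g using subgroup.mem_carrier[OF sub that] .
  show "g \<in> \<Gamma> \<Longrightarrow> hyp_isometry g" using car[of g] by (simp add: hyp_isom_def hyp_isometry_def)
  show "id \<in> \<Gamma>" using subgroup.one_closed[OF sub] by (simp add: ops)
  show "f \<in> \<Gamma> \<Longrightarrow> g \<in> \<Gamma> \<Longrightarrow> f \<circ> g \<in> \<Gamma>" using subgroup.m_closed[OF sub, of f g] by (simp add: ops)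
  show "g \<in> \<Gamma> \<Longrightarrow> \<exists>h\<in>\<Gamma>. g \<circ> h = id \<and> h \<circ> g = id"
    using subgroup.m_inv_closed[OF sub, of g] group.l_inv[OF group_hyp_isom car[of g]] group.r_inv[OF group_hyp_isom car[of g]]
    by (auto simp: ops)
  have pow: "g [^]\<^bsub>hyp_isom\<^esub> m = g ^^ m" for m :: nat
    using group.is_monoid[OF group_hyp_isom]
    by (induction m) (simp_all add: monoid.nat_pow_0 monoid.nat_pow_Suc ops funpow_Suc_right del: funpow.simps(2))
  have "\<forall>g\<in>\<Gamma>. \<forall>n>0. g [^]\<^bsub>hyp_isom\<^esub> (n :: nat) = \<one>\<^bsub>hyp_isom\<^esub> \<longrightarrow> g = \<one>\<^bsub>hyp_isom\<^esub>"
    using assms unfolding hyperbolic_3_manifold_def by (elim conjE)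
  from this[rule_format, of g n] show "g \<in> \<Gamma> \<Longrightarrow> g ^^ n = id \<Longrightarrow> n > 0 \<Longrightarrow> g = id"
    unfolding pow ops(2) .
qed

text \<open>
  Near the identity in the topology of pointwise convergence means moving finitely many points by
  little. As balls are totally bounded, infinitely many elements moving a point a
  bounded distance would contain two that differ by little at these finitely many points.
\<close>

lemma kleinian_if_manifold:
  assumes M: "hyperbolic_3_manifold \<Gamma>"
  shows "kleinian_group \<Gamma>"
proof
  note g = group_facts[OF M]
  show "g \<in> \<Gamma> \<Longrightarrow> hyp_isometry g" for g by (rule g(1))
  show "id \<in> \<Gamma>" by (rule g(2))
  show "f \<in> \<Gamma> \<Longrightarrow> g \<in> \<Gamma> \<Longrightarrow> f \<circ> g \<in> \<Gamma>" for f g by (rule g(3))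
  show "g \<in> \<Gamma> \<Longrightarrow> \<exists>h\<in>\<Gamma>. g \<circ> h = id \<and> h \<circ> g = id" for g by (rule g(4))
  show "g \<in> \<Gamma> \<Longrightarrow> g ^^ n = id \<Longrightarrow> n > 0 \<Longrightarrow> g = id" for g n by (rule g(5))
  fix x0 R
  have isoD: "dist (f y) (f z) = dist y z" if "f \<in> \<Gamma>" for f y z using g(1)[OF that] by (simp add: hyp_isometry_def)
  have "discrete \<Gamma>" using M by (simp add: hyperbolic_3_manifold_def)
  then have "id isolated_in \<Gamma>" using g(2) by (rule discreteD)
  then obtain U where U: "open U" "U \<inter> \<Gamma> = {id}" by (auto simp: isolated_in_def)
  have "openin (product_topology (\<lambda>i. euclidean) UNIV) U" using U(1) by (simp add: open_fun_def)
  from product_topology_open_contains_basis[OF this, of id] U(2)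
  obtain V where V: "id \<in> (\<Pi>\<^sub>E i\<in>UNIV. V i)" "\<And>i. open (V i)" "finite {i. V i \<noteq> UNIV}" "(\<Pi>\<^sub>E i\<in>UNIV. V i) \<subseteq> U"
    by auto
  define F where "F = {i. V i \<noteq> UNIV}"
  have "\<exists>e>0. \<forall>y. dist y i < e \<longrightarrow> y \<in> V i" for i
    using V(1,2) by (auto simp: PiE_iff open_dist)
  then obtain e where e: "\<And>i. e i > 0" "\<And>i y. dist y i < e i \<Longrightarrow> y \<in> V i" by metis
  define \<epsilon> where "\<epsilon> = Min (insert 1 (e ` F))"
  have fF: "finite F" using V(3) by (simp add: F_def)
  have \<epsilon>: "\<epsilon> > 0" "\<And>i. i \<in> F \<Longrightarrow> \<epsilon> \<le> e i" using fF e(1) by (auto simp: \<epsilon>_def)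
  have small: "f = id" if f: "f \<in> \<Gamma>" "\<And>i. i \<in> F \<Longrightarrow> dist (f i) i < \<epsilon>" for f
  proof -
    have "f i \<in> V i" for i
    proof (cases "i \<in> F")
      case True
      then show ?thesis using f(2)[OF True] \<epsilon>(2)[OF True] by (intro e(2)) linarith
    qed (simp add: F_def)
    then have "f \<in> U" using V(4) by (auto simp: PiE_iff)
    then show ?thesis using U(2) f(1) by blast
  qed
  define S where "S = {f \<in> \<Gamma>. dist (f x0) x0 \<le> R}"
  have "\<exists>N. finite N \<and> (\<forall>y\<in>cball x0 (dist i x0 + R). \<exists>n\<in>N. dist y n < \<epsilon> / 2)" for i
  proof -
    have "compact (cball x0 (dist i x0 + R))" by (rule compact_cball_hyp3)
    then obtain N where "finite N" "cball x0 (dist i x0 + R) \<subseteq> (\<Union>n\<in>N. ball n (\<epsilon> / 2))"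
      using compact_eq_totally_bounded[of "cball x0 (dist i x0 + R)"] \<epsilon>(1) by (metis half_gt_zero)
    then show ?thesis by (intro exI[of _ N]) (auto simp: subset_iff dist_commute)
  qed
  then obtain N where N: "\<And>i. finite (N i)" "\<And>i y. y \<in> cball x0 (dist i x0 + R) \<Longrightarrow> \<exists>n\<in>N i. dist y n < \<epsilon> / 2" by metis
  have "\<exists>n\<in>N i. dist (f i) n < \<epsilon> / 2" if f: "f \<in> S" for f i
  proof (rule N(2))
    have "dist (f i) x0 \<le> dist (f i) (f x0) + dist (f x0) x0" by (rule dist_triangle)
    then show "f i \<in> cball x0 (dist i x0 + R)" using f isoD by (simp add: S_def dist_commute)
  qed
  then obtain c where c: "\<And>f i. f \<in> S \<Longrightarrow> c f i \<in> N i" "\<And>f i. f \<in> S \<Longrightarrow> dist (f i) (c f i) < \<epsilon> / 2" by metis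
  have "inj_on (\<lambda>f. restrict (c f) F) S"
  proof (rule inj_onI)
    fix f h assume f: "f \<in> S" and h: "h \<in> S" and eq: "restrict (c f) F = restrict (c h) F"
    obtain h' where h': "h' \<in> \<Gamma>" "h \<circ> h' = id" "h' \<circ> h = id" using g(4) h by (auto simp: S_def)
    have "h' \<circ> f = id"
    proof (rule small)
      show "h' \<circ> f \<in> \<Gamma>" using g(3) h' f by (simp add: S_def)
      fix i assume i: "i \<in> F"
      have "c f i = c h i" using fun_cong[OF eq, of i] i by simp
      then have "dist (f i) (h i) < \<epsilon>"
        using c(2)[OF f, of i] c(2)[OF h, of i] dist_triangle_half_r[of "c f i" "f i" \<epsilon> "h i"] by (simp add: dist_commute)
      moreover have "h' (h i) = i" using h'(3) by (metis comp_apply id_apply)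
      ultimately show "dist ((h' \<circ> f) i) i < \<epsilon>" using isoD[OF h'(1), of "f i" "h i"] by simp
    qed
    then show "f = h" using h'(2) by (metis comp_assoc comp_id id_comp)
  qed
  moreover have "(\<lambda>f. restrict (c f) F) ` S \<subseteq> (\<Pi>\<^sub>E i\<in>F. N i)" using c(1) by auto
  moreover have "finite (\<Pi>\<^sub>E i\<in>F. N i)" using fF N(1) by (simp add: finite_PiE)
  ultimately show "finite {g \<in> \<Gamma>. dist (g x0) x0 \<le> R}"
    unfolding S_def by (meson finite_subset finite_imageD)
qed

subsection \<open>Change of coordinates\<close>

definition conj_group :: "(hyp3 \<Rightarrow> hyp3) \<Rightarrow> (hyp3 \<Rightarrow> hyp3) \<Rightarrow> (hyp3 \<Rightarrow> hyp3) set \<Rightarrow> (hyp3 \<Rightarrow> hyp3) set" where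
  "conj_group c c' \<Gamma> = (\<lambda>g. c \<circ> g \<circ> c') ` \<Gamma>"

lemma inj_image: "inj f \<Longrightarrow> inj (\<lambda>A. f ` A)"
  by (rule injI) (simp add: inj_image_eq_iff)

locale coordinate_change =
  fixes c c' :: "hyp3 \<Rightarrow> hyp3"
  assumes c: "hyp_isometry c" and cc' [simp]: "\<And>x. c (c' x) = x" and c'c [simp]: "\<And>x. c' (c x) = x"
begin

lemma c': "hyp_isometry c'"
proof -
  have "c' = inv_into UNIV c" by (rule ext) (metis cc' c hyp_isometry_def bij_is_inj inv_f_f c'c)
  then show ?thesis using hyp_isometry_inv[OF c] by simp
qed

lemma conj_funpow: "(c \<circ> g \<circ> c') ^^ n = c \<circ> g ^^ n \<circ> c'"
  by (induction n) (simp_all add: fun_eq_iff)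

lemma conj_inject: "c \<circ> f \<circ> c' = c \<circ> g \<circ> c' \<longleftrightarrow> f = g"
proof
  assume e: "c \<circ> f \<circ> c' = c \<circ> g \<circ> c'"
  show "f = g"
  proof
    fix x
    have "c (f x) = c (g x)" using fun_cong[OF e, of "c x"] by simp
    then show "f x = g x" by (metis c'c)
  qed
qed simp

lemma kleinian_conj:
  assumes "kleinian_group \<Gamma>"
  shows "kleinian_group (conj_group c c' \<Gamma>)"
proof -
  interpret kleinian_group \<Gamma> by fact
  have dc: "dist (c x) (c y) = dist x y" for x y using c by (simp add: hyp_isometry_def)
  show ?thesis
  proof
    fix g assume "g \<in> conj_group c c' \<Gamma>"
    then obtain f where f: "f \<in> \<Gamma>" "g = c \<circ> f \<circ> c'" by (auto simp: conj_group_def)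
    show "hyp_isometry g" unfolding f(2) by (intro hyp_isometry_comp c c' isom f)
    obtain h where h: "h \<in> \<Gamma>" "f \<circ> h = id" "h \<circ> f = id" using inverse_in f by blast
    then have "f (h x) = x" "h (f x) = x" for x by (metis comp_apply id_apply)+
    then have "g \<circ> (c \<circ> h \<circ> c') = id \<and> (c \<circ> h \<circ> c') \<circ> g = id" unfolding f(2) by (simp add: fun_eq_iff)
    then show "\<exists>h\<in>conj_group c c' \<Gamma>. g \<circ> h = id \<and> h \<circ> g = id" using h(1) unfolding conj_group_def by blast
    show "g = id" if "g ^^ n = id" "n > 0" for n
    proof -
      have "c \<circ> f ^^ n \<circ> c' = c \<circ> id \<circ> c'" using that(1) unfolding f(2) conj_funpow by (simp add: fun_eq_iff)
      then have "f = id" using torsion_free[OF f(1) _ that(2)] unfolding conj_inject by blast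
      then show ?thesis unfolding f(2) by (simp add: fun_eq_iff)
    qed
    fix f' assume "f' \<in> conj_group c c' \<Gamma>"
    then obtain k where k: "k \<in> \<Gamma>" "f' = c \<circ> k \<circ> c'" by (auto simp: conj_group_def)
    have "g \<circ> f' = c \<circ> (f \<circ> k) \<circ> c'" unfolding f k by (simp add: fun_eq_iff)
    then show "g \<circ> f' \<in> conj_group c c' \<Gamma>" using comp_in[OF f(1) k(1)] by (simp add: conj_group_def)
  next
    show "id \<in> conj_group c c' \<Gamma>"
      unfolding conj_group_def using id_in by (intro image_eqI[of _ _ id]) (simp_all add: fun_eq_iff)
  next
    fix x R
    have "{g \<in> conj_group c c' \<Gamma>. dist (g x) x \<le> R} \<subseteq> conj_group c c' {g \<in> \<Gamma>. dist (g (c' x)) (c' x) \<le> R}"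
    proof
      fix g assume g: "g \<in> {g \<in> conj_group c c' \<Gamma>. dist (g x) x \<le> R}"
      then obtain f where f: "f \<in> \<Gamma>" "g = c \<circ> f \<circ> c'" by (auto simp: conj_group_def)
      have "dist (f (c' x)) (c' x) = dist (g x) x" using dc[of "f (c' x)" "c' x"] by (simp add: f)
      then show "g \<in> conj_group c c' {g \<in> \<Gamma>. dist (g (c' x)) (c' x) \<le> R}" using g f by (auto simp: conj_group_def)
    qed
    then show "finite {g \<in> conj_group c c' \<Gamma>. dist (g x) x \<le> R}"
      by (rule finite_subset) (simp add: conj_group_def proper)
  qed
qed

lemma orbit_proj_conj: "orbit_proj (conj_group c c' \<Gamma>) x = c ` orbit_proj \<Gamma> (c' x)"
  unfolding orbit_proj_def conj_group_def image_image by simp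

lemma infinite_geodesics_conj:
  assumes "infinite (simple_closed_geodesics (conj_group c c' \<Gamma>))"
  shows "infinite (simple_closed_geodesics \<Gamma>)"
proof
  assume fin: "finite (simple_closed_geodesics \<Gamma>)"
  define \<Phi> where "\<Phi> L = (\<lambda>Q. c' ` Q) ` L" for L :: "hyp3 set set"
  have "inj c'" by (metis cc' injI)
  have inj: "inj \<Phi>" unfolding \<Phi>_def by (intro inj_image \<open>inj c'\<close>)
  have "\<Phi> ` simple_closed_geodesics (conj_group c c' \<Gamma>) \<subseteq> simple_closed_geodesics \<Gamma>"
  proof
    fix L assume "L \<in> \<Phi> ` simple_closed_geodesics (conj_group c c' \<Gamma>)"
    then obtain d l where d: "L = \<Phi> (range d)" "closed_geodesic (conj_group c c' \<Gamma>) d l" "inj_on d {0..<l}"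
      by (auto simp: simple_closed_geodesics_def)
    then obtain \<gamma> where \<gamma>: "geodesic_line \<gamma>" "d = orbit_proj (conj_group c c' \<Gamma>) \<circ> \<gamma>" "l > 0" "\<And>t. d (t + l) = d t"
      by (auto simp: closed_geodesic_def)
    define e where "e = orbit_proj \<Gamma> \<circ> (c' \<circ> \<gamma>)"
    have e: "e t = c' ` d t" for t
      unfolding e_def \<gamma>(2) comp_apply orbit_proj_conj by (simp add: image_image)
    have "geodesic_line (c' \<circ> \<gamma>)" using \<gamma>(1) c' by (simp add: geodesic_line_def hyp_isometry_def)
    then have "closed_geodesic \<Gamma> e l" unfolding closed_geodesic_def using \<gamma>(3,4) e e_def by auto
    moreover have "inj_on e {0..<l}"
      using d(3) unfolding inj_on_def e inj_image_eq_iff[OF \<open>inj c'\<close>] .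
    moreover have "L = range e" unfolding d(1) \<Phi>_def by (simp add: e image_image)
    ultimately show "L \<in> simple_closed_geodesics \<Gamma>" unfolding simple_closed_geodesics_def by blast
  qed
  then have "finite (\<Phi> ` simple_closed_geodesics (conj_group c c' \<Gamma>))" using fin finite_subset by blast
  then have "finite (simple_closed_geodesics (conj_group c c' \<Gamma>))"
    using inj by (metis finite_imageD inj_on_subset subset_UNIV)
  then show False using assms by simp
qed

end

lemma coordinate_change_hscale: "r > 0 \<Longrightarrow> coordinate_change (hscale r) (hscale (1 / r))"
  by unfold_locales (simp_all add: hyp_isometry_hscale hscale_hscale)

lemma coordinate_change_hinv: "coordinate_change (hinv b) (hinv b)"
  by unfold_locales (simp_all add: hyp_isometry_hinv)

lemma coordinate_change_comp:
  assumes "coordinate_change c c'" "coordinate_change d d'"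
  shows "coordinate_change (c \<circ> d) (d' \<circ> c')"
  using assms by (auto simp: coordinate_change_def hyp_isometry_comp)

text \<open>
  The coordinates are a dilation, preceded by an inversion in the centre of the horoball if that is
  not infinity. If all elements preserve the resulting heights then orbits lie in closed sets
  whose only point at infinity is the centre.
\<close>

lemma horoball_coordinates:
  assumes "horoball H"
  obtains c c' where "coordinate_change c c'" "H = {x. height (c x) > 1}"
    "\<And>\<Gamma>. (\<And>g x. g \<in> \<Gamma> \<Longrightarrow> height (c (g x)) = height (c x)) \<Longrightarrow> elementary \<Gamma>"
  using assms unfolding horoball_def
proof (elim disjE exE conjE)
  fix h :: real assume h: "h > 0" "H = {x. height x > h}"
  show thesis
  proof (rule that[OF coordinate_change_hscale[of "1 / h"]])
    show "1 / h > 0" using h by simp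
    show "H = {x. height (hscale (1 / h) x) > 1}" using h by simp
    fix \<Gamma> assume "\<And>g x. g \<in> \<Gamma> \<Longrightarrow> height (hscale (1 / h) (g x)) = height (hscale (1 / h) x)"
    then have hh: "height (g x) = height x" if "g \<in> \<Gamma>" for g x using h that by simp
    have "limit_set \<Gamma> \<subseteq> {None}"
    proof
      fix \<xi> assume "\<xi> \<in> limit_set \<Gamma>"
      moreover have "\<not> (w, 0) islimpt Rep_hyp3 ` orbit_proj \<Gamma> x" for w x
      proof
        assume lim: "(w, 0) islimpt Rep_hyp3 ` orbit_proj \<Gamma> x"
        define D where "D = {p :: complex \<times> real. snd p = height x}"
        have "Rep_hyp3 ` orbit_proj \<Gamma> x \<subseteq> D" using hh by (auto simp: D_def orbit_proj_def height_def)
        then have "(w, 0) islimpt D" using lim islimpt_subset by blast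
        moreover have "closed D" unfolding D_def by (intro closed_Collect_eq continuous_intros)
        ultimately have "(w, 0) \<in> D" by (metis closed_limpt)
        then show False by (simp add: D_def)
      qed
      ultimately show "\<xi> \<in> {None}" by (auto simp: limit_set_def)
    qed
    then show "elementary \<Gamma>" unfolding elementary_def
      by (metis card_mono card.empty card_insert_if empty_iff finite.emptyI finite_insert finite_subset le_trans one_le_numeral One_nat_def)
  qed
next
  fix z r assume r: "r > 0" "H = {x. dist (Rep_hyp3 x) (z, r) < r}"
  have hc: "height ((hscale (2 * r) \<circ> hinv z) x) = 2 * r * (height x / (dist (Rep_hyp3 x) (z, 0))\<^sup>2)" for x
    using r by (simp add: height_hinv)
  show thesis
  proof (rule that[OF coordinate_change_comp[OF coordinate_change_hscale[of "2 * r"] coordinate_change_hinv[of z]]])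
    show "2 * r > 0" using r by simp
    have "dist (Rep_hyp3 x) (z, r) < r \<longleftrightarrow> 1 < height ((hscale (2 * r) \<circ> hinv z) x)" for x
    proof -
      have "dist (Rep_hyp3 x) (z, r) < r \<longleftrightarrow> (dist (Rep_hyp3 x) (z, r))\<^sup>2 < r\<^sup>2"
        using r power2_less_imp_less[of "dist (Rep_hyp3 x) (z, r)" r]
          power_strict_mono[of "dist (Rep_hyp3 x) (z, r)" r 2] by auto
      also have "\<dots> \<longleftrightarrow> (dist (Rep_hyp3 x) (z, 0))\<^sup>2 < 2 * r * height x"
        unfolding dist_Rep_sq by (simp add: power2_eq_square algebra_simps)
      also have "\<dots> \<longleftrightarrow> 1 < height ((hscale (2 * r) \<circ> hinv z) x)"
        unfolding hc using zero_less_power[OF dist_bdry_pos[of x z], of 2] by (simp add: field_simps)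
      finally show ?thesis .
    qed
    then show "H = {x. height ((hscale (2 * r) \<circ> hinv z) x) > 1}" unfolding r(2) by blast
    fix \<Gamma> assume inv: "\<And>g x. g \<in> \<Gamma> \<Longrightarrow> height ((hscale (2 * r) \<circ> hinv z) (g x)) = height ((hscale (2 * r) \<circ> hinv z) x)"
    then have hh: "height (g x) / (dist (Rep_hyp3 (g x)) (z, 0))\<^sup>2 = height x / (dist (Rep_hyp3 x) (z, 0))\<^sup>2" if "g \<in> \<Gamma>" for g x
      using inv[OF that, of x] r(1) unfolding hc by (simp only: mult_cancel_left) simp
    have orb: "\<exists>\<kappa>>0. Rep_hyp3 ` orbit_proj \<Gamma> x \<subseteq> {p. \<kappa> * (dist p (z, 0))\<^sup>2 = snd p}" for x
    proof (intro exI conjI subsetI)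
      show "height x / (dist (Rep_hyp3 x) (z, 0))\<^sup>2 > 0" by simp
      fix p assume "p \<in> Rep_hyp3 ` orbit_proj \<Gamma> x"
      then obtain g where g: "g \<in> \<Gamma>" "p = Rep_hyp3 (g x)" by (auto simp: orbit_proj_def)
      have "height (g x) / (dist (Rep_hyp3 (g x)) (z, 0))\<^sup>2 * (dist (Rep_hyp3 (g x)) (z, 0))\<^sup>2 = height (g x)"
        by simp
      then have "height x / (dist (Rep_hyp3 x) (z, 0))\<^sup>2 * (dist p (z, 0))\<^sup>2 = height (g x)"
        by (simp only: hh[OF g(1), of x] g(2))
      moreover have "snd p = height (g x)" by (simp add: g(2) height_def)
      ultimately show "p \<in> {p. height x / (dist (Rep_hyp3 x) (z, 0))\<^sup>2 * (dist p (z, 0))\<^sup>2 = snd p}"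
        by simp
    qed
    have "limit_set \<Gamma> \<subseteq> {Some z}"
    proof
      fix \<xi> assume "\<xi> \<in> limit_set \<Gamma>"
      moreover have "w = z" if lim: "(w, 0) islimpt Rep_hyp3 ` orbit_proj \<Gamma> x" for w x
      proof -
        obtain \<kappa> where \<kappa>: "\<kappa> > 0" "Rep_hyp3 ` orbit_proj \<Gamma> x \<subseteq> {p. \<kappa> * (dist p (z, 0))\<^sup>2 = snd p}"
          using orb[of x] by blast
        have "closed {p. \<kappa> * (dist p (z, 0))\<^sup>2 = snd p}" by (intro closed_Collect_eq continuous_intros)
        then have "(w, 0) \<in> {p. \<kappa> * (dist p (z, 0))\<^sup>2 = snd p}"
          using islimpt_subset[OF lim \<kappa>(2)] by (metis closed_limpt)
        then show "w = z" using \<kappa>(1) by simp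
      qed
      moreover have "bounded (Rep_hyp3 ` orbit_proj \<Gamma> x)" for x
      proof -
        obtain \<kappa> where \<kappa>: "\<kappa> > 0" "Rep_hyp3 ` orbit_proj \<Gamma> x \<subseteq> {p. \<kappa> * (dist p (z, 0))\<^sup>2 = snd p}"
          using orb[of x] by blast
        have "{p. \<kappa> * (dist p (z, 0))\<^sup>2 = snd p} \<subseteq> cball (z, 0) (1 / \<kappa>)"
        proof
          fix p :: "complex \<times> real" assume "p \<in> {p. \<kappa> * (dist p (z, 0))\<^sup>2 = snd p}"
          then have "\<kappa> * (dist p (z, 0))\<^sup>2 = snd p" by simp
          also have "\<dots> \<le> dist p (z, 0)" using dist_snd_le[of p "(z, 0)"] by (simp add: dist_real_def)
          finally have "dist p (z, 0) * (\<kappa> * dist p (z, 0)) \<le> dist p (z, 0) * 1" by (simp add: power2_eq_square mult_ac)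
          then have "\<kappa> * dist p (z, 0) \<le> 1 \<or> dist p (z, 0) = 0"
            by (metis mult_le_cancel_left_pos zero_less_dist_iff dist_eq_0_iff)
          then show "p \<in> cball (z, 0) (1 / \<kappa>)" using \<kappa>(1) by (auto simp: dist_commute field_simps)
        qed
        then show ?thesis using \<kappa>(2) bounded_subset[OF bounded_cball] by blast
      qed
      ultimately show "\<xi> \<in> {Some z}" by (auto simp: limit_set_def)
    qed
    then show "elementary \<Gamma>" unfolding elementary_def
      by (metis card_mono card.empty card_insert_if empty_iff finite.emptyI finite_insert finite_subset le_trans one_le_numeral One_nat_def)
  qed
qed

text \<open>
  In these coordinates the elements stabilizing the horoball are those preserving heights, and
  embeddedness of the horocusp bounds the product of the heights of a point and its
  image under any other element.
\<close>

lemma horocusp_coordinates: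
  assumes M: "hyperbolic_3_manifold \<Gamma>" and H: "horocusp \<Gamma> H"
    and co: "coordinate_change c c'" and Hc: "H = {x. height (c x) > 1}"
  shows "cusp_at_infinity (conj_group c c' \<Gamma>)"
    "g \<in> \<Gamma> \<Longrightarrow> g \<in> set_stabilizer \<Gamma> H \<longleftrightarrow> (\<forall>x. height (c (g x)) = height (c x))"
proof -
  interpret coordinate_change c c' by fact
  have kl: "kleinian_group \<Gamma>" by (rule kleinian_if_manifold[OF M])
  interpret kleinian_group \<Gamma> by fact
  have emb: "g ` H = H" if "g \<in> \<Gamma>" "x \<in> H" "g x \<in> H" for g x
    using H that unfolding horocusp_def set_stabilizer_def by blast
  have cases: "(\<forall>x. height (c (g x)) = height (c x)) \<and> g ` H = H \<or>
     (\<forall>x. height (c x) * height (c (g x)) \<le> 1) \<and> g ` H \<noteq> H" if g: "g \<in> \<Gamma>" for g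
  proof -
    define f where "f = c \<circ> g \<circ> c'"
    have fi: "hyp_isometry f" unfolding f_def by (intro hyp_isometry_comp c c' isom g)
    have fc: "c (g x) = f (c x)" for x by (simp add: f_def)
    have gx: "g (c' y) \<in> H \<longleftrightarrow> height (f y) > 1" and xc: "c' y \<in> H \<longleftrightarrow> height y > 1" for y
      by (simp_all add: Hc f_def)
    show ?thesis using fi
    proof (cases rule: hyp_isometry_height_cases)
      case (affine l)
      define y where "y = mk 0 (2 + 2 / l)"
      have hy: "height y = 2 + 2 / l" using affine(1) by (simp add: y_def add_pos_pos)
      have "c' y \<in> H" unfolding xc hy using affine(1) by (simp add: add_pos_pos less_add_same_cancel1 add_strict_increasing)
      moreover have "g (c' y) \<in> H" unfolding gx affine(2) hy using affine(1) by (simp add: distrib_left add_strict_increasing2 less_imp_le)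
      ultimately have gH: "g ` H = H" using emb g by blast
      have l1: "l \<ge> 1"
      proof (rule ccontr)
        assume "\<not> l \<ge> 1"
        then have l: "1 / l > 1" using affine(1) by simp
        define y where "y = mk 0 (1 / l)"
        have "c' y \<in> H" unfolding xc y_def using l affine(1) by simp
        then have "g (c' y) \<in> H" using gH by blast
        then show False unfolding gx affine(2) y_def using affine(1) by simp
      qed
      moreover have "l \<le> 1"
      proof (rule ccontr)
        assume "\<not> l \<le> 1"
        then have l: "l > 1" by simp
        have "c' (mk 0 l) \<in> H" unfolding xc using l by simp
        then obtain x where x: "x \<in> H" "c' (mk 0 l) = g x" using gH by blast
        have "height (c (g x)) = l" unfolding x(2)[symmetric] using l by simp
        then have "l * height (c x) = l" unfolding fc affine(2) .
        then show False using x(1) l by (simp add: Hc)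
      qed
      ultimately have "height (c (g x)) = height (c x)" for x unfolding fc affine(2) by simp
      then show ?thesis using gH by blast
    next
      case (inversive b r)
      have m: "height (f (mk b t)) = r / t" if "t > 0" for t
        using that inversive(2)[of "mk b t"] by (simp add: dist_Pair_sq) (simp add: power2_eq_square)
      have gH: "g ` H \<noteq> H"
      proof
        assume gH: "g ` H = H"
        have "c' (mk b (r + 1)) \<in> H" unfolding xc using inversive(1) by simp
        then have "g (c' (mk b (r + 1))) \<in> H" using gH by blast
        then show False unfolding gx using m[of "r + 1"] inversive(1) by simp
      qed
      have r1: "r \<le> 1"
      proof (rule ccontr)
        assume "\<not> r \<le> 1"
        then obtain t where t: "1 < t" "t < r" using dense[of 1 r] by auto
        have "c' (mk b t) \<in> H" unfolding xc using t by simp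
        moreover have "g (c' (mk b t)) \<in> H" unfolding gx using m[of t] t by simp
        ultimately show False using emb g gH by blast
      qed
      have "height (c x) * height (c (g x)) \<le> 1" for x
      proof -
        define D where "D = (dist (Rep_hyp3 (c x)) (b, 0))\<^sup>2"
        have D: "(height (c x))\<^sup>2 \<le> D" "D > 0" unfolding D_def dist_Rep_sq by (simp_all add: add_nonneg_pos)
        have "height (c x) * height (c (g x)) = r * ((height (c x))\<^sup>2 / D)"
          unfolding fc inversive(2) D_def by (simp add: power2_eq_square)
        also have "\<dots> \<le> 1 * 1" using r1 D inversive(1) by (intro mult_mono) auto
        finally show ?thesis by simp
      qed
      then show ?thesis using gH by blast
    qed
  qed
  show "cusp_at_infinity (conj_group c c' \<Gamma>)"
  proof (intro cusp_at_infinity.intro kleinian_conj[OF kl] cusp_at_infinity_axioms.intro)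
    fix f assume "f \<in> conj_group c c' \<Gamma>"
    then obtain g where g: "g \<in> \<Gamma>" "f = c \<circ> g \<circ> c'" by (auto simp: conj_group_def)
    show "(\<forall>x. height (f x) = height x) \<or> (\<forall>x. height x * height (f x) \<le> 1)"
      using cases[OF g(1)] unfolding g(2) comp_apply by (metis cc')
  qed
  have nb: "\<not> ((\<forall>x. height (c x) * height (c (g x)) \<le> 1) \<and> (\<forall>x. height (c (g x)) = height (c x)))" for g
  proof
    assume a: "(\<forall>x. height (c x) * height (c (g x)) \<le> 1) \<and> (\<forall>x. height (c (g x)) = height (c x))"
    have "height (c (c' (mk 0 2))) * height (c (g (c' (mk 0 2)))) \<le> 1" using a by blast
    moreover have "height (c (g (c' (mk 0 2)))) = height (c (c' (mk 0 2)))" using a by blast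
    ultimately show False by simp
  qed
  then show "g \<in> \<Gamma> \<Longrightarrow> g \<in> set_stabilizer \<Gamma> H \<longleftrightarrow> (\<forall>x. height (c (g x)) = height (c x))"
    using cases[of g] nb[of g] unfolding set_stabilizer_def by blast
qed

text \<open>
  Rescaling, the horoball can be enlarged until it almost touches one of its translates.
\<close>

lemma (in cusp_at_infinity) maximal_cusp:
  assumes "g0 \<in> \<Gamma>" "g0 \<notin> parabolics"
  obtains \<mu> g b r where "\<mu> > 0" "cusp_at_infinity (conj_group (hscale \<mu>) (hscale (1 / \<mu>)) \<Gamma>)"
    "g \<in> conj_group (hscale \<mu>) (hscale (1 / \<mu>)) \<Gamma>" "moves g b r" "r \<ge> 19/20"
proof -
  define S where "S = {r. \<exists>g\<in>\<Gamma>. \<exists>b. moves g b r}"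
  have S1: "0 < r \<and> r \<le> 1" if "r \<in> S" for r
    using that moves_le_1 moves_not_parabolic unfolding S_def by (auto simp: moves_def) blast
  obtain b0 r0 where r0: "moves g0 b0 r0" using moves_exists[OF assms] .
  have rS: "r0 \<in> S" using r0 assms by (auto simp: S_def)
  define s where "s = Sup S"
  have bdd: "bdd_above S" using S1 by (intro bdd_aboveI[of _ 1]) auto
  have up: "r \<le> s" if "r \<in> S" for r unfolding s_def using that bdd by (rule cSup_upper)
  have s: "s > 0" using up[OF rS] S1[OF rS] by linarith
  have "19/20 * s < Sup S" using s by (simp add: s_def)
  then obtain r1 where r1: "r1 \<in> S" "19/20 * s < r1" using less_cSup_iff[of S "19/20 * s"] rS bdd by blast
  then obtain g1 b1 where g1: "g1 \<in> \<Gamma>" "moves g1 b1 r1" by (auto simp: S_def)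
  define \<mu> where "\<mu> = 1 / sqrt s"
  have \<mu>: "\<mu> > 0" "\<mu>\<^sup>2 = 1 / s" using s by (simp_all add: \<mu>_def power_divide)
  interpret co: coordinate_change "hscale \<mu>" "hscale (1 / \<mu>)" by (rule coordinate_change_hscale[OF \<mu>(1)])
  have dm: "height (hscale \<mu> (g (hscale (1 / \<mu>) x))) = \<mu> * height (g (hscale (1 / \<mu>) x))" for g x using \<mu>(1) by simp
  have mv: "moves (hscale \<mu> \<circ> g \<circ> hscale (1 / \<mu>)) (\<mu> *\<^sub>R b) (\<mu>\<^sup>2 * r)" if m: "moves g b r" for g b r
  proof -
    have "dist (Rep_hyp3 x) (\<mu> *\<^sub>R b, 0) = \<mu> * dist (Rep_hyp3 (hscale (1 / \<mu>) x)) (b, 0)" for x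
    proof -
      have "Rep_hyp3 x = \<mu> *\<^sub>R Rep_hyp3 (hscale (1 / \<mu>) x)"
        using \<mu>(1) by (simp add: prod_eq_iff flip: height_def)
      moreover have "(\<mu> *\<^sub>R b, 0::real) = \<mu> *\<^sub>R (b, 0)" by simp
      ultimately show ?thesis using dist_scaleR_both[of \<mu> "Rep_hyp3 (hscale (1 / \<mu>) x)" "(b, 0)"] \<mu>(1) by simp
    qed
    then show ?thesis using m \<mu>(1) by (simp add: moves_def power_mult_distrib power2_eq_square)
  qed
  show thesis
  proof (rule that[OF \<mu>(1)])
    show "cusp_at_infinity (conj_group (hscale \<mu>) (hscale (1 / \<mu>)) \<Gamma>)"
    proof (intro cusp_at_infinity.intro co.kleinian_conj cusp_at_infinity_axioms.intro)
      show "kleinian_group \<Gamma>" by (rule kleinian_group_axioms)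
      fix f assume "f \<in> conj_group (hscale \<mu>) (hscale (1 / \<mu>)) \<Gamma>"
      then obtain g where g: "g \<in> \<Gamma>" "f = hscale \<mu> \<circ> g \<circ> hscale (1 / \<mu>)" by (auto simp: conj_group_def)
      show "(\<forall>x. height (f x) = height x) \<or> (\<forall>x. height x * height (f x) \<le> 1)"
      proof (cases "g \<in> parabolics")
        case True
        then show ?thesis using parabolics_height[OF True] \<mu>(1) by (simp add: g(2))
      next
        case False
        then obtain b r where m: "moves g b r" using moves_exists g(1) by blast
        then have "r \<le> s" using up g(1) by (auto simp: S_def)
        then have r: "\<mu>\<^sup>2 * r \<le> 1" "\<mu>\<^sup>2 * r > 0" using s m by (simp_all add: \<mu>(2) moves_def)
        have mf: "moves f (\<mu> *\<^sub>R b) (\<mu>\<^sup>2 * r)" unfolding g(2) by (rule mv[OF m])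
        have "height x * height (f x) \<le> 1" for x
        proof -
          define D where "D = (dist (Rep_hyp3 x) (\<mu> *\<^sub>R b, 0))\<^sup>2"
          have D: "(height x)\<^sup>2 \<le> D" "D > 0" unfolding D_def dist_Rep_sq by (simp_all add: add_nonneg_pos)
          have "height x * height (f x) = \<mu>\<^sup>2 * r * ((height x)\<^sup>2 / D)"
            using mf unfolding moves_def D_def by (simp add: power2_eq_square)
          also have "\<dots> \<le> 1 * 1" using r D by (intro mult_mono) auto
          finally show ?thesis by simp
        qed
        then show ?thesis by blast
      qed
    qed
    show "hscale \<mu> \<circ> g1 \<circ> hscale (1 / \<mu>) \<in> conj_group (hscale \<mu>) (hscale (1 / \<mu>)) \<Gamma>"
      using g1 by (simp add: conj_group_def)
    show "moves (hscale \<mu> \<circ> g1 \<circ> hscale (1 / \<mu>)) (\<mu> *\<^sub>R b1) (\<mu>\<^sup>2 * r1)" by (rule mv[OF g1(2)])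
    show "\<mu>\<^sup>2 * r1 \<ge> 19/20" using r1 s by (simp add: \<mu>(2) field_simps)
  qed
qed

subsection \<open>Virtually rank-2 cusps\<close>

lemma isometry_frontier:
  assumes k: "hyp_isometry k" "k ` H = H" and x: "x \<in> frontier H"
  shows "k x \<in> frontier H"
  unfolding frontier_straddle
proof (intro allI impI conjI)
  fix e :: real assume e: "e > 0"
  have d: "dist (k x) (k y) = dist x y" for y using k(1) by (simp add: hyp_isometry_def)
  obtain y where "y \<in> H" "dist x y < e" using x e unfolding frontier_straddle by blast
  then show "\<exists>y\<in>H. dist (k x) y < e" using k(2) d by (metis imageI)
  obtain y where y: "y \<notin> H" "dist x y < e" using x e unfolding frontier_straddle by blast
  have "k y \<notin> H"
  proof
    assume "k y \<in> H"
    then have "k y \<in> k ` H" using k(2) by simp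
    then show False using y(1) k(1) by (simp add: hyp_isometry_def bij_is_inj inj_image_mem_iff)
  qed
  then show "\<exists>y. y \<notin> H \<and> dist (k x) y < e" using y(2) d by metis
qed

text \<open>
  Restriction to the horosphere is a homomorphism on the stabilizer of the horoball. Relations
  between two elements that restrict to generators of a subgroup isomorphic to the square of the
  integers are therefore relations between these generators.
\<close>

lemma virtually_rank_2_independent:
  assumes M: "hyperbolic_3_manifold \<Gamma>" and vr: "virtually_rank_2 (cusp_group \<Gamma> H)"
  obtains k1 k2 where "k1 \<in> set_stabilizer \<Gamma> H" "k2 \<in> set_stabilizer \<Gamma> H"
    "\<And>n m. k1 ^^ n = k2 ^^ m \<Longrightarrow> n = 0" "\<And>n m. k1 ^^ n \<circ> k2 ^^ m = id \<Longrightarrow> n = 0" "\<And>m. k2 ^^ m = id \<Longrightarrow> m = 0"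
proof -
  define S where "S = frontier H"
  define St where "St = set_stabilizer \<Gamma> H"
  note gf = group_facts[OF M]
  have St: "k \<in> St \<Longrightarrow> hyp_isometry k \<and> k ` H = H" for k using gf(1) by (simp add: St_def set_stabilizer_def)
  have St_comp: "f \<circ> g \<in> St" if "f \<in> St" "g \<in> St" for f g
    using that gf(3)[of f g] unfolding St_def set_stabilizer_def mem_Collect_eq
    by (simp only: image_comp[symmetric])
  have St_id: "id \<in> St" using gf(2) by (simp add: St_def set_stabilizer_def)
  have St_pow: "k ^^ n \<in> St" if k: "k \<in> St" for k n
  proof (induction n)
    case 0
    show ?case unfolding funpow.simps by (rule St_id)
  next
    case (Suc n)
    show ?case unfolding funpow.simps by (rule St_comp[OF k Suc])
  qed
  define G where "G = cusp_group \<Gamma> H"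
  define \<rho> where "\<rho> k = restrict k S" for k :: "hyp3 \<Rightarrow> hyp3"
  have Gc: "carrier G = \<rho> ` St" by (simp add: G_def cusp_group_def \<rho>_def S_def St_def)
  have bij: "\<rho> k \<in> Bij S" if k: "k \<in> St" for k
  proof -
    have kS: "k ` S \<subseteq> S" using isometry_frontier St[OF k] by (auto simp: S_def)
    obtain h where h: "h \<in> \<Gamma>" "k \<circ> h = id" "h \<circ> k = id" using gf(4)[of k] k unfolding St_def set_stabilizer_def by blast
    have "h ` H = H" using St[OF k] h(3) by (metis image_comp image_id id_apply)
    then have hS: "h ` S \<subseteq> S" using isometry_frontier gf(1)[OF h(1)] by (auto simp: S_def)
    have "bij_betw k S S"
      by (rule bij_betwI[where g=h]) (use kS hS h in \<open>auto simp: fun_eq_iff\<close>)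
    then have "bij_betw (\<rho> k) S S" unfolding \<rho>_def by (simp add: bij_betw_restrict_eq)
    then show ?thesis by (simp add: Bij_def \<rho>_def)
  qed
  have mult: "\<rho> f \<otimes>\<^bsub>G\<^esub> \<rho> g = \<rho> (f \<circ> g)" if "f \<in> St" "g \<in> St" for f g
  proof -
    have gS: "g x \<in> S" if "x \<in> S" for x using isometry_frontier St[OF \<open>g \<in> St\<close>] that by (auto simp: S_def)
    have "\<rho> f \<otimes>\<^bsub>G\<^esub> \<rho> g = compose S (\<rho> f) (\<rho> g)"
      using bij that by (simp add: G_def cusp_group_def BijGroup_def S_def[symmetric])
    also have "\<dots> = \<rho> (f \<circ> g)" using gS by (auto simp: compose_def \<rho>_def fun_eq_iff)
    finally show ?thesis .
  qed
  obtain A where A: "subgroup A G" "G\<lparr>carrier := A\<rparr> \<cong> integer_group \<times>\<times> integer_group"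
    using vr unfolding virtually_rank_2_def G_def by blast
  obtain \<phi> where \<phi>: "\<phi> \<in> hom (G\<lparr>carrier := A\<rparr>) (integer_group \<times>\<times> integer_group)"
    "bij_betw \<phi> A (UNIV \<times> UNIV)"
    using A(2) unfolding is_iso_def iso_def by (auto simp: DirProd_def integer_group_def)
  have hom: "\<phi> (x \<otimes>\<^bsub>G\<^esub> y) = (fst (\<phi> x) + fst (\<phi> y), snd (\<phi> x) + snd (\<phi> y))" if "x \<in> A" "y \<in> A" for x y
    using \<phi>(1) that unfolding hom_def by (auto simp: DirProd_def integer_group_def split: prod.splits)
  have AS: "A \<subseteq> carrier G" using subgroup.subset[OF A(1)] .
  have Am: "x \<otimes>\<^bsub>G\<^esub> y \<in> A" if "x \<in> A" "y \<in> A" for x y using subgroup.m_closed[OF A(1) that] .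
  have "\<one>\<^bsub>G\<^esub> = \<rho> id" by (simp add: G_def cusp_group_def BijGroup_def \<rho>_def S_def fun_eq_iff restrict_def)
  then have idA: "\<rho> id \<in> A" using subgroup.one_closed[OF A(1)] by simp
  have "\<phi> (\<rho> id) = (fst (\<phi> (\<rho> id)) + fst (\<phi> (\<rho> id)), snd (\<phi> (\<rho> id)) + snd (\<phi> (\<rho> id)))"
    using hom[OF idA idA] mult[OF St_id St_id] by simp
  then have \<phi>0: "\<phi> (\<rho> id) = (0, 0)" by (simp add: prod_eq_iff)
  have surj: "\<exists>k\<in>St. \<rho> k \<in> A \<and> \<phi> (\<rho> k) = v" for v
  proof -
    have "v \<in> \<phi> ` A" using \<phi>(2) by (simp add: bij_betw_def)
    then obtain x where x: "x \<in> A" "\<phi> x = v" by auto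
    then obtain k where "k \<in> St" "x = \<rho> k" using AS Gc by auto
    then show ?thesis using x by blast
  qed
  obtain k1 where k1: "k1 \<in> St" "\<rho> k1 \<in> A" "\<phi> (\<rho> k1) = (1, 0)" using surj by blast
  obtain k2 where k2: "k2 \<in> St" "\<rho> k2 \<in> A" "\<phi> (\<rho> k2) = (0, 1)" using surj by blast
  have pow: "\<rho> (k ^^ n) \<in> A \<and> \<phi> (\<rho> (k ^^ n)) = (of_nat n * fst (\<phi> (\<rho> k)), of_nat n * snd (\<phi> (\<rho> k)))"
    if k: "k \<in> St" "\<rho> k \<in> A" for k n
  proof (induction n)
    case 0
    show ?case using idA \<phi>0 by (simp only: funpow.simps of_nat_0 mult_zero_left simp_thms)
  next
    case (Suc n)
    have "\<rho> (k ^^ Suc n) = \<rho> k \<otimes>\<^bsub>G\<^esub> \<rho> (k ^^ n)"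
      unfolding funpow.simps by (rule mult[OF k(1) St_pow[OF k(1)], symmetric])
    then show ?case using Am[OF k(2)] hom[OF k(2)] Suc by (simp add: algebra_simps del: funpow.simps)
  qed
  have p1: "\<rho> (k1 ^^ n) \<in> A" "\<phi> (\<rho> (k1 ^^ n)) = (of_nat n, 0)" for n using pow[OF k1(1,2), of n] k1(3) by auto
  have p2: "\<rho> (k2 ^^ n) \<in> A" "\<phi> (\<rho> (k2 ^^ n)) = (0, of_nat n)" for n using pow[OF k2(1,2), of n] k2(3) by auto
  show thesis
  proof (rule that)
    show "k1 \<in> set_stabilizer \<Gamma> H" "k2 \<in> set_stabilizer \<Gamma> H" using k1 k2 by (simp_all add: St_def)
    show "n = 0" if "k1 ^^ n = k2 ^^ m" for n m using p1(2)[of n] p2(2)[of m] that by simp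
    show "m = 0" if "k2 ^^ m = id" for m using p2(2)[of m] \<phi>0 that by simp
    show "n = 0" if e: "k1 ^^ n \<circ> k2 ^^ m = id" for n m
    proof -
      have "\<rho> (k1 ^^ n) \<otimes>\<^bsub>G\<^esub> \<rho> (k2 ^^ m) = \<rho> id" using mult[OF St_pow[OF k1(1)] St_pow[OF k2(1)]] e by simp
      then show ?thesis using hom[OF p1(1)[of n] p2(1)[of m]] p1(2) p2(2) \<phi>0 by simp
    qed
  qed
qed

context cusp_at_infinity
begin

lemma shadow_funpow: "k \<in> parabolics \<Longrightarrow> k ^^ n \<in> parabolics \<and> shadow (k ^^ n) = shadow k ^^ n"
proof (induction n)
  case 0
  have "shadow id = id" "id \<in> parabolics" by (simp_all add: shadow_def parabolics_def id_in fun_eq_iff)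
  then show ?case unfolding funpow.simps by blast
next
  case (Suc n)
  then have a: "k ^^ n \<in> parabolics" "shadow (k ^^ n) = shadow k ^^ n" by blast+
  have "shadow (k \<circ> k ^^ n) = shadow k \<circ> shadow (k ^^ n)"
    by (rule shadow_comp[OF isom[OF parabolics_sub[OF Suc.prems]] parabolics_height[OF Suc.prems] parabolics_height[OF a(1)]])
  then show ?case unfolding funpow.simps using parabolics_comp[OF Suc.prems a(1)] a(2) by (simp only: simp_thms)
qed

lemma shadow_inject: "f \<in> parabolics \<Longrightarrow> g \<in> parabolics \<Longrightarrow> shadow f = shadow g \<Longrightarrow> f = g"
  by (rule ext) (metis lift_shadow)

lemma rank2_if_independent:
  assumes k: "k1 \<in> parabolics" "k2 \<in> parabolics"
    and ind: "\<And>n m. k1 ^^ n = k2 ^^ m \<Longrightarrow> n = 0" "\<And>n m. k1 ^^ n \<circ> k2 ^^ m = id \<Longrightarrow> n = 0"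
      "\<And>m. k2 ^^ m = id \<Longrightarrow> m = 0"
  shows "cusp.rank2"
proof (rule cusp.rank2I)
  have sid: "shadow id = id" by (simp add: shadow_def fun_eq_iff)
  have idP: "id \<in> parabolics" by (simp add: parabolics_def id_in)
  show "shadow k1 \<in> shadow ` parabolics" "shadow k2 \<in> shadow ` parabolics" using k by auto
  show "n = 0" if "shadow k1 ^^ n = shadow k2 ^^ m" for n m
    using that shadow_inject shadow_funpow k ind(1) by metis
  show "m = 0" if "shadow k2 ^^ m = id" for m
    using that shadow_inject[of "k2 ^^ m" id] shadow_funpow[OF k(2), of m] idP sid ind(3) by metis
  show "n = 0" if e: "shadow k1 ^^ n \<circ> shadow k2 ^^ m = id" for n m
  proof -
    have p: "k1 ^^ n \<in> parabolics" "k2 ^^ m \<in> parabolics" using shadow_funpow k by auto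
    have "shadow (k1 ^^ n \<circ> k2 ^^ m) = shadow (k1 ^^ n) \<circ> shadow (k2 ^^ m)"
      by (rule shadow_comp[OF isom[OF parabolics_sub[OF p(1)]] parabolics_height[OF p(1)] parabolics_height[OF p(2)]])
    also have "\<dots> = shadow id" using e shadow_funpow[OF k(1), of n] shadow_funpow[OF k(2), of m] sid by simp
    finally have "k1 ^^ n \<circ> k2 ^^ m = id" by (rule shadow_inject[OF parabolics_comp[OF p] idP])
    then show ?thesis by (rule ind(2))
  qed
qed

end

section \<open>Volume\<close>

subsection \<open>Hyperbolic volume is invariant under isometries\<close>

definition half_space :: "(complex \<times> real) set" where "half_space = {p. snd p > 0}"

definition vol_density :: "(complex \<times> real) measure" where
  "vol_density = density lborel (\<lambda>p. ennreal (1 / snd p ^ 3))"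

definition vol :: "hyp3 measure" where
  "vol = distr (restrict_space vol_density half_space) borel Abs_hyp3"

lemma open_half_space: "open half_space"
  unfolding half_space_def by (intro open_Collect_less continuous_intros)

lemma sets_vol_density [simp]: "sets vol_density = sets borel" and space_vol_density [simp]: "space vol_density = UNIV"
  by (simp_all add: vol_density_def)

lemma sets_vol [simp]: "sets vol = sets borel"
  by (simp add: vol_def)

lemma space_vol [simp]: "space vol = UNIV"
  by (simp add: vol_def)

lemma Rep_in_half_space: "Rep_hyp3 x \<in> half_space"
  using Rep_hyp3[of x] by (simp add: half_space_def)

lemma Rep_image_eq: "Rep_hyp3 ` A = Abs_hyp3 -` A \<inter> half_space"
proof
  show "Rep_hyp3 ` A \<subseteq> Abs_hyp3 -` A \<inter> half_space" using Rep_in_half_space by (auto simp: Rep_hyp3_inverse)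
  show "Abs_hyp3 -` A \<inter> half_space \<subseteq> Rep_hyp3 ` A"
  proof
    fix p assume p: "p \<in> Abs_hyp3 -` A \<inter> half_space"
    then have "p = Rep_hyp3 (Abs_hyp3 p)" by (simp add: half_space_def Abs_hyp3_inverse)
    then show "p \<in> Rep_hyp3 ` A" using p by blast
  qed
qed

lemma Abs_measurable: "Abs_hyp3 \<in> measurable (restrict_space vol_density half_space) borel"
proof -
  have "Abs_hyp3 \<in> borel_measurable (restrict_space borel half_space)"
    unfolding half_space_def by (rule borel_measurable_continuous_on_restrict[OF continuous_on_Abs_hyp3])
  moreover have "sets (restrict_space vol_density half_space) = sets (restrict_space borel half_space)"
    by (intro sets_restrict_space_cong) simp
  ultimately show ?thesis by (simp cong: measurable_cong_sets)
qed

lemma Rep_borel: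
  assumes "A \<in> sets borel" shows "Rep_hyp3 ` A \<in> sets borel"
proof -
  have "Abs_hyp3 -` A \<inter> space (restrict_space vol_density half_space) \<in> sets (restrict_space vol_density half_space)"
    by (rule measurable_sets[OF Abs_measurable assms])
  then show ?thesis using open_half_space by (simp add: Rep_image_eq sets_restrict_space_iff space_restrict_space)
qed

lemma open_Rep_image: "open A \<Longrightarrow> open (Rep_hyp3 ` A)"
  unfolding Rep_image_eq
  using continuous_on_open_vimage[OF open_half_space, of Abs_hyp3] continuous_on_Abs_hyp3 by (simp add: half_space_def)

lemma emeasure_vol: "A \<in> sets borel \<Longrightarrow> emeasure vol A = emeasure vol_density (Rep_hyp3 ` A)"
  unfolding vol_def using open_half_space
  by (simp add: emeasure_distr[OF Abs_measurable] space_restrict_space Rep_image_eq emeasure_restrict_space)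

lemma density_measurable: "(\<lambda>p :: complex \<times> real. ennreal (1 / snd p ^ 3)) \<in> borel_measurable borel"
proof -
  have "(snd :: complex \<times> real \<Rightarrow> real) \<in> borel_measurable borel"
    by (intro borel_measurable_continuous_onI continuous_intros)
  then show ?thesis
    by (intro measurable_compose[OF _ measurable_ennreal] borel_measurable_divide borel_measurable_const borel_measurable_power)
qed

lemma hyp_volume_eq: "A \<in> sets borel \<Longrightarrow> hyp_volume A = emeasure vol A"
  unfolding emeasure_vol hyp_volume_def vol_density_def
  by (subst emeasure_density) (simp_all add: density_measurable Rep_borel)

definition similarity :: "complex \<Rightarrow> real \<Rightarrow> hyp3 \<Rightarrow> hyp3" where
  "similarity w r x = mk (w + r *\<^sub>R base x) (r * height x)"

lemma Rep_similarity: "r > 0 \<Longrightarrow> Rep_hyp3 (similarity w r x) = (w, 0) + r *\<^sub>R Rep_hyp3 x"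
  by (simp add: similarity_def prod_eq_iff flip: height_def)

lemma similarity_inverse: "r > 0 \<Longrightarrow> similarity w r (similarity (- (w /\<^sub>R r)) (1 / r) x) = x"
  "r > 0 \<Longrightarrow> similarity (- (w /\<^sub>R r)) (1 / r) (similarity w r x) = x"
  by (rule hyp3_eqI; simp add: similarity_def scaleR_right_diff_distrib scaleR_right_distrib inverse_eq_divide)+

lemma dist_similarity:
  assumes r: "r > 0" shows "dist (similarity w r x) (similarity w r y) = dist x y"
proof -
  have "height (similarity w r x) = r * height x" for x using r by (simp add: similarity_def)
  moreover have "dist (Rep_hyp3 (similarity w r x)) (Rep_hyp3 (similarity w r y)) = r * dist (Rep_hyp3 x) (Rep_hyp3 y)"
    using r unfolding Rep_similarity[OF r] by (simp add: dist_scaleR_both)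
  ultimately have "hyp_cosh (similarity w r x) (similarity w r y) = hyp_cosh x y"
    using r by (simp add: hyp_cosh_def power_mult_distrib power2_eq_square)
  then show ?thesis by (simp add: dist_eq_iff)
qed

lemma similarity_ball:
  assumes r: "r > 0" shows "similarity w r ` ball x e = ball (similarity w r x) e"
proof
  show "similarity w r ` ball x e \<subseteq> ball (similarity w r x) e" by (auto simp: dist_similarity[OF r])
  show "ball (similarity w r x) e \<subseteq> similarity w r ` ball x e"
  proof
    fix y assume y: "y \<in> ball (similarity w r x) e"
    have "y = similarity w r (similarity (- (w /\<^sub>R r)) (1 / r) y)" using similarity_inverse(1)[OF r] by simp
    moreover have "dist x (similarity (- (w /\<^sub>R r)) (1 / r) y) = dist (similarity w r x) y"
      using dist_similarity[OF r, of w x "similarity (- (w /\<^sub>R r)) (1 / r) y"] similarity_inverse(1)[OF r] by simp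
    ultimately show "y \<in> similarity w r ` ball x e" using y by (intro image_eqI) auto
  qed
qed

text \<open>The density \<open>1 / t^3\<close> compensates the scaling of Lebesgue measure in dimension 3.\<close>

lemma vol_ball_similarity:
  assumes r: "r > 0" shows "emeasure vol (ball (similarity w r x) e) = emeasure vol (ball x e)"
proof -
  define f where "f p = ennreal (1 / snd p ^ 3)" for p :: "complex \<times> real"
  define B where "B = Rep_hyp3 ` ball x e"
  define \<tau> where "\<tau> p = (w, 0) + r *\<^sub>R p" for p :: "complex \<times> real"
  have B: "B \<in> sets borel" unfolding B_def by (rule Rep_borel) simp
  have img: "Rep_hyp3 ` ball (similarity w r x) e = \<tau> ` B"
    unfolding similarity_ball[OF r, symmetric] B_def image_image \<tau>_def Rep_similarity[OF r] ..
  have \<tau>B: "\<tau> ` B \<in> sets borel" unfolding img[symmetric] by (rule Rep_borel) simp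
  have f: "f \<in> borel_measurable borel" unfolding f_def by (rule density_measurable)
  have \<tau>: "\<tau> \<in> borel_measurable borel" unfolding \<tau>_def by (intro borel_measurable_continuous_onI continuous_intros)
  have "inj \<tau>" using r by (auto simp: inj_def \<tau>_def)
  then have inj: "indicator (\<tau> ` B) (\<tau> p) = (indicator B p :: ennreal)" for p
    by (simp add: indicator_def inj_image_mem_iff)
  have dim: "DIM(complex \<times> real) = 3" by simp
  have "emeasure vol (ball (similarity w r x) e) = (\<integral>\<^sup>+ p. f p * indicator (\<tau> ` B) p \<partial>lborel)"
    unfolding emeasure_vol[OF borel_open[OF open_ball]] img vol_density_def f_def[symmetric]
    using \<tau>B f by (simp add: emeasure_density)
  also have "\<dots> = (\<integral>\<^sup>+ p. f p * indicator (\<tau> ` B) p \<partial>(density (distr lborel borel \<tau>) (\<lambda>_. \<bar>r\<bar> ^ 3)))"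
  proof (rule arg_cong[where f="\<lambda>M. \<integral>\<^sup>+ p. f p * indicator (\<tau> ` B) p \<partial>M"])
    show "lborel = density (distr lborel borel \<tau>) (\<lambda>_. \<bar>r\<bar> ^ 3)"
      unfolding \<tau>_def dim[symmetric] by (rule lborel_affine) (use r in simp)
  qed
  also have "\<dots> = (\<integral>\<^sup>+ p. ennreal (\<bar>r\<bar> ^ 3) * (f (\<tau> p) * indicator (\<tau> ` B) (\<tau> p)) \<partial>lborel)"
    using f \<tau> \<tau>B by (subst nn_integral_density) (simp_all add: nn_integral_distr)
  also have "\<dots> = (\<integral>\<^sup>+ p. f p * indicator B p \<partial>lborel)"
  proof (intro nn_integral_cong)
    fix p :: "complex \<times> real"
    have "ennreal (\<bar>r\<bar> ^ 3) * f (\<tau> p) = f p" if "p \<in> B"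
    proof -
      have "snd p > 0" using that Rep_in_half_space by (auto simp: B_def half_space_def)
      then show ?thesis using r unfolding f_def \<tau>_def
        by (subst ennreal_mult''[symmetric]) (simp_all add: power_mult_distrib)
    qed
    then show "ennreal (\<bar>r\<bar> ^ 3) * (f (\<tau> p) * indicator (\<tau> ` B) (\<tau> p)) = f p * indicator B p"
      unfolding inj by (auto simp: indicator_def mult.assoc)
  qed
  also have "\<dots> = emeasure vol (ball x e)"
    unfolding emeasure_vol[OF borel_open[OF open_ball]] vol_density_def f_def[symmetric] B_def[symmetric]
    using B f by (simp add: emeasure_density)
  finally show ?thesis .
qed

lemma vol_ball_eq: "emeasure vol (ball x e) = emeasure vol (ball y e)"
proof -
  have "similarity (base x) (height x) (mk 0 1) = x" for x by (rule hyp3_eqI) (simp_all add: similarity_def)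
  then show ?thesis using vol_ball_similarity[OF height_pos] by metis
qed

lemma vol_ball_finite: "emeasure vol (ball x e) < \<infinity>"
proof -
  define K where "K = Rep_hyp3 ` cball x e"
  have K: "compact K" unfolding K_def
    by (rule compact_continuous_image[OF continuous_on_subset[OF continuous_on_Rep_hyp3] compact_cball_hyp3]) simp
  have Kb: "K \<in> sets borel" using compact_imp_closed[OF K] by simp
  obtain m where m: "m > 0" "\<And>p. p \<in> K \<Longrightarrow> m \<le> snd p"
  proof (cases "K = {}")
    case False
    obtain q where q: "q \<in> K" "\<And>p. p \<in> K \<Longrightarrow> snd q \<le> snd p"
      using continuous_attains_inf[OF K False continuous_on_snd[OF continuous_on_id]] by auto
    have "snd q > 0" using q(1) Rep_in_half_space by (auto simp: K_def half_space_def)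
    then show thesis using that q(2) by blast
  qed (use that[of 1] in auto)
  have "emeasure vol (ball x e) = emeasure vol_density (Rep_hyp3 ` ball x e)" by (rule emeasure_vol) simp
  also have "\<dots> \<le> emeasure vol_density K" using Kb by (intro emeasure_mono) (auto simp: K_def)
  also have "\<dots> = (\<integral>\<^sup>+ p. ennreal (1 / snd p ^ 3) * indicator K p \<partial>lborel)"
    unfolding vol_density_def using Kb by (subst emeasure_density) (simp_all add: density_measurable)
  also have "\<dots> \<le> (\<integral>\<^sup>+ p. ennreal (1 / m ^ 3) * indicator K p \<partial>lborel)"
    using m by (intro nn_integral_mono) (auto simp: indicator_def intro!: ennreal_leI frac_le power_mono)
  also have "\<dots> = ennreal (1 / m ^ 3) * emeasure lborel K" using Kb by (subst nn_integral_cmult_indicator) auto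
  also have "\<dots> < \<infinity>" using emeasure_compact_finite[OF K] by (simp add: ennreal_mult_less_top)
  finally show ?thesis .
qed

lemma vol_ball_pos:
  assumes "e > 0" shows "emeasure vol (ball x e) > 0"
proof (rule ccontr)
  assume "\<not> ?thesis"
  then have 0: "emeasure vol_density (Rep_hyp3 ` ball x e) = 0" by (simp add: emeasure_vol)
  have op: "open (Rep_hyp3 ` ball x e)" by (rule open_Rep_image) simp
  have "Rep_hyp3 ` ball x e \<in> null_sets (density lborel (\<lambda>p. ennreal (1 / snd p ^ 3)))"
    using 0 op unfolding vol_density_def by (intro null_setsI) auto
  then have "AE p in lborel. p \<in> Rep_hyp3 ` ball x e \<longrightarrow> ennreal (1 / snd p ^ 3) = 0"
    by (subst (asm) null_sets_density_iff) (auto simp: density_measurable)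
  then have "AE p in lborel. p \<notin> Rep_hyp3 ` ball x e"
  proof eventually_elim
    case (elim p)
    show ?case
    proof
      assume p: "p \<in> Rep_hyp3 ` ball x e"
      then have "snd p > 0" using Rep_in_half_space by (auto simp: half_space_def)
      then have "1 / snd p ^ 3 > 0" by simp
      then show False using elim p by (metis ennreal_eq_0_iff not_le)
    qed
  qed
  then have "Rep_hyp3 ` ball x e \<in> null_sets lborel" using op by (subst AE_iff_null_sets) auto
  then have "negligible (Rep_hyp3 ` ball x e)" unfolding negligible_iff_null_sets by (rule null_sets_completionI)
  then show False using open_not_negligible[OF op] assms by auto
qed

text \<open>
  A Euclidean ball of radius \<open>s\<close> at height \<open>t\<close> is a hyperbolic ball centred at height
  \<open>sqrt (t^2 - s^2)\<close>.
\<close>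

lemma Rep_hyp_ball:
  assumes "0 < s" "s < t"
  obtains x e where "e > 0" "Rep_hyp3 ` ball x e = ball (z, t) s"
proof -
  define u where "u = sqrt (t\<^sup>2 - s\<^sup>2)"
  have st: "s\<^sup>2 < t\<^sup>2" using assms by (intro power_strict_mono) auto
  have u: "u > 0" "u\<^sup>2 = t\<^sup>2 - s\<^sup>2" "u < t"
  proof -
    show "u > 0" "u\<^sup>2 = t\<^sup>2 - s\<^sup>2" using st by (simp_all add: u_def)
    then have "u\<^sup>2 < t\<^sup>2" using assms by simp
    then show "u < t" using assms by (intro power_less_imp_less_base[of u 2 t]) auto
  qed
  define x where "x = mk z u"
  have c: "t / u > 1" using u by simp
  define e where "e = arcosh (t / u)"
  have e: "e > 0" "cosh e = t / u" using c u by (auto simp: e_def)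
  have iff: "dist x y < e \<longleftrightarrow> dist (z, t) (Rep_hyp3 y) < s" for y
  proof -
    define h where "h = height y"
    have h: "h > 0" by (simp add: h_def)
    have "dist x y < e \<longleftrightarrow> cosh (dist x y) < cosh e" using e(1) by (subst cosh_real_nonneg_less_iff) auto
    also have "\<dots> \<longleftrightarrow> ((norm (z - base y))\<^sup>2 + u\<^sup>2 + h\<^sup>2) / (2 * u * h) < t / u"
      unfolding cosh_dist hyp_cosh_alt e using u(1) by (simp add: x_def h_def)
    also have "\<dots> \<longleftrightarrow> (norm (z - base y))\<^sup>2 + u\<^sup>2 + h\<^sup>2 < 2 * t * h"
      using u(1) h by (simp add: divide_less_eq mult_ac)
    also have "\<dots> \<longleftrightarrow> (norm (base y - z))\<^sup>2 + (h - t)\<^sup>2 < s\<^sup>2"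
      unfolding u(2) by (simp add: norm_minus_commute power2_diff) argo
    also have "\<dots> \<longleftrightarrow> (dist (Rep_hyp3 y) (z, t))\<^sup>2 < s\<^sup>2" unfolding dist_Rep_sq h_def ..
    also have "\<dots> \<longleftrightarrow> dist (z, t) (Rep_hyp3 y) < s"
      using assms power2_less_imp_less[of "dist (Rep_hyp3 y) (z, t)" s]
        power_strict_mono[of "dist (Rep_hyp3 y) (z, t)" s 2] by (auto simp: dist_commute)
    finally show ?thesis .
  qed
  have "ball (z, t) s \<subseteq> half_space"
  proof
    fix p assume "p \<in> ball (z, t) s"
    then have "dist t (snd p) < s" using dist_snd_le[of "(z, t)" p] by simp
    then show "p \<in> half_space" using assms by (simp add: half_space_def dist_real_def)
  qed
  then have "Rep_hyp3 ` ball x e = ball (z, t) s"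
    using iff unfolding Rep_image_eq by (auto simp: half_space_def Abs_hyp3_inverse)
  then show thesis using that e(1) by blast
qed

text \<open>
  Hyperbolic balls are Euclidean balls, and their volume depends on their radius only. By the Vitali
  covering theorem an open set is, up to a null set, a disjoint union of balls, so its image
  under an isometry cannot have smaller volume.
\<close>

lemma vol_open_le_image:
  assumes g: "hyp_isometry g" and A: "open A" and gA: "g ` A \<in> sets borel"
  shows "emeasure vol A \<le> emeasure vol (g ` A)"
proof -
  define S where "S = Rep_hyp3 ` A"
  have S: "open S" "S \<subseteq> half_space" unfolding S_def using open_Rep_image[OF A] Rep_in_half_space by auto
  define K where "K = {(x, e) | x e. e > 0 \<and> ball x e \<subseteq> A \<and> (\<exists>c s. s > 0 \<and> Rep_hyp3 ` ball x e = ball c s)}"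
  define cr where "cr k = (SOME cs. snd cs > 0 \<and> Rep_hyp3 ` ball (fst k) (snd k) = ball (fst cs) (snd cs))"
    for k :: "hyp3 \<times> real"
  have cr: "snd (cr k) > 0" "Rep_hyp3 ` ball (fst k) (snd k) = ball (fst (cr k)) (snd (cr k))" if k: "k \<in> K" for k
  proof -
    obtain c s where "s > 0" "Rep_hyp3 ` ball (fst k) (snd k) = ball c s" using k by (auto simp: K_def)
    then have "snd (cr k) > 0 \<and> Rep_hyp3 ` ball (fst k) (snd k) = ball (fst (cr k)) (snd (cr k))"
      unfolding cr_def by (intro someI[of "\<lambda>cs. snd cs > 0 \<and> Rep_hyp3 ` ball (fst k) (snd k) = ball (fst cs) (snd cs)" "(c, s)"]) simp
    then show "snd (cr k) > 0" "Rep_hyp3 ` ball (fst k) (snd k) = ball (fst (cr k)) (snd (cr k))" by auto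
  qed
  obtain C where C: "countable C" "C \<subseteq> K"
     "pairwise (\<lambda>i j. disjnt (ball (fst (cr i)) (snd (cr i))) (ball (fst (cr j)) (snd (cr j)))) C"
     "negligible (S - (\<Union>i\<in>C. ball (fst (cr i)) (snd (cr i))))"
  proof (rule Vitali_covering_theorem_balls[of S K "\<lambda>k. fst (cr k)" "\<lambda>k. snd (cr k)"])
    fix p and d :: real assume p: "p \<in> S" and d: "d > 0"
    obtain \<epsilon> where \<epsilon>: "\<epsilon> > 0" "ball p \<epsilon> \<subseteq> S" using S(1) p openE by blast
    define s where "s = min (min \<epsilon> d) (snd p) / 2"
    have sp: "snd p > 0" using S(2) p by (auto simp: half_space_def)
    have s: "s > 0" "s < d" "s < \<epsilon>" "s < snd p" using \<epsilon> d sp by (auto simp: s_def)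
    obtain x e where x: "e > 0" "Rep_hyp3 ` ball x e = ball (fst p, snd p) s" using Rep_hyp_ball[OF s(1,4)] .
    have "ball x e \<subseteq> A"
    proof
      fix y assume "y \<in> ball x e"
      then have "Rep_hyp3 y \<in> ball p s" using x(2) by auto
      then have "Rep_hyp3 y \<in> S" using \<epsilon> s by auto
      then show "y \<in> A" by (auto simp: S_def Rep_hyp3_inject)
    qed
    then have k: "(x, e) \<in> K" using x s(1) unfolding K_def by blast
    have "ball p s = ball (fst (cr (x, e))) (snd (cr (x, e)))" using cr(2)[OF k] x(2) by simp
    then have "fst (cr (x, e)) = p" "snd (cr (x, e)) = s" using s(1) cr(1)[OF k] by (auto simp: ball_eq_ball_iff)
    then show "\<exists>i. i \<in> K \<and> p \<in> ball (fst (cr i)) (snd (cr i)) \<and> snd (cr i) < d"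
      using k s by (intro exI[of _ "(x, e)"]) auto
  qed
  define Bl where "Bl k = ball (fst k) (snd k)" for k :: "hyp3 \<times> real"
  have RB: "Rep_hyp3 ` Bl k = ball (fst (cr k)) (snd (cr k))" if "k \<in> C" for k
    using cr(2)[of k] C(2) that unfolding Bl_def by blast
  have injR: "inj Rep_hyp3" by (simp add: inj_def Rep_hyp3_inject)
  have disj: "disjoint_family_on Bl C" unfolding disjoint_family_on_def
  proof (intro ballI impI)
    fix i j assume ij: "i \<in> C" "j \<in> C" "i \<noteq> j"
    then have "Rep_hyp3 ` Bl i \<inter> Rep_hyp3 ` Bl j = {}" using C(3) unfolding RB[OF ij(1)] RB[OF ij(2)] pairwise_def disjnt_def by blast
    then show "Bl i \<inter> Bl j = {}" using image_Int[OF injR, of "Bl i" "Bl j"] by simp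
  qed
  have ginj: "inj g" using g by (simp add: hyp_isometry_def bij_is_inj)
  have gB: "g ` Bl k = ball (g (fst k)) (snd k)" for k
  proof
    have d: "dist (g x) (g y) = dist x y" for x y using g by (simp add: hyp_isometry_def)
    show "g ` Bl k \<subseteq> ball (g (fst k)) (snd k)" by (auto simp: Bl_def d)
    show "ball (g (fst k)) (snd k) \<subseteq> g ` Bl k"
    proof
      fix y assume y: "y \<in> ball (g (fst k)) (snd k)"
      obtain x where "y = g x" using g by (metis hyp_isometry_def bij_is_surj surjD)
      then show "y \<in> g ` Bl k" using y by (auto simp: Bl_def d)
    qed
  qed
  have disj': "disjoint_family_on (\<lambda>k. g ` Bl k) C" unfolding disjoint_family_on_def
  proof (intro ballI impI)
    fix i j assume "i \<in> C" "j \<in> C" "i \<noteq> j"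
    then have "Bl i \<inter> Bl j = {}" using disj by (auto simp: disjoint_family_on_def)
    then show "g ` Bl i \<inter> g ` Bl j = {}" using image_Int[OF ginj, of "Bl i" "Bl j"] by simp
  qed
  have Bm: "Bl k \<in> sets vol" "g ` Bl k \<in> sets vol" for k unfolding gB by (simp_all add: Bl_def)
  have Am: "A \<in> sets borel" using A by simp
  define U where "U = (\<Union>k\<in>C. Bl k)"
  have Um: "U \<in> sets vol" unfolding U_def using C(1) Bm by (intro sets.countable_UN') auto
  have "ball (fst k) (snd k) \<subseteq> A" if "k \<in> K" for k using that unfolding K_def by auto
  then have UA: "U \<subseteq> A" unfolding U_def Bl_def using C(2) by blast
  have RU: "Rep_hyp3 ` U = (\<Union>i\<in>C. ball (fst (cr i)) (snd (cr i)))"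
    unfolding U_def image_UN using RB by (intro SUP_cong) auto
  have "S - Rep_hyp3 ` U \<in> null_sets lborel"
  proof -
    have "S - Rep_hyp3 ` U \<in> sets borel" using S(1) Rep_borel[of U] Um by (intro sets.Diff) auto
    moreover have "S - Rep_hyp3 ` U \<in> null_sets lebesgue" using C(4) unfolding RU negligible_iff_null_sets .
    ultimately show ?thesis by (simp add: null_sets_completion_iff)
  qed
  then have "S - Rep_hyp3 ` U \<in> null_sets vol_density"
    unfolding vol_density_def
    using absolutely_continuousI_density[of "\<lambda>p. ennreal (1 / snd p ^ 3)" lborel] density_measurable
    by (auto simp: absolutely_continuous_def)
  then have "emeasure vol_density (Rep_hyp3 ` (A - U)) = 0"
    unfolding S_def image_set_diff[OF injR] by (simp add: null_setsD1)
  then have "emeasure vol (A - U) = 0" using Am Um by (subst emeasure_vol) auto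
  then have "emeasure vol A = emeasure vol U"
    using emeasure_Un_null_set[of U vol "A - U"] Am Um UA by (simp add: null_sets_def Un_absorb1)
  also have "\<dots> = (\<integral>\<^sup>+k. emeasure vol (Bl k) \<partial>count_space C)"
    unfolding U_def by (rule emeasure_UN_countable[OF Bm(1) C(1) disj])
  also have "\<dots> = (\<integral>\<^sup>+k. emeasure vol (g ` Bl k) \<partial>count_space C)"
    unfolding gB unfolding Bl_def using vol_ball_eq by (intro nn_integral_cong) blast
  also have "\<dots> = emeasure vol (\<Union>k\<in>C. g ` Bl k)"
    by (rule emeasure_UN_countable[OF Bm(2) C(1) disj', symmetric])
  also have "\<dots> \<le> emeasure vol (g ` A)"
    using UA gA by (intro emeasure_mono) (auto simp: U_def)
  finally show ?thesis .
qed

lemma isometry_image_vimage: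
  assumes "\<And>x. g (h x) = x" "\<And>x. h (g x) = x" shows "g ` A = h -` A"
  using assms by (auto simp: image_iff) metis

lemma isometry_continuous: "hyp_isometry g \<Longrightarrow> continuous_on UNIV g"
  unfolding continuous_on_iff hyp_isometry_def by auto

lemma isometry_borel:
  assumes "hyp_isometry h" "\<And>x. g (h x) = x" "\<And>x. h (g x) = x" "A \<in> sets borel"
  shows "g ` A \<in> sets borel"
  unfolding isometry_image_vimage[OF assms(2,3)]
  using measurable_sets[OF borel_measurable_continuous_onI[OF isometry_continuous[OF assms(1)]] assms(4)] by simp

text \<open>
  Equality holds for open sets, by applying the inequality to the inverse isometry as well, and
  open sets determine a measure that is finite on balls.
\<close>

theorem vol_isometry_image:
  assumes g: "hyp_isometry g" and h: "hyp_isometry h" and gh: "\<And>x. g (h x) = x" "\<And>x. h (g x) = x"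
    and A: "A \<in> sets borel"
  shows "emeasure vol (g ` A) = emeasure vol A"
proof -
  have hm: "h \<in> measurable vol borel"
    using borel_measurable_continuous_onI[OF isometry_continuous[OF h]] by (simp cong: measurable_cong_sets)
  have em: "emeasure (distr vol borel h) B = emeasure vol (g ` B)" if "B \<in> sets borel" for B
    using that hm by (simp add: emeasure_distr isometry_image_vimage[OF gh])
  have "vol = distr vol borel h"
  proof (rule measure_eqI_generator_eq[where E="{B. open B}" and \<Omega>=UNIV and A="\<lambda>n. ball (mk 0 1) (real n)"])
    show "Int_stable {B :: hyp3 set. open B}" by (auto simp: Int_stable_def)
    show "sets vol = sigma_sets UNIV {B. open B}" "sets (distr vol borel h) = sigma_sets UNIV {B. open B}"
      by (simp_all add: borel_def)
    show "(\<Union>n. ball (mk 0 1) (real n)) = UNIV" using reals_Archimedean2 by auto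
    show "emeasure vol (ball (mk 0 1) (real n)) \<noteq> \<infinity>" for n using vol_ball_finite[of "mk 0 1" "real n"] by auto
    fix B :: "hyp3 set" assume "B \<in> {B. open B}"
    then have B: "open B" by simp
    have gB: "open (g ` B)" unfolding isometry_image_vimage[OF gh]
      using isometry_continuous[OF h] B by (simp add: continuous_on_open_vimage)
    have hgB: "h ` g ` B = B" using gh(2) by (simp add: image_image)
    have "emeasure vol B \<le> emeasure vol (g ` B)" using vol_open_le_image[OF g B] gB by simp
    moreover have "emeasure vol (g ` B) \<le> emeasure vol B" using vol_open_le_image[OF h gB] B hgB by simp
    ultimately show "emeasure vol B = emeasure (distr vol borel h) B" using em[of B] B by simp
  qed auto
  then show ?thesis using em[OF A] by simp
qed

subsection \<open>Volume and packings\<close>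

context kleinian_group
begin

lemma countable_group: "countable \<Gamma>"
proof -
  have "\<Gamma> = (\<Union>n::nat. {g \<in> \<Gamma>. dist (g (mk 0 1)) (mk 0 1) \<le> real n})"
    by (auto simp: real_arch_simple)
  moreover have "countable (\<Union>n::nat. {g \<in> \<Gamma>. dist (g (mk 0 1)) (mk 0 1) \<le> real n})"
  proof (rule countable_UN)
    show "countable {g \<in> \<Gamma>. dist (g (mk 0 1)) (mk 0 1) \<le> real n}" for n by (rule countable_finite[OF proper])
  qed simp
  ultimately show ?thesis by simp
qed

lemma inverse_isometry:
  assumes "g \<in> \<Gamma>"
  obtains h where "h \<in> \<Gamma>" "hyp_isometry h" "\<And>x. g (h x) = x" "\<And>x. h (g x) = x"
proof -
  obtain h where "h \<in> \<Gamma>" "g \<circ> h = id" "h \<circ> g = id" using inverse_in assms by blast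
  then show thesis using that isom by (metis comp_apply id_apply)
qed

text \<open>
  A set meeting every orbit at most once is cut into countably many pieces by the translates of a
  fundamental set, and moving the pieces back into the fundamental set makes them disjoint.
\<close>

lemma vol_injective_le_fundamental:
  assumes F: "fundamental_set \<Gamma> F" and W: "W \<in> sets borel"
    and inj: "\<And>g x. g \<in> \<Gamma> \<Longrightarrow> x \<in> W \<Longrightarrow> g x \<in> W \<Longrightarrow> g = id"
  shows "emeasure vol W \<le> emeasure vol F"
proof -
  have Fb: "F \<in> sets borel" and bij: "bij_betw (orbit_proj \<Gamma>) F (range (orbit_proj \<Gamma>))"
    using F by (auto simp: fundamental_set_def)
  define Y where "Y g = F \<inter> g -` W" for g
  have Ym: "Y g \<in> sets vol" if "g \<in> \<Gamma>" for g
    unfolding Y_def using measurable_sets[OF borel_measurable_continuous_onI[OF isometry_continuous[OF isom[OF that]]] W] Fb by simp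
  have gYm: "g ` Y g \<in> sets vol" and gYv: "emeasure vol (g ` Y g) = emeasure vol (Y g)" if g: "g \<in> \<Gamma>" for g
  proof -
    obtain h where h: "h \<in> \<Gamma>" "hyp_isometry h" "\<And>x. g (h x) = x" "\<And>x. h (g x) = x" using inverse_isometry[OF g] by blast
    show "g ` Y g \<in> sets vol" using isometry_borel[OF h(2,3,4)] Ym[OF g] by simp
    show "emeasure vol (g ` Y g) = emeasure vol (Y g)" using vol_isometry_image[OF isom[OF g] h(2,3,4)] Ym[OF g] by simp
  qed
  have orb: "orbit_proj \<Gamma> (g x) = orbit_proj \<Gamma> x" if g: "g \<in> \<Gamma>" for g x
  proof -
    obtain h where h: "h \<in> \<Gamma>" "\<And>x. g (h x) = x" "\<And>x. h (g x) = x" using inverse_isometry[OF g] by metis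
    show ?thesis unfolding orbit_proj_def
    proof (intro subset_antisym subsetI)
      fix y assume "y \<in> (\<lambda>k. k (g x)) ` \<Gamma>"
      then obtain k where "k \<in> \<Gamma>" "y = (k \<circ> g) x" by auto
      then show "y \<in> (\<lambda>k. k x) ` \<Gamma>" using comp_in[OF _ g] by (intro image_eqI[of _ _ "k \<circ> g"])
    next
      fix y assume "y \<in> (\<lambda>k. k x) ` \<Gamma>"
      then obtain k where "k \<in> \<Gamma>" "y = (k \<circ> h) (g x)" using h by auto
      then show "y \<in> (\<lambda>k. k (g x)) ` \<Gamma>" using comp_in[OF _ h(1)] by (intro image_eqI[of _ _ "k \<circ> h"])
    qed
  qed
  have self: "x \<in> orbit_proj \<Gamma> x" for x unfolding orbit_proj_def using id_in by (intro image_eqI[of _ _ id]) auto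
  have "W \<subseteq> (\<Union>g\<in>\<Gamma>. g ` Y g)"
  proof
    fix w assume w: "w \<in> W"
    have "orbit_proj \<Gamma> w \<in> orbit_proj \<Gamma> ` F" using bij by (simp add: bij_betw_def)
    then obtain f where f: "f \<in> F" "orbit_proj \<Gamma> w = orbit_proj \<Gamma> f" by auto
    then have "w \<in> orbit_proj \<Gamma> f" using self[of w] by simp
    then obtain g where "g \<in> \<Gamma>" "w = g f" by (auto simp: orbit_proj_def)
    then show "w \<in> (\<Union>g\<in>\<Gamma>. g ` Y g)" using f w by (auto simp: Y_def)
  qed
  then have "emeasure vol W \<le> emeasure vol (\<Union>g\<in>\<Gamma>. g ` Y g)"
    using countable_group gYm by (intro emeasure_mono sets.countable_UN'') auto
  also have "\<dots> = (\<integral>\<^sup>+g. emeasure vol (g ` Y g) \<partial>count_space \<Gamma>)"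
  proof (rule emeasure_UN_countable[OF gYm countable_group])
    show "disjoint_family_on (\<lambda>g. g ` Y g) \<Gamma>" unfolding disjoint_family_on_def
    proof (intro ballI impI)
      fix g k assume g: "g \<in> \<Gamma>" and k: "k \<in> \<Gamma>" and "g \<noteq> k"
      show "g ` Y g \<inter> k ` Y k = {}"
      proof (rule ccontr)
        assume "g ` Y g \<inter> k ` Y k \<noteq> {}"
        then obtain x y where xy: "x \<in> F" "y \<in> F" "g x = k y" by (auto simp: Y_def)
        then have "orbit_proj \<Gamma> x = orbit_proj \<Gamma> y" using orb[OF g, of x] orb[OF k, of y] by simp
        then have "x = y" using bij xy by (auto simp: bij_betw_def inj_on_def)
        obtain h where h: "h \<in> \<Gamma>" "\<And>x. k (h x) = x" "\<And>x. h (k x) = x" using inverse_isometry[OF k] by metis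
        have "(h \<circ> g) x = x" using xy \<open>x = y\<close> h by simp
        then have "h \<circ> g = id" using free comp_in[OF h(1) g] by blast
        then have "g z = k z" for z using h(2)[of "g z"] by (metis comp_apply id_apply)
        then have "g = k" by (rule ext)
        then show False using \<open>g \<noteq> k\<close> by simp
      qed
    qed
  qed
  also have "\<dots> = (\<integral>\<^sup>+g. emeasure vol (Y g) \<partial>count_space \<Gamma>)"
    using gYv by (intro nn_integral_cong) simp
  also have "\<dots> = emeasure vol (\<Union>g\<in>\<Gamma>. Y g)"
  proof (rule emeasure_UN_countable[OF Ym countable_group, symmetric])
    show "disjoint_family_on Y \<Gamma>" unfolding disjoint_family_on_def
    proof (intro ballI impI)
      fix g k assume g: "g \<in> \<Gamma>" and k: "k \<in> \<Gamma>" and "g \<noteq> k"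
      show "Y g \<inter> Y k = {}"
      proof (rule ccontr)
        assume "Y g \<inter> Y k \<noteq> {}"
        then obtain x where x: "g x \<in> W" "k x \<in> W" by (auto simp: Y_def)
        obtain h where h: "h \<in> \<Gamma>" "\<And>x. g (h x) = x" "\<And>x. h (g x) = x" using inverse_isometry[OF g] by metis
        have "k \<circ> h = id" using inj[OF comp_in[OF k h(1)] x(1)] x(2) h by simp
        then have "k z = g z" for z using h(3)[of z] by (metis comp_apply id_apply)
        then have "k = g" by (rule ext)
        then show False using \<open>g \<noteq> k\<close> by simp
      qed
    qed
  qed
  also have "\<dots> \<le> emeasure vol F" using Fb by (intro emeasure_mono) (auto simp: Y_def)
  finally show ?thesis .
qed

text \<open>
  Disjoint balls of the same radius embedded in the quotient each contribute the same
  positive volume.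
\<close>

lemma packing_infinite_volume:
  fixes x :: "nat \<Rightarrow> hyp3"
  assumes e: "e > 0" and F: "fundamental_set \<Gamma> F"
    and sep: "\<And>i j g w. g \<in> \<Gamma> \<Longrightarrow> w \<in> ball (x i) e \<Longrightarrow> g w \<in> ball (x j) e \<Longrightarrow> i = j \<and> g = id"
  shows "emeasure vol F = \<infinity>"
proof (rule ccontr)
  assume fin: "emeasure vol F \<noteq> \<infinity>"
  define v where "v = emeasure vol (ball (mk 0 1) e)"
  have v: "v > 0" unfolding v_def by (rule vol_ball_pos[OF e])
  have "of_nat n * v \<le> emeasure vol F" for n
  proof -
    define W where "W = (\<Union>i<n. ball (x i) e)"
    have "emeasure vol W = (\<Sum>i<n. emeasure vol (ball (x i) e))"
      unfolding W_def
    proof (rule sum_emeasure[symmetric])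
      show "disjoint_family_on (\<lambda>i. ball (x i) e) {..<n}" unfolding disjoint_family_on_def
        using sep[OF id_in] by fastforce
    qed auto
    also have "\<dots> = (\<Sum>i<n. v)" unfolding v_def by (intro sum.cong refl vol_ball_eq)
    finally have "of_nat n * v = emeasure vol W" by simp
    also have "\<dots> \<le> emeasure vol F"
    proof (rule vol_injective_le_fundamental[OF F])
      show "W \<in> sets borel" unfolding W_def by (intro borel_open open_UN) auto
      fix g w assume "g \<in> \<Gamma>" "w \<in> W" "g w \<in> W"
      then show "g = id" using sep unfolding W_def by blast
    qed
    finally show ?thesis .
  qed
  then have "(SUP n. of_nat n * v) \<le> emeasure vol F" by (intro SUP_least)
  moreover have "(SUP n. of_nat n * v) = (\<infinity> :: ennreal)"
    using v by (simp add: SUP_mult_right_ennreal[symmetric] ennreal_SUP_of_nat_eq_top ennreal_top_mult)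
  ultimately show False using fin by (simp add: top_unique)
qed

end

text \<open>
  Dilations make the estimate uniform: a small hyperbolic ball has Euclidean size proportional
  to the height of its centre.
\<close>

lemma uniform_small_balls:
  assumes "\<rho> > 0"
  obtains e where "e > 0" "\<And>z t x. t > 0 \<Longrightarrow> dist (mk z t) x < e \<Longrightarrow> t / 4 < height x \<and> height x < 4 * t \<and> dist z (base x) < \<rho> * t"
proof -
  define m where "m = min (1/2) (\<rho>\<^sup>2 / 8)"
  have m: "m > 0" "m \<le> 1/2" "8 * m \<le> \<rho>\<^sup>2" using assms by (auto simp: m_def)
  show thesis
  proof (rule that[of "arcosh (1 + m)"])
    show "arcosh (1 + m) > 0" using m by simp
    fix z t x assume t: "t > (0::real)" and d: "dist (mk z t) x < arcosh (1 + m)"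
    have "cosh (dist (mk z t) x) < cosh (arcosh (1 + m))" using d m by (subst cosh_real_nonneg_less_iff) auto
    then have c: "hyp_cosh (mk z t) x < 1 + m" "hyp_cosh x (mk z t) < 1 + m" using m by (simp_all add: cosh_dist hyp_cosh_commute)
    have "height x \<le> 2 * hyp_cosh (mk z t) x * t" "t \<le> 2 * hyp_cosh x (mk z t) * height x"
      using height_le_hyp_cosh[of x "mk z t"] height_le_hyp_cosh[of "mk z t" x] t by simp_all
    moreover have "2 * hyp_cosh (mk z t) x * t < 4 * t" "2 * hyp_cosh x (mk z t) * height x < 4 * height x"
      using c m t by (auto intro!: mult_strict_right_mono)
    ultimately have h: "height x < 4 * t" "t / 4 < height x" by linarith+
    have "(dist z (base x))\<^sup>2 \<le> (dist (Rep_hyp3 (mk z t)) (Rep_hyp3 x))\<^sup>2"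
      using t dist_fst_le[of "Rep_hyp3 (mk z t)" "Rep_hyp3 x"] by (intro power_mono) auto
    also have "\<dots> = 2 * t * height x * (hyp_cosh (mk z t) x - 1)" unfolding Rep_dist_sq using t by simp
    also have "\<dots> \<le> 2 * t * (4 * t) * (hyp_cosh (mk z t) x - 1)"
      using h t by (intro mult_right_mono mult_left_mono) auto
    also have "\<dots> < 2 * t * (4 * t) * m" using c t by (intro mult_strict_left_mono) auto
    also have "\<dots> = (8 * m) * t\<^sup>2" by (simp add: power2_eq_square)
    also have "\<dots> \<le> (\<rho> * t)\<^sup>2" using m unfolding power_mult_distrib by (intro mult_right_mono) auto
    finally have "dist z (base x) < \<rho> * t" using assms t by (intro power_less_imp_less_base[of _ 2 "\<rho> * t"]) auto
    then show "t / 4 < height x \<and> height x < 4 * t \<and> dist z (base x) < \<rho> * t" using h by simp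
  qed
qed

context cusp_at_infinity
begin

text \<open>A cusp that is not of rank 2 contains infinitely many disjoint balls of the same size.\<close>

lemma infinite_volume_if_not_rank2:
  assumes F: "fundamental_set \<Gamma> F" and nr: "\<not> cusp.rank2" and nt: "parabolics \<noteq> {id}"
  shows "emeasure vol F = \<infinity>"
proof -
  have id_parabolic: "id \<in> parabolics" by (simp add: parabolics_def id_in)
  have sid: "shadow id = id" by (simp add: shadow_def fun_eq_iff)
  have "shadow ` parabolics \<noteq> {id}"
  proof
    assume a: "shadow ` parabolics = {id}"
    have "q = id" if "q \<in> parabolics" for q
    proof (rule shadow_inject[OF that id_parabolic])
      show "shadow q = shadow id" using a that sid by auto
    qed
    then show False using nt id_parabolic by blast
  qed
  then obtain \<rho> z where \<rho>: "\<rho> > 0"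
    and z: "\<And>i j f w. f \<in> shadow ` parabolics \<Longrightarrow> w \<in> ball (z i) \<rho> \<Longrightarrow> f w \<in> ball (z j) \<rho> \<Longrightarrow> i = (j::nat) \<and> f = id"
    using cusp.not_rank2_packing[OF nr] by metis
  have "\<rho> / 8 > 0" using \<rho> by simp
  from uniform_small_balls[OF this] obtain e where e: "e > 0"
    "\<And>z t x. t > 0 \<Longrightarrow> dist (mk z t) x < e \<Longrightarrow> t / 4 < height x \<and> height x < 4 * t \<and> dist z (base x) < \<rho> / 8 * t"
    by metis
  show ?thesis
  proof (rule packing_infinite_volume[OF e(1) F, of "\<lambda>i. mk (z i) 8"])
    fix i j g w assume g: "g \<in> \<Gamma>" and w: "w \<in> ball (mk (z i) 8) e" and gw: "g w \<in> ball (mk (z j) 8) e"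
    have w': "height w > 2" "w \<in> ball (mk (z i) 8) e" "dist (z i) (base w) < \<rho>" using e(2)[of 8 "z i" w] w by auto
    have gw': "height (g w) > 2" "dist (z j) (base (g w)) < \<rho>" using e(2)[of 8 "z j" "g w"] gw by auto
    have "2 * 2 < height w * height (g w)" using w' gw' by (intro mult_strict_mono) auto
    then have gP: "g \<in> parabolics" using nonparabolic_bound[OF g, of w] by force
    have "i = j \<and> shadow g = id" using z[of "shadow g" "base w" i j] gP w' gw' base_parabolic[OF gP, of w] by auto
    then show "i = j \<and> g = id" using shadow_inject[OF gP id_parabolic] sid by auto
  qed
qed

text \<open>If all elements preserve the horospheres about infinity then balls further and further down
  are disjoint in the quotient.\<close>

lemma infinite_volume_if_parabolic:
  assumes F: "fundamental_set \<Gamma> F" and all: "\<Gamma> \<subseteq> parabolics"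
  shows "emeasure vol F = \<infinity>"
proof -
  have id_parabolic: "id \<in> parabolics" by (simp add: parabolics_def id_in)
  have sid: "shadow id = id" by (simp add: shadow_def fun_eq_iff)
  define D where "D = (\<lambda>f. f 0) ` {f \<in> shadow ` parabolics. dist (f 0) 0 \<le> 1}"
  have "finite D" unfolding D_def by (intro finite_imageI cusp.locally_finite)
  then obtain m where m: "m > 0" "\<And>x. x \<in> D \<Longrightarrow> x \<noteq> 0 \<Longrightarrow> m \<le> dist 0 x" using finite_set_avoid[of D 0] by metis
  define \<rho> where "\<rho> = min m 1 / 2"
  have \<rho>: "\<rho> > 0" "2 * \<rho> \<le> m" "2 * \<rho> \<le> 1" using m(1) by (auto simp: \<rho>_def)
  obtain e where e: "e > 0"
    "\<And>z t x. t > 0 \<Longrightarrow> dist (mk z t) x < e \<Longrightarrow> t / 4 < height x \<and> height x < 4 * t \<and> dist z (base x) < \<rho> * t"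
    using uniform_small_balls[OF \<rho>(1)] by metis
  define t where "t i = (1 / 16 :: real) ^ i" for i :: nat
  have t: "0 < t i" "t i \<le> 1" for i by (simp_all add: t_def power_le_one)
  show ?thesis
  proof (rule packing_infinite_volume[OF e(1) F, of "\<lambda>i. mk 0 (t i)"])
    fix i j g w assume g: "g \<in> \<Gamma>" and w: "w \<in> ball (mk 0 (t i)) e" and gw: "g w \<in> ball (mk 0 (t j)) e"
    have gP: "g \<in> parabolics" using g all by blast
    have w': "t i / 4 < height w" "height w < 4 * t i" "dist 0 (base w) < \<rho> * t i" using e(2)[OF t(1), of 0 i w] w by auto
    have gw': "t j / 4 < height w" "height w < 4 * t j" "dist 0 (base (g w)) < \<rho> * t j"
      using e(2)[OF t(1), of 0 j "g w"] gw parabolics_height[OF gP] by auto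
    have step: "t l \<le> t k / 16" if "k < l" for k l
    proof -
      have "t l = t (Suc k) * (1/16) ^ (l - Suc k)" using that by (simp add: t_def del: power_Suc flip: power_add)
      also have "\<dots> \<le> t (Suc k) * 1" using t by (intro mult_left_mono power_le_one) (auto simp: less_imp_le)
      finally show ?thesis by (simp add: t_def)
    qed
    have ij: "i = j" using step[of i j] step[of j i] w' gw' by (cases i j rule: linorder_cases) auto
    have "\<rho> * t k \<le> \<rho> * 1" for k using \<rho>(1) t(2) by (intro mult_left_mono) auto
    from this[of i] this[of j] have "dist 0 (base w) < \<rho>" "dist 0 (base (g w)) < \<rho>" using w'(3) gw'(3) by linarith+
    then have "dist (shadow g (base w)) 0 < \<rho>" "dist (base w) 0 < \<rho>" using base_parabolic[OF gP, of w] by (simp_all add: dist_commute)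
    moreover have "dist (shadow g 0) (shadow g (base w)) = dist 0 (base w)" using gP by (intro cusp.isom) auto
    ultimately have "dist (shadow g 0) 0 < 2 * \<rho>"
      using dist_triangle[of "shadow g 0" 0 "shadow g (base w)"] by (simp add: dist_commute)
    then have "shadow g 0 = 0" using m(2)[of "shadow g 0"] \<rho> gP unfolding D_def by (force simp: dist_commute)
    then have "shadow g = shadow id" using cusp.free[of "shadow g" 0] gP sid by auto
    then show "i = j \<and> g = id" using ij shadow_inject[OF gP id_parabolic] by simp
  qed
qed

end

lemma (in coordinate_change) fundamental_set_conj:
  assumes "fundamental_set \<Gamma> F"
  shows "fundamental_set (conj_group c c' \<Gamma>) (c ` F)" "emeasure vol (c ` F) = emeasure vol F"
proof -
  have F: "F \<in> sets borel" "bij_betw (orbit_proj \<Gamma>) F (range (orbit_proj \<Gamma>))" using assms by (auto simp: fundamental_set_def)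
  show "emeasure vol (c ` F) = emeasure vol F" by (rule vol_isometry_image[OF c c' cc' c'c F(1)])
  have injc: "inj (\<lambda>A. c ` A)" by (rule inj_image) (metis c'c injI)
  have op: "orbit_proj (conj_group c c' \<Gamma>) (c x) = c ` orbit_proj \<Gamma> x" for x unfolding orbit_proj_conj by simp
  have "inj_on (orbit_proj (conj_group c c' \<Gamma>)) (c ` F)"
  proof (rule inj_onI)
    fix x y assume "x \<in> c ` F" "y \<in> c ` F" and eq: "orbit_proj (conj_group c c' \<Gamma>) x = orbit_proj (conj_group c c' \<Gamma>) y"
    then obtain u v where uv: "u \<in> F" "v \<in> F" "x = c u" "y = c v" by auto
    then have "c ` orbit_proj \<Gamma> u = c ` orbit_proj \<Gamma> v" using eq op by simp
    then have "orbit_proj \<Gamma> u = orbit_proj \<Gamma> v" using injD[OF injc] by blast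
    then show "x = y" using F(2) uv by (auto simp: bij_betw_def inj_on_def)
  qed
  moreover have "orbit_proj (conj_group c c' \<Gamma>) ` c ` F = range (orbit_proj (conj_group c c' \<Gamma>))"
  proof -
    have "orbit_proj (conj_group c c' \<Gamma>) ` c ` F = (\<lambda>A. c ` A) ` orbit_proj \<Gamma> ` F" by (simp add: image_image op)
    also have "\<dots> = (\<lambda>A. c ` A) ` range (orbit_proj \<Gamma>)" using F(2) by (simp add: bij_betw_def)
    also have "\<dots> = range (orbit_proj (conj_group c c' \<Gamma>))"
    proof -
      have "range (orbit_proj (conj_group c c' \<Gamma>)) = orbit_proj (conj_group c c' \<Gamma>) ` range c"
        by (metis c hyp_isometry_def bij_is_surj)
      then show ?thesis by (simp add: image_image op)
    qed
    finally show ?thesis .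
  qed
  ultimately show "fundamental_set (conj_group c c' \<Gamma>) (c ` F)"
    using isometry_borel[OF c' cc' c'c F(1)] by (simp add: fundamental_set_def bij_betw_def)
qed

section \<open>Infinitely many simple closed geodesics\<close>

context cusp_at_infinity
begin

lemma conj_rank2:
  assumes \<mu>: "\<mu> > 0" and C: "cusp_at_infinity (conj_group (hscale \<mu>) (hscale (1 / \<mu>)) \<Gamma>)"
    and rank: "cusp.rank2"
  shows "plane_group.rank2 (shadow ` cusp_at_infinity.parabolics (conj_group (hscale \<mu>) (hscale (1 / \<mu>)) \<Gamma>))"
proof -
  interpret C: cusp_at_infinity "conj_group (hscale \<mu>) (hscale (1 / \<mu>)) \<Gamma>" by fact
  have T: "\<mu> *\<^sub>R t \<in> C.cusp.T" if t: "t \<in> cusp.T" for t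
  proof -
    obtain q where q: "q \<in> parabolics" "shadow q = (\<lambda>z. z + t)" using t by (auto simp: cusp.T_def)
    define k where "k = hscale \<mu> \<circ> q \<circ> hscale (1 / \<mu>)"
    have "k \<in> conj_group (hscale \<mu>) (hscale (1 / \<mu>)) \<Gamma>" using parabolics_sub[OF q(1)] by (simp add: k_def conj_group_def)
    then have kP: "k \<in> C.parabolics" using \<mu> parabolics_height[OF q(1)] by (simp add: C.parabolics_def k_def)
    have "shadow k = (\<lambda>z. z + \<mu> *\<^sub>R t)"
    proof
      fix z
      have "shadow k z = \<mu> *\<^sub>R shadow q (base (hscale (1 / \<mu>) (mk z 1)))"
      proof -
        have "shadow k z = base (hscale \<mu> (q (hscale (1 / \<mu>) (mk z 1))))" by (simp add: shadow_def k_def)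
        then show ?thesis using \<mu> by (simp only: base_hscale base_parabolic[OF q(1)])
      qed
      then show "shadow k z = z + \<mu> *\<^sub>R t" using \<mu> q(2) by (simp add: scaleR_right_distrib)
    qed
    then have "(\<lambda>z. z + \<mu> *\<^sub>R t) \<in> shadow ` C.parabolics" using kP by (intro image_eqI[of _ _ k]) simp_all
    then show ?thesis by (simp add: C.cusp.T_def)
  qed
  obtain v w where "v \<in> cusp.T" "w \<in> cusp.T" "Im (cnj v * w) \<noteq> 0" using rank by (auto simp: cusp.rank2_def)
  moreover have "Im (cnj (\<mu> *\<^sub>R v) * (\<mu> *\<^sub>R w)) = \<mu> * \<mu> * Im (cnj v * w)" by (simp add: algebra_simps)
  ultimately have "Im (cnj (\<mu> *\<^sub>R v) * (\<mu> *\<^sub>R w)) \<noteq> 0" using \<mu> by (metis mult_eq_0_iff less_irrefl)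
  then show ?thesis unfolding C.cusp.rank2_def using T \<open>v \<in> cusp.T\<close> \<open>w \<in> cusp.T\<close> by blast
qed

theorem infinite_simple_closed_geodesics_rank2:
  assumes rank: "cusp.rank2" and g: "g \<in> \<Gamma>" "g \<notin> parabolics"
  shows "infinite (simple_closed_geodesics \<Gamma>)"
proof -
  obtain \<mu> h b r where \<mu>: "\<mu> > 0" and C: "cusp_at_infinity (conj_group (hscale \<mu>) (hscale (1 / \<mu>)) \<Gamma>)"
    and h: "h \<in> conj_group (hscale \<mu>) (hscale (1 / \<mu>)) \<Gamma>" "moves h b r" "r \<ge> 19/20"
    using maximal_cusp[OF g] by blast
  interpret co: coordinate_change "hscale \<mu>" "hscale (1 / \<mu>)" by (rule coordinate_change_hscale[OF \<mu>])
  interpret C: cusp_at_infinity "conj_group (hscale \<mu>) (hscale (1 / \<mu>)) \<Gamma>" by (rule C)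
  show ?thesis
    by (rule co.infinite_geodesics_conj[OF C.infinite_simple_closed_geodesics[OF conj_rank2[OF \<mu> C rank] h]])
qed

end

text \<open>
  Finite volume forces the group to be larger than the cusp group, hence to move infinity, and
  the cusp to have rank 2: otherwise the quotient would contain infinitely many disjoint
  balls of one size.
\<close>

theorem theorem1p2:
  fixes \<Gamma> :: "(hyp3 \<Rightarrow> hyp3) set"
  assumes "hyperbolic_3_manifold \<Gamma>"
  shows "(\<not> elementary \<Gamma> \<and> has_virtually_rank_2_cusp \<Gamma> \<longrightarrow>
            infinite (simple_closed_geodesics \<Gamma>)) \<and>
         (cusped \<Gamma> \<and> manifold_volume \<Gamma> < \<infinity> \<longrightarrow>
            infinite (simple_closed_geodesics \<Gamma>))"
proof (intro conjI impI; elim conjE)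
  assume ne: "\<not> elementary \<Gamma>" and "has_virtually_rank_2_cusp \<Gamma>"
  then obtain H where H: "horocusp \<Gamma> H" and vr: "virtually_rank_2 (cusp_group \<Gamma> H)"
    by (auto simp: has_virtually_rank_2_cusp_def)
  have "horoball H" using H by (simp add: horocusp_def)
  then obtain c c' where co: "coordinate_change c c'" and Hc: "H = {x. height (c x) > 1}"
    and el: "\<And>\<Gamma>. (\<And>g x. g \<in> \<Gamma> \<Longrightarrow> height (c (g x)) = height (c x)) \<Longrightarrow> elementary \<Gamma>"
    using horoball_coordinates by blast
  interpret coordinate_change c c' by (rule co)
  interpret C: cusp_at_infinity "conj_group c c' \<Gamma>" by (rule horocusp_coordinates(1)[OF assms H co Hc])
  note stab = horocusp_coordinates(2)[OF assms H co Hc]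
  have inP: "c \<circ> k \<circ> c' \<in> C.parabolics" if k: "k \<in> set_stabilizer \<Gamma> H" for k
  proof -
    have "k \<in> \<Gamma>" using k by (simp add: set_stabilizer_def)
    then have "c \<circ> k \<circ> c' \<in> conj_group c c' \<Gamma>" "\<forall>x. height (c (k x)) = height (c x)" using stab k by (auto simp: conj_group_def)
    then show ?thesis by (simp add: C.parabolics_def)
  qed
  obtain k1 k2 where k: "k1 \<in> set_stabilizer \<Gamma> H" "k2 \<in> set_stabilizer \<Gamma> H"
    "\<And>n m. k1 ^^ n = k2 ^^ m \<Longrightarrow> n = 0" "\<And>n m. k1 ^^ n \<circ> k2 ^^ m = id \<Longrightarrow> n = 0" "\<And>m. k2 ^^ m = id \<Longrightarrow> m = 0"
    using virtually_rank_2_independent[OF assms vr] by blast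
  have cid: "c \<circ> f \<circ> c' = id \<longleftrightarrow> f = id" for f
  proof -
    have "c \<circ> id \<circ> c' = id" by (simp add: fun_eq_iff)
    then show ?thesis using conj_inject[of f id] by simp
  qed
  have cc: "(c \<circ> f \<circ> c') \<circ> (c \<circ> g \<circ> c') = c \<circ> (f \<circ> g) \<circ> c'" for f g by (simp add: fun_eq_iff)
  have rank: "C.cusp.rank2"
  proof (rule C.rank2_if_independent[OF inP[OF k(1)] inP[OF k(2)]])
    show "n = 0" if "(c \<circ> k1 \<circ> c') ^^ n = (c \<circ> k2 \<circ> c') ^^ m" for n m
      using that k(3) unfolding conj_funpow conj_inject by blast
    show "n = 0" if "(c \<circ> k1 \<circ> c') ^^ n \<circ> (c \<circ> k2 \<circ> c') ^^ m = id" for n m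
      using that k(4) unfolding conj_funpow cc cid by blast
    show "m = 0" if "(c \<circ> k2 \<circ> c') ^^ m = id" for m
      using that k(5) unfolding conj_funpow cid by blast
  qed
  obtain g where g: "g \<in> \<Gamma>" "\<not> (\<forall>x. height (c (g x)) = height (c x))" using el[of \<Gamma>] ne by blast
  have "c \<circ> g \<circ> c' \<notin> C.parabolics"
  proof
    assume "c \<circ> g \<circ> c' \<in> C.parabolics"
    then have "height ((c \<circ> g \<circ> c') (c x)) = height (c x)" for x by (rule C.parabolics_height)
    then show False using g(2) by simp
  qed
  moreover have "c \<circ> g \<circ> c' \<in> conj_group c c' \<Gamma>" using g(1) by (simp add: conj_group_def)
  ultimately show "infinite (simple_closed_geodesics \<Gamma>)"
    using C.infinite_simple_closed_geodesics_rank2[OF rank] infinite_geodesics_conj by blast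
next
  assume "cusped \<Gamma>" and fin: "manifold_volume \<Gamma> < \<infinity>"
  then obtain H where H: "horocusp \<Gamma> H" by (auto simp: cusped_def)
  obtain F where F: "fundamental_set \<Gamma> F" "hyp_volume F < \<infinity>"
    using fin unfolding manifold_volume_def by (auto simp: INF_less_iff)
  have "F \<in> sets borel" using F(1) by (simp add: fundamental_set_def)
  then have vF: "emeasure vol F < \<infinity>" using F(2) hyp_volume_eq by simp
  have "horoball H" using H by (simp add: horocusp_def)
  then obtain c c' where co: "coordinate_change c c'" and Hc: "H = {x. height (c x) > 1}"
    using horoball_coordinates by blast
  interpret coordinate_change c c' by (rule co)
  interpret C: cusp_at_infinity "conj_group c c' \<Gamma>" by (rule horocusp_coordinates(1)[OF assms H co Hc])
  note stab = horocusp_coordinates(2)[OF assms H co Hc]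
  note cF = fundamental_set_conj[OF F(1)]
  have "id \<in> set_stabilizer \<Gamma> H" using group_facts(2)[OF assms] by (simp add: set_stabilizer_def)
  moreover have "set_stabilizer \<Gamma> H \<noteq> {id}" using H by (simp add: horocusp_def hyp_isom_def)
  ultimately obtain k where k: "k \<in> set_stabilizer \<Gamma> H" "k \<noteq> id" by blast
  have kG: "k \<in> \<Gamma>" using k by (simp add: set_stabilizer_def)
  have "c \<circ> k \<circ> c' \<in> conj_group c c' \<Gamma>" "\<forall>x. height (c (k x)) = height (c x)" using stab[OF kG] k kG by (auto simp: conj_group_def)
  then have kP: "c \<circ> k \<circ> c' \<in> C.parabolics" by (simp add: C.parabolics_def)
  have "c \<circ> k \<circ> c' \<noteq> id"
  proof
    assume "c \<circ> k \<circ> c' = id"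
    then have "c \<circ> k \<circ> c' = c \<circ> id \<circ> c'" by (simp add: fun_eq_iff)
    then show False using k(2) unfolding conj_inject by blast
  qed
  then have nt: "C.parabolics \<noteq> {id}" using kP by blast
  have rank: "C.cusp.rank2"
  proof (rule ccontr)
    assume "\<not> C.cusp.rank2"
    from C.infinite_volume_if_not_rank2[OF cF(1) this nt] show False using cF(2) vF by simp
  qed
  have "\<not> conj_group c c' \<Gamma> \<subseteq> C.parabolics"
  proof
    assume "conj_group c c' \<Gamma> \<subseteq> C.parabolics"
    from C.infinite_volume_if_parabolic[OF cF(1) this] show False using cF(2) vF by simp
  qed
  then obtain g where "g \<in> conj_group c c' \<Gamma>" "g \<notin> C.parabolics" by blast
  then show "infinite (simple_closed_geodesics \<Gamma>)"
    using C.infinite_simple_closed_geodesics_rank2[OF rank] infinite_geodesics_conj by blast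
qed

end
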